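(* At least one of the numbers $\beta(2),\beta(4),\beta(6),\beta(8),\beta(10)$ is irrational, where $\beta(s)=\sum_{j=0}^{\infty}\frac{(-1)^j}{(2j+1)^s}$.
   Context: $\beta(s)=L(s,\chi_4)$ is the Dirichlet beta function, $\chi_4$ being the non-principal Dirichlet character modulo $4$; $\beta(2)$ is Catalan's constant. *)

theory Defs
  imports Complex_Main
begin

(* The Dirichlet beta function at positive integer arguments. For s >= 1 the series converges
   (see the lemma below); the value at s = 0, where it diverges, is meaningless. *)
definition dirichlet_beta :: "nat \<Rightarrow> real" where
  "dirichlet_beta s = (\<Sum>j. (-1) ^ j / real (2 * j + 1) ^ s)"

lemma dirichlet_beta_sums:
  assumes "s \<ge> 1"
  shows "(\<lambda>j. (-1) ^ j / real (2 * j + 1) ^ s) sums dirichlet_beta s"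
proof -
  let ?a = "\<lambda>j. 1 / real (2 * j + 1) ^ s"
  have lim: "?a \<longlonglongrightarrow> 0"
  proof (rule tendsto_sandwich[where f = "\<lambda>_. 0" and h = "\<lambda>j. 1 / real (Suc j)"])
    have "?a j \<le> 1 / real (Suc j)" for j
    proof -
      have "real (Suc j) \<le> real (2 * j + 1) ^ 1"
        by simp
      also have "\<dots> \<le> real (2 * j + 1) ^ s"
        by (rule power_increasing) (use assms in auto)
      finally show ?thesis
        by (intro divide_left_mono) auto
    qed
    then show "\<forall>\<^sub>F j in sequentially. ?a j \<le> 1 / real (Suc j)"
      by simp
    show "(\<lambda>j. 1 / real (Suc j)) \<longlonglongrightarrow> 0"
      using LIMSEQ_inverse_real_of_nat by (simp add: inverse_eq_divide)
  qed auto
  have mono: "monoseq ?a"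
    by (intro decseq_imp_monoseq decseq_SucI divide_left_mono power_mono) auto
  have "summable (\<lambda>j. (-1) ^ j * ?a j)"
    by (rule summable_Leibniz(1)[OF lim mono])
  then show ?thesis
    unfolding dirichlet_beta_def by (simp add: summable_sums)
qed

end

theory Submission
  imports Defs "HOL-Analysis.Analysis" "HOL-Computational_Algebra.Computational_Algebra"
begin

text \<open>Let \<open>m = 6 k\<close>, \<open>h = 21 m\<close> and let \<open>R(u)\<close> be \<open>u\<close> times the product of \<open>u\<^sup>2 - (i + 1/2)\<^sup>2\<close> over \<open>0 \<le> i < h\<close>, divided by the
  eleven products of \<open>u - w\<close> over \<open>\<bar>w\<bar> \<le> B m\<close> with \<open>B = 3, 4, 4, 5, 5, 6, 6, 7, 7, 8, 8\<close>. By partial fractions the alternating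
  sum of the values \<open>R(t + 1/2)\<close> is a rational linear form in 1 and \<open>\<beta>(1), \<dots>, \<beta>(11)\<close>, and the symmetry
  of \<open>R\<close> removes the odd arguments.

  The sum is, up to sign, the value at \<open>z = 1\<close> of a power series that arises from an explicit rational function with
  denominator \<open>(1 + z)\<^bsup>2 h + 2\<^esup>\<close> by dividing the coefficients successively by linear factors \<open>n + a\<close>. Each division is an
  integration which preserves positivity and upper bounds of the form \<open>K z\<^bsup>-s\<^esup>\<close>; hence the linear form is positive and
  explicitly small.

  Counting poles and zeros modulo prime powers bounds the denominators of the coefficients prime by prime through a
  step function of \<open>m / p\<close>. The resulting sum of \<open>ln p\<close> with step function weights is as small as the prime number
  theorem predicts for infinitely many \<open>k\<close>, by averaging Mertens' theorem. For these \<open>k\<close>, if the five beta values were rational,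
  the linear form times its denominator would be a positive integer below 1.\<close>

section \<open>Partial fractions\<close>

text \<open>The \<open>k ln k\<close> terms of the estimates cancel because 7 * 72 + 252 = 756 = 12
  * 63, where 63 is the sum of the radii \<open>B\<close>. The linear terms then leave a margin
  below 4 per unit of \<open>k\<close>, against a contribution of 499 from the primes: an error of
  one percent in the prime sum would be fatal. This is why denominators are computed prime by prime
  and why Chebyshev's bounds are too weak.

  The half-integer zeros serve twice. They remove the first \<open>h\<close> terms of the sum, and
  modulo an odd prime power they count against the poles; the price is an extra power of 2. The sum
  alternates, so a bound term by term would lose its cancellation, which the denominator (1 + z)^(2
  h + 2) retains. Positivity moreover shows that the linear form does not vanish.

  The exponent \<open>s\<close> in the bounds K z^(-s) is a free parameter. The choice s = k = m / 6
  is the reason for m = 6 k, and z^k / (1 + z)^(252 k) is then largest at z = 1 / 251.\<close>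

lemma pcompose_power: "pcompose (p ^ n) r = pcompose p r ^ n" for p :: "'a::comm_semiring_1 poly"
  by (induction n) (simp_all add: pcompose_mult pcompose_1)

text \<open>Translating \<open>v\<close> to 0 turns the order of vanishing at \<open>v\<close> into
  the number of vanishing lowest coefficients, which a power series computation can check.\<close>

lemma linear_power_dvd_of_coeffs:
  fixes P :: "'a::field poly"
  assumes "\<And>k. k < q \<Longrightarrow> coeff (pcompose P [:v, 1:]) k = 0"
  shows "[:- v, 1:] ^ q dvd P"
proof -
  have "monom 1 q dvd pcompose P [:v, 1:]"
    using assms by (simp add: monom_1_dvd_iff')
  then obtain R where "pcompose P [:v, 1:] = monom 1 q * R" by (elim dvdE)
  then have "pcompose (pcompose P [:v, 1:]) [:- v, 1:] = pcompose (monom 1 q) [:- v, 1:] * pcompose R [:- v, 1:]"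
    by (simp add: pcompose_mult)
  moreover have "pcompose (monom 1 q) [:- v, 1:] = [:- v, 1:] ^ q"
    by (simp add: monom_altdef pcompose_pCons pcompose_power)
  moreover have "pcompose (pcompose P [:v, 1:]) [:- v, 1:] = P"
    by (simp add: pcompose_assoc[symmetric] pcompose_pCons)
  ultimately show ?thesis by simp
qed

lemma prod_linear_power_dvd:
  fixes P :: "'a::field poly"
  assumes "finite V" "\<And>v. v \<in> V \<Longrightarrow> [:- v, 1:] ^ q v dvd P"
  shows "(\<Prod>v\<in>V. [:- v, 1:] ^ q v) dvd P"
  using assms
proof (induction V arbitrary: P rule: finite_induct)
  case (insert a V)
  show ?case
  proof (cases "P = 0")
    case False
    from insert.prems obtain Q where Q: "P = [:- a, 1:] ^ q a * Q" by (auto elim: dvdE)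
    with False have "Q \<noteq> 0" by auto
    have "[:- v, 1:] ^ q v dvd Q" if "v \<in> V" for v
    proof -
      have "v \<noteq> a" using that insert by auto
      then have "order v ([:- a, 1:] ^ q a) = 0" by (intro order_0I) simp
      moreover have "q v \<le> order v P"
        using insert.prems[of v] that False by (simp add: order_divides)
      ultimately have "q v \<le> order v Q" using False unfolding Q by (simp add: order_mult)
      then show ?thesis by (simp add: order_divides)
    qed
    then have "(\<Prod>v\<in>V. [:- v, 1:] ^ q v) dvd Q" by (rule insert.IH)
    then show ?thesis using insert Q by (simp add: mult_dvd_mono)
  qed simp
qed simp

text \<open>Expansion of \<open>(u - v)\<^sup>q \<cdot> R(u)\<close> at \<open>u = v\<close>, where \<open>q\<close> is the order of the pole \<open>v\<close> of \<open>R\<close>.\<close>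
definition local_series :: "'a::field poly \<Rightarrow> 'a set \<Rightarrow> ('a \<Rightarrow> nat) \<Rightarrow> 'a \<Rightarrow> 'a fps" where
  "local_series N V q v = fps_of_poly (pcompose N [:v, 1:]) * (\<Prod>w\<in>V - {v}. inverse (fps_X + fps_const (v - w)) ^ q w)"

text \<open>The truncated expansions \<open>T v\<close>, multiplied by the cofactors
  \<open>E v\<close>, add up to a polynomial \<open>S\<close> that agrees with \<open>N\<close> to
  order \<open>q v\<close> at every pole. Hence the full denominator divides \<open>N - S\<close>,
  whose degree is smaller, and \<open>N = S\<close>.\<close>

proposition partial_fractions:
  fixes N :: "'a::field poly"
  assumes V: "finite V" and deg: "degree N < (\<Sum>v\<in>V. q v)" and u: "u \<notin> V"
  shows "poly N u / (\<Prod>w\<in>V. (u - w) ^ q w) = (\<Sum>v\<in>V. \<Sum>k<q v. local_series N V q v $ k / (u - v) ^ (q v - k))"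
proof -
  define E where "E v = (\<Prod>w\<in>V - {v}. [:- w, 1:] ^ q w)" for v :: 'a
  define D where "D = (\<Prod>w\<in>V. [:- w, 1:] ^ q w)"
  define T where "T v = (\<Sum>k<q v. smult (local_series N V q v $ k) ([:- v, 1:] ^ k))" for v
  define S where "S = (\<Sum>v\<in>V. T v * E v)"
  have DE: "D = [:- v, 1:] ^ q v * E v" if "v \<in> V" for v
    unfolding D_def E_def using V that by (simp add: prod.remove)
  have degD: "degree D = (\<Sum>v\<in>V. q v)"
    unfolding D_def by (subst degree_prod_sum_eq) (auto simp: degree_power_eq)
  have D0: "D \<noteq> 0" unfolding D_def using V by auto
  have degTE: "degree (T v * E v) < degree D" if "v \<in> V" for v
  proof (cases "T v = 0 \<or> E v = 0 \<or> q v = 0")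
    case True
    then have *: "T v * E v = 0" unfolding T_def by auto
    show ?thesis unfolding * using deg degD by simp
  next
    case False
    have "degree (smult (local_series N V q v $ k) ([:- v, 1:] ^ k)) \<le> q v - 1" if "k < q v" for k
      using that by (intro order.trans[OF degree_smult_le]) (auto simp: degree_linear_power)
    then have "degree (T v) \<le> q v - 1"
      unfolding T_def by (intro degree_sum_le) auto
    then have "degree (T v) < degree ([:- v, 1:] ^ q v)" using False by (auto simp: degree_linear_power)
    then show ?thesis
      using False DE[OF that] by (simp add: degree_mult_eq)
  qed
  have degS: "degree S < degree D"
  proof -
    have "degree S \<le> degree D - 1"
      unfolding S_def using V degTE by (intro degree_sum_le) fastforce+
    then show ?thesis using deg degD by simp
  qed
  have "[:- v, 1:] ^ q v dvd N - S" if v: "v \<in> V" for v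
  proof -
    have "[:- v, 1:] ^ q v dvd N - T v * E v"
    proof (rule linear_power_dvd_of_coeffs)
      fix k assume k: "k < q v"
      let ?L = "local_series N V q v" and ?F = "\<Prod>w\<in>V - {v}. (fps_X + fps_const (v - w)) ^ q w"
      have FE: "fps_of_poly (pcompose (E v) [:v, 1:]) = ?F"
        unfolding E_def by (simp add: pcompose_prod pcompose_power fps_of_poly_prod fps_of_poly_power
            pcompose_pCons fps_of_poly_linear)
      have FT: "fps_of_poly (pcompose (T v) [:v, 1:]) = fps_cutoff (q v) ?L"
      proof -
        have "pcompose (T v) [:v, 1:] = (\<Sum>k<q v. monom (?L $ k) k)"
          unfolding T_def by (simp add: pcompose_sum pcompose_smult pcompose_power pcompose_pCons monom_altdef)
        then show ?thesis
          by (intro fps_ext) (auto simp: coeff_sum if_distrib cong: if_cong)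
      qed
      have inv: "inverse (fps_X + fps_const (v - w)) ^ q w * (fps_X + fps_const (v - w)) ^ q w = 1"
        if "w \<in> V - {v}" for w
      proof -
        have "(fps_X + fps_const (v - w)) $ 0 \<noteq> 0" using that by auto
        then have "inverse (fps_X + fps_const (v - w)) * (fps_X + fps_const (v - w)) = 1" by (rule inverse_mult_eq_1)
        then show ?thesis by (simp add: power_mult_distrib[symmetric])
      qed
      have "(\<Prod>w\<in>V - {v}. inverse (fps_X + fps_const (v - w)) ^ q w) * ?F = 1"
        unfolding prod.distrib[symmetric] using inv by simp
      then have LF: "?L * ?F = fps_of_poly (pcompose N [:v, 1:])"
        unfolding local_series_def by (simp add: mult.assoc)
      \<comment> \<open>Up to the cofactor, the error is the tail of the local expansion, whose
        first \<open>q v\<close> coefficients vanish.\<close>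
      have "fps_of_poly (pcompose (N - T v * E v) [:v, 1:]) = (?L - fps_cutoff (q v) ?L) * ?F"
        by (simp add: pcompose_diff pcompose_mult fps_of_poly_diff fps_of_poly_mult FE FT LF left_diff_distrib)
      then have "coeff (pcompose (N - T v * E v) [:v, 1:]) k = ((?L - fps_cutoff (q v) ?L) * ?F) $ k"
        by (metis fps_of_poly_nth)
      also have "\<dots> = 0" using k by (simp add: fps_mult_nth)
      finally show "coeff (pcompose (N - T v * E v) [:v, 1:]) k = 0" .
    qed
    moreover have "[:- v, 1:] ^ q v dvd (\<Sum>x\<in>V - {v}. T x * E x)"
    proof (intro dvd_sum dvd_mult)
      fix x assume "x \<in> V - {v}"
      then have "v \<in> V - {x}" using v by auto
      then show "[:- v, 1:] ^ q v dvd E x" unfolding E_def using V by (intro dvd_prodI) auto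
    qed
    moreover have "N - S = (N - T v * E v) - (\<Sum>x\<in>V - {v}. T x * E x)"
      unfolding S_def using V v by (simp add: sum.remove)
    ultimately show ?thesis by (metis dvd_diff)
  qed
  then have "D dvd N - S" unfolding D_def by (intro prod_linear_power_dvd V)
  moreover have "degree (N - S) < degree D"
    using degS deg degD by (intro degree_diff_less) auto
  ultimately have "N = S" using dvd_imp_degree_le[of D "N - S"] D0 by force
  have prod_nz: "(\<Prod>w\<in>A. (u - w) ^ q w) \<noteq> 0" if "A \<subseteq> V" for A
    using that u V by (auto simp: finite_subset)
  have "poly N u / (\<Prod>w\<in>V. (u - w) ^ q w) = (\<Sum>v\<in>V. poly (T v) u * poly (E v) u / (\<Prod>w\<in>V. (u - w) ^ q w))"
    by (subst \<open>N = S\<close>) (simp add: S_def poly_sum sum_divide_distrib)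
  also have "\<dots> = (\<Sum>v\<in>V. \<Sum>k<q v. local_series N V q v $ k / (u - v) ^ (q v - k))"
  proof (rule sum.cong)
    fix v assume v: "v \<in> V"
    have "poly (E v) u = (\<Prod>w\<in>V - {v}. (u - w) ^ q w)" unfolding E_def by (simp add: poly_prod)
    moreover have "(\<Prod>w\<in>V. (u - w) ^ q w) = (u - v) ^ q v * (\<Prod>w\<in>V - {v}. (u - w) ^ q w)"
      using V v by (simp add: prod.remove)
    ultimately have "poly (T v) u * poly (E v) u / (\<Prod>w\<in>V. (u - w) ^ q w) = poly (T v) u / (u - v) ^ q v"
      using prod_nz[of "V - {v}"] by auto
    also have "\<dots> = (\<Sum>k<q v. local_series N V q v $ k * (u - v) ^ k / (u - v) ^ q v)"
      unfolding T_def by (simp add: poly_sum sum_divide_distrib)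
    also have "\<dots> = (\<Sum>k<q v. local_series N V q v $ k / (u - v) ^ (q v - k))"
    proof (intro sum.cong refl)
      fix k assume "k \<in> {..<q v}"
      then have "(u - v) ^ q v = (u - v) ^ k * (u - v) ^ (q v - k)" by (simp flip: power_add)
      moreover have "u - v \<noteq> 0" using u v by auto
      ultimately show "local_series N V q v $ k * (u - v) ^ k / (u - v) ^ q v = local_series N V q v $ k / (u - v) ^ (q v - k)"
        by simp
    qed
    finally show "poly (T v) u * poly (E v) u / (\<Prod>w\<in>V. (u - w) ^ q w) =
       (\<Sum>k<q v. local_series N V q v $ k / (u - v) ^ (q v - k))" .
  qed simp
  finally show ?thesis .
qed

section \<open>Valuations of coefficients\<close>

text \<open>\<open>x\<close> is rational and has \<open>p\<close>-adic valuation at least \<open>e\<close>.\<close>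
definition vge :: "nat \<Rightarrow> int \<Rightarrow> real \<Rightarrow> bool" where
  "vge p e x \<longleftrightarrow> (\<exists>a b :: int. \<not> int p dvd b \<and> x * of_int b = of_int a * of_nat p powi e)"

lemma vge_0 [simp]: "prime p \<Longrightarrow> vge p e 0"
  unfolding vge_def by (rule exI[of _ 0], rule exI[of _ 1]) (auto simp: not_prime_1)

lemma vge_minus_iff [simp]: "vge p e (- x) \<longleftrightarrow> vge p e x"
proof -
  have "vge p e (- x)" if "vge p e x" for x
  proof -
    from that obtain a b where "\<not> int p dvd b" "x * of_int b = of_int a * of_nat p powi e"
      unfolding vge_def by auto
    then show ?thesis unfolding vge_def by (intro exI[of _ "- a"] exI[of _ b]) auto
  qed
  from this[of x] this[of "- x"] show ?thesis by auto
qed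

lemma vge_mult:
  assumes "prime p" "vge p e x" "vge p f y"
  shows "vge p (e + f) (x * y)"
proof -
  obtain a b c d where "\<not> int p dvd b" "x * of_int b = of_int a * of_nat p powi e"
    "\<not> int p dvd d" "y * of_int d = of_int c * of_nat p powi f"
    using assms unfolding vge_def by metis
  moreover have "p > 0" using assms by (simp add: prime_gt_0_nat)
  moreover have "\<not> int p dvd b * d"
    using calculation assms by (simp add: prime_dvd_mult_iff)
  moreover have "x * y * of_int (b * d) = (x * of_int b) * (y * of_int d)" by simp
  ultimately show ?thesis
    unfolding vge_def by (intro exI[of _ "a * c"] exI[of _ "b * d"]) (simp add: power_int_add)
qed

lemma vge_mono:
  assumes "prime p" "vge p e x" "f \<le> e"
  shows "vge p f x"
proof -
  obtain a b where ab: "\<not> int p dvd b" "x * of_int b = of_int a * of_nat p powi e"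
    using assms unfolding vge_def by metis
  have p: "p > 0" using assms by (simp add: prime_gt_0_nat)
  have "of_nat p powi e = of_nat p powi f * (of_nat p :: real) ^ nat (e - f)"
    using p assms(3) by (simp flip: power_int_of_nat power_int_add)
  then show ?thesis unfolding vge_def using ab
    by (intro exI[of _ "a * int p ^ nat (e - f)"] exI[of _ b]) simp
qed

lemma vge_add:
  assumes "prime p" "vge p e x" "vge p e y"
  shows "vge p e (x + y)"
proof -
  obtain a b c d where *: "\<not> int p dvd b" "x * of_int b = of_int a * of_nat p powi e"
    "\<not> int p dvd d" "y * of_int d = of_int c * of_nat p powi e"
    using assms unfolding vge_def by metis
  have "\<not> int p dvd b * d"
    using * assms by (simp add: prime_dvd_mult_iff)
  moreover have "(x + y) * of_int (b * d) = (x * of_int b) * of_int d + (y * of_int d) * of_int b"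
    by (simp add: algebra_simps)
  then have "(x + y) * of_int (b * d) = of_int (a * d + c * b) * of_nat p powi e"
    unfolding * by (simp add: algebra_simps)
  ultimately show ?thesis unfolding vge_def by blast
qed

lemma vge_sum:
  assumes "prime p" "\<And>i. i \<in> A \<Longrightarrow> vge p e (f i)"
  shows "vge p e (sum f A)"
  using assms(2) by (induction A rule: infinite_finite_induct) (auto intro: vge_add assms(1) vge_0)

lemma vge_of_int:
  assumes "prime p" shows "vge p 0 (of_int n)"
  unfolding vge_def using assms by (intro exI[of _ n] exI[of _ 1]) (auto simp: not_prime_1)

lemma vge_1: "prime p \<Longrightarrow> vge p 0 1"
  using vge_of_int[of p 1] by simp

lemma vge_of_dvd:
  assumes "prime p" "int p ^ e dvd n" shows "vge p (int e) (of_int n)"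
proof -
  from assms(2) obtain a where "n = int p ^ e * a" by (elim dvdE)
  then show ?thesis
    unfolding vge_def using assms(1) by (intro exI[of _ a] exI[of _ 1]) (auto simp: not_prime_1)
qed

lemma multiplicity_split:
  assumes "prime p" "n \<noteq> 0"
  obtains m where "n = int p ^ multiplicity (int p) n * m" "\<not> int p dvd m"
proof -
  have "\<not> is_unit (int p)" using assms(1) not_prime_1 by (auto simp: zdvd1_eq)
  from multiplicity_decompose'[OF assms(2) this] show ?thesis using that by metis
qed

lemma vge_multiplicity:
  assumes "prime p" "n \<noteq> 0" shows "vge p (int (multiplicity (int p) n)) (of_int n)"
  using assms by (intro vge_of_dvd) (auto simp: multiplicity_dvd)

lemma vge_inverse:
  assumes "prime p" "n \<noteq> 0" shows "vge p (- int (multiplicity (int p) n)) (1 / of_int n)"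
proof -
  obtain m where m: "n = int p ^ multiplicity (int p) n * m" "\<not> int p dvd m"
    using multiplicity_split[OF assms] .
  have p: "p > 0" using assms by (simp add: prime_gt_0_nat)
  have "m \<noteq> 0" using m(2) by auto
  have rn: "real_of_int n = of_nat p ^ multiplicity (int p) n * of_int m"
    using m(1) by (metis of_int_mult of_int_of_nat_eq of_int_power)
  have "1 / of_int n * of_int m = (1 :: real) / of_nat p ^ multiplicity (int p) n"
    unfolding rn using p \<open>m \<noteq> 0\<close> by simp
  then show ?thesis
    unfolding vge_def using m(2) p by (intro exI[of _ 1] exI[of _ m]) (simp add: power_int_minus inverse_eq_divide)
qed

lemma vge_power:
  assumes "prime p" "vge p e x" shows "vge p (int k * e) (x ^ k)"
proof (induction k)
  case (Suc k)
  have "int (Suc k) * e = e + int k * e" by (simp add: algebra_simps)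
  then show ?case using vge_mult[OF assms Suc] by simp
qed (simp add: vge_1 assms)

text \<open>\<open>vge\<close> for a single prime already makes \<open>x\<close> rational; a prime
  factor of the reduced denominator would contradict \<open>vge\<close> for that prime.\<close>

lemma Ints_if_vge:
  fixes x :: real
  assumes "\<And>p. prime p \<Longrightarrow> vge p 0 x"
  shows "x \<in> \<int>"
proof -
  obtain a b where ab: "\<not> int 2 dvd b" "x * of_int b = of_int a"
    using assms[of 2] unfolding vge_def by auto
  have "b \<noteq> 0" using ab(1) by auto
  then have "x = of_int a / of_int b" using ab by (simp add: field_simps)
  then have "x \<in> \<rat>" by auto
  then obtain a b where x: "x = of_int a / of_int b" and b: "b > 0" and co: "coprime a b"
    by (rule Rats_cases')
  have "b = 1"
  proof (rule ccontr)
    assume "b \<noteq> 1"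
    then have "nat b \<noteq> 1" using b by simp
    then obtain p where p: "prime p" "p dvd nat b" using prime_factor_nat by blast
    then have pb: "int p dvd b" using b by (metis int_dvd_int_iff int_nat_eq less_imp_le of_nat_dvd_iff int_eq_iff)
    obtain c d where cd: "\<not> int p dvd d" "x * of_int d = of_int c"
      using assms[OF p(1)] unfolding vge_def by auto
    then have "real_of_int (a * d) = of_int (c * b)" using x b by (simp add: field_simps)
    then have "a * d = c * b" by linarith
    then have "int p dvd a * d" using pb by simp
    then have "int p dvd a" using p(1) cd(1) by (simp add: prime_dvd_mult_iff)
    then have "is_unit (int p)" using pb co by (metis coprime_common_divisor)
    then show False using p(1) not_prime_1 by (auto simp: zdvd1_eq)
  qed
  then show ?thesis using x by simp
qed

text \<open>Equivalently, all coefficients of F(p^L X) have valuation at least \<open>e\<close>,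
  which makes the property multiplicative. The loss of \<open>L\<close> per index is the price of
  one more division by a number of valuation at most \<open>L\<close>.\<close>

definition fps_vge :: "nat \<Rightarrow> nat \<Rightarrow> int \<Rightarrow> real fps \<Rightarrow> bool" where
  "fps_vge p L e F \<longleftrightarrow> (\<forall>k. vge p (e - int L * int k) (F $ k))"

lemma fps_vge_mult:
  assumes "prime p" "fps_vge p L e F" "fps_vge p L f G"
  shows "fps_vge p L (e + f) (F * G)"
  unfolding fps_vge_def fps_mult_nth
proof (intro allI vge_sum assms(1))
  fix k i :: nat assume "i \<in> {0..k}"
  then have "(e - int L * int i) + (f - int L * int (k - i)) = e + f - int L * int k"
    by (simp add: of_nat_diff algebra_simps)
  then show "vge p (e + f - int L * int k) (F $ i * G $ (k - i))"
    using assms vge_mult unfolding fps_vge_def by metis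
qed

lemma fps_vge_1: "prime p \<Longrightarrow> fps_vge p L 0 1"
  unfolding fps_vge_def by (auto simp: vge_1 vge_0)

lemma fps_vge_prod:
  assumes "prime p" "\<And>i. i \<in> A \<Longrightarrow> fps_vge p L (e i) (F i)"
  shows "fps_vge p L (sum e A) (prod F A)"
  using assms(2) by (induction A rule: infinite_finite_induct) (auto intro: fps_vge_mult fps_vge_1 assms(1))

lemma fps_vge_power:
  assumes "prime p" "fps_vge p L e F"
  shows "fps_vge p L (int n * e) (F ^ n)"
proof (induction n)
  case (Suc n)
  have "int (Suc n) * e = e + int n * e" by (simp add: algebra_simps)
  then show ?case using fps_vge_mult[OF assms Suc] by simp
qed (simp add: fps_vge_1 assms)

lemma fps_vge_linear:
  assumes "prime p" "vge p e d" "e \<le> int L"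
  shows "fps_vge p L e (fps_X + fps_const d)"
  unfolding fps_vge_def
proof
  fix k :: nat
  consider "k = 0" | "k = 1" | "k > 1" by linarith
  then show "vge p (e - int L * int k) ((fps_X + fps_const d) $ k)"
  proof cases
    case 2
    have "vge p (e - int L) 1" by (rule vge_mono[OF assms(1) vge_1[OF assms(1)]]) (use assms in simp)
    then show ?thesis using 2 by simp
  qed (use assms in auto)
qed

lemma inverse_fps_linear:
  assumes "d \<noteq> (0 :: real)"
  shows "inverse (fps_X + fps_const d) = Abs_fps (\<lambda>k. (- 1) ^ k / d ^ Suc k)"
proof (rule fps_inverse_unique)
  show "(fps_X + fps_const d) * Abs_fps (\<lambda>k. (- 1) ^ k / d ^ Suc k) = 1"
  proof (rule fps_ext)
    fix k show "((fps_X + fps_const d) * Abs_fps (\<lambda>k. (- 1) ^ k / d ^ Suc k)) $ k = (1 :: real fps) $ k"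
      using assms by (cases k) (simp_all add: distrib_right field_simps)
  qed
qed

text \<open>Up to sign, coefficient \<open>k\<close> is the power \<open>k + 1\<close> of 1 / n. One
  factor gives the leading exponent, each of the others costs at most \<open>L\<close>.\<close>

lemma fps_vge_inverse_linear:
  assumes "prime p" "n \<noteq> 0" "multiplicity (int p) n \<le> L"
  shows "fps_vge p L (- int (multiplicity (int p) n)) (inverse (fps_X + fps_const (of_int n)))"
  unfolding fps_vge_def
proof
  fix k
  let ?e = "int (multiplicity (int p) n)"
  have "vge p (int (Suc k) * - ?e) ((1 / of_int n) ^ Suc k)"
    using assms by (intro vge_power vge_inverse)
  moreover have "- ?e - int L * int k \<le> int (Suc k) * - ?e"
    using mult_left_mono[of ?e "int L" "int k"] assms(3) by (simp add: algebra_simps)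
  ultimately have "vge p (- ?e - int L * int k) ((1 / of_int n) ^ Suc k)"
    using vge_mono assms(1) by blast
  then have "vge p (- ?e - int L * int k) ((- 1) ^ k * (1 / of_int n) ^ Suc k)"
    by (cases "even k") (simp_all del: power_Suc)
  then show "vge p (- ?e - int L * int k) (inverse (fps_X + fps_const (real_of_int n)) $ k)"
    using assms(2) by (simp add: inverse_fps_linear power_divide del: power_Suc)
qed

text \<open>Writes a valuation as a count over prime powers, so that sums of valuations over poles
  or zeros can be exchanged with the sum over \<open>l\<close> and become counts of
  multiples.\<close>

lemma multiplicity_eq_sum:
  assumes "prime p" "n \<noteq> 0" "\<bar>n\<bar> < int p ^ Suc L"
  shows "int (multiplicity (int p) n) = (\<Sum>l=1..L. if int p ^ l dvd n then 1 else 0)" "multiplicity (int p) n \<le> L"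
proof -
  let ?m = "multiplicity (int p) n"
  have nu: "\<not> is_unit (int p)" using assms(1) not_prime_1 by (auto simp: zdvd1_eq)
  have iff: "int p ^ l dvd n \<longleftrightarrow> l \<le> ?m" for l
    using assms(2) nu by (intro power_dvd_iff_le_multiplicity) auto
  have p1: "int p > 1" using prime_gt_1_nat[OF assms(1)] by simp
  have "int p ^ ?m \<le> \<bar>n\<bar>" using dvd_imp_le_int[of n "int p ^ ?m"] iff[of ?m] assms(2) by simp
  also note assms(3)
  finally show le: "?m \<le> L" using p1 by (simp add: power_strict_increasing_iff flip: power_Suc)
  have "(\<Sum>l=1..L. if int p ^ l dvd n then 1 else 0) = int (card {l \<in> {1..L}. l \<le> ?m})"
    unfolding iff by (simp add: sum.If_cases Int_def)
  also have "{l \<in> {1..L}. l \<le> ?m} = {1..?m}" using le by auto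
  finally show "int ?m = (\<Sum>l=1..L. if int p ^ l dvd n then 1 else 0)" by simp
qed

text \<open>\<open>(- a) div P\<close> is minus the ceiling of a / P. The hypothesis
  \<open>a \<le> b + 1\<close> keeps the right-hand side nonnegative, so that the formula also
  covers intervals without multiples.\<close>

lemma card_multiples:
  fixes a b P :: int
  assumes "P > 0" "a \<le> b + 1"
  shows "int (card {w \<in> {a..b}. P dvd w}) = b div P + (- a) div P + 1"
proof -
  let ?A = "{- ((- a) div P)..b div P}"
  have eq: "{w \<in> {a..b}. P dvd w} = (\<lambda>k. P * k) ` ?A"
  proof (intro equalityI subsetI)
    fix w assume "w \<in> {w \<in> {a..b}. P dvd w}"
    then obtain k where k: "w = P * k" "a \<le> P * k" "P * k \<le> b" by (auto elim: dvdE)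
    have "(P * k) div P \<le> b div P" using k assms by (intro zdiv_mono1) auto
    moreover have "(P * - k) div P \<le> (- a) div P" using k assms by (intro zdiv_mono1) auto
    ultimately have "k \<le> b div P" "- k \<le> (- a) div P"
      using assms by (metis nonzero_mult_div_cancel_left less_irrefl)+
    then show "w \<in> (\<lambda>k. P * k) ` ?A" using k by (intro image_eqI[of _ _ k]) auto
  next
    fix w assume "w \<in> (\<lambda>k. P * k) ` ?A"
    then obtain k where "k \<in> ?A" and k1: "w = P * k" by (elim imageE)
    then have k: "w = P * k" "- ((- a) div P) \<le> k" "k \<le> b div P" by simp_all
    have "P * k \<le> P * (b div P)" using k assms by (intro mult_left_mono) auto
    also have "\<dots> \<le> b" using assms by (simp add: minus_mod_eq_mult_div[symmetric])
    finally have "w \<le> b" using k by simp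
    moreover have "P * (- k) \<le> P * ((- a) div P)" using k assms by (intro mult_left_mono) auto
    then have "P * (- k) \<le> - a" using assms by (simp add: minus_mod_eq_mult_div[symmetric]) (smt (verit) pos_mod_sign)
    ultimately show "w \<in> {w \<in> {a..b}. P dvd w}" using k by auto
  qed
  have "card {w \<in> {a..b}. P dvd w} = card ?A"
    unfolding eq using assms by (intro card_image inj_onI) auto
  moreover have "- (b div P) \<le> (- a) div P + 1"
  proof -
    have "b - b mod P = P * (b div P)" "- a - (- a) mod P = P * ((- a) div P)"
      by (simp_all add: minus_mod_eq_mult_div)
    moreover have "b mod P < P" "(- a) mod P < P" using assms by simp_all
    ultimately have "- (P * (b div P)) < P * ((- a) div P) + 2 * P"
      using assms(2) by linarith
    then have "P * (- (b div P)) < P * ((- a) div P + 2)" by (simp add: algebra_simps)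
    then have "- (b div P) < (- a) div P + 2" using mult_less_cancel_left_pos[OF assms(1)] by blast
    then show ?thesis by simp
  qed
  ultimately show ?thesis by simp
qed

section \<open>The local cost function\<close>

text \<open>The contribution of an odd prime power \<open>P\<close> to the exponent of its prime in the denominators of the
  coefficients at the pole \<open>v\<close>: the poles congruent to \<open>v\<close> modulo \<open>P\<close> are counted against the zeros, which are
  half-integers, hence the shift by \<open>P div 2\<close>.\<close>
definition gcost :: "int list \<Rightarrow> int \<Rightarrow> int \<Rightarrow> int \<Rightarrow> int" where
  "gcost ns h P v = int (length ns) + (\<Sum>n\<leftarrow>ns. (n + v) div P + (n - v) div P)
     - ((h + v + P div 2) div P + (h - v + P div 2) div P)"

lemma div_diff_one_eq:
  fixes a P :: int
  assumes "P > 0" "\<not> P dvd a"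
  shows "(a - 1) div P = a div P"
proof -
  have "a mod P > 0"
    using assms pos_mod_sign[of P a] by (simp add: dvd_eq_mod_eq_0 order_less_le)
  moreover have "a mod P < P" using assms by simp
  moreover have "a = P * (a div P) + a mod P" by simp
  ultimately have "a - 1 = P * (a div P) + (a mod P - 1)" "0 \<le> a mod P - 1" "a mod P - 1 < P" by linarith+
  then show ?thesis
    by (metis div_mult_self4 div_pos_pos_trivial add_0 assms(1) less_irrefl add.commute add.right_neutral)
qed

lemma div_add_one_eq:
  fixes a P :: int
  assumes "P > 0" "\<not> P dvd (a + 1)"
  shows "(a + 1) div P = a div P"
  using div_diff_one_eq[OF assms] by simp

lemma gcost_uminus: "gcost ns h P (- v) = gcost ns h P v"
  by (simp add: gcost_def add.commute)

text \<open>From \<open>v - 1\<close> to \<open>v\<close>, the floor of (n + v) / P rises only if P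
  divides n + v, and the zero count \<open>(h - v + P div 2) div P\<close> drops only if P divides h
  + P div 2 + 1 - v. The remaining floors can only lower the cost.\<close>

lemma gcost_step:
  assumes "P > 0" "\<forall>n\<in>set ns. \<not> P dvd n + v" "\<not> P dvd h + P div 2 + 1 - v"
  shows "gcost ns h P v \<le> gcost ns h P (v - 1)"
proof -
  have "(\<Sum>n\<leftarrow>ns. (n + v) div P + (n - v) div P) \<le> (\<Sum>n\<leftarrow>ns. (n + (v - 1)) div P + (n - (v - 1)) div P)"
  proof (rule sum_list_mono)
    fix n assume "n \<in> set ns"
    then have "(n + (v - 1)) div P = (n + v) div P"
      using div_diff_one_eq[of P "n + v"] assms by (simp add: algebra_simps)
    moreover have "(n - v) div P \<le> (n - (v - 1)) div P"
      using assms(1) by (intro zdiv_mono1) auto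
    ultimately show "(n + v) div P + (n - v) div P \<le> (n + (v - 1)) div P + (n - (v - 1)) div P" by simp
  qed
  moreover have "(h + (v - 1) + P div 2) div P \<le> (h + v + P div 2) div P"
    using assms(1) by (intro zdiv_mono1) auto
  moreover have "(h - (v - 1) + P div 2) div P = (h - v + P div 2) div P"
    using div_add_one_eq[of P "h - v + P div 2"] assms by (simp add: algebra_simps)
  ultimately show ?thesis unfolding gcost_def by linarith
qed

text \<open>By \<open>gcost_step\<close> the cost can increase with \<open>v\<close> only at points of two kinds, so it is at most its value at the
  last such point before \<open>v\<close>.\<close>
lemma gcost_le_candidate:
  assumes "P > 0" "ns \<noteq> []"
  obtains v0 where "gcost ns h P v \<le> gcost ns h P v0" "v0 \<le> v"
    "(\<exists>n\<in>set ns. P dvd n + v0) \<or> P dvd h + P div 2 + 1 - v0"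
    "\<And>u. u \<le> v \<Longrightarrow> (\<exists>n\<in>set ns. P dvd n + u) \<Longrightarrow> u \<le> v0"
proof -
  define S where "S u \<longleftrightarrow> (\<exists>n\<in>set ns. P dvd n + u) \<or> P dvd h + P div 2 + 1 - u" for u
  have ex: "\<exists>t. S (v - int t)"
  proof -
    obtain n where n: "n \<in> set ns" using assms by (cases ns) auto
    have "P dvd n + (v - (n + v) mod P)"
      by (metis add_diff_eq minus_mod_eq_mult_div dvd_triv_left)
    moreover have "int (nat ((n + v) mod P)) = (n + v) mod P" using assms by simp
    ultimately have "S (v - int (nat ((n + v) mod P)))" unfolding S_def using n by metis
    then show ?thesis by blast
  qed
  define t where "t = (LEAST t. S (v - int t))"
  have St: "S (v - int t)" unfolding t_def using ex by (rule LeastI_ex)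
  have min: "\<not> S (v - int k)" if "k < t" for k
    using not_less_Least that unfolding t_def by blast
  have "gcost ns h P v \<le> gcost ns h P (v - int k)" if "k \<le> t" for k
    using that
  proof (induction k)
    case (Suc k)
    then have "\<not> S (v - int k)" using min by simp
    then have "gcost ns h P (v - int k) \<le> gcost ns h P (v - int k - 1)"
      unfolding S_def by (intro gcost_step assms(1)) auto
    also have "v - int k - 1 = v - int (Suc k)" by simp
    finally show ?case using Suc by simp
  qed simp
  \<comment> \<open>No pole candidate is skipped on the way down; in \<open>gcost_le_weight\<close>
    this keeps \<open>v0\<close> at least \<open>P - 8 * m\<close>.\<close>
  moreover have "u \<le> v - int t" if "u \<le> v" "\<exists>n\<in>set ns. P dvd n + u" for u
  proof (rule ccontr)
    assume "\<not> u \<le> v - int t"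
    then have "nat (v - u) < t" "v - int (nat (v - u)) = u" using that by auto
    then show False using min[of "nat (v - u)"] that unfolding S_def by auto
  qed
  ultimately show ?thesis using St that[of "v - int t"] unfolding S_def by auto
qed

lemma gcost_shift:
  assumes "P > 0" 
  shows "gcost ns h P (v + t * P) = gcost ns h P v"
proof -
  have e: "(a + (v + t * P)) div P = (a + v) div P + t" "(a - (v + t * P)) div P = (a - v) div P - t" for a
    using assms div_mult_self1[of P "a + v" t] div_mult_self1[of P "a - v" "-t"] by (auto simp: algebra_simps)
  have "(h + (v + t * P) + P div 2) div P = (h + v + P div 2) div P + t"
    "(h - (v + t * P) + P div 2) div P = (h - v + P div 2) div P - t"
    using e[of "h + P div 2"] by (auto simp: algebra_simps)
  then show ?thesis unfolding gcost_def e by simp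
qed

lemma gcost_pole_candidate:
  assumes "P > 0" "P dvd n + v"
  shows "gcost ns h P v = int (length ns) + (\<Sum>i\<leftarrow>ns. (i - n) div P + (i + n) div P)
     - ((h - n + P div 2) div P + (h + n + P div 2) div P)"
proof -
  from assms(2) obtain t where "v = - n + t * P"
    by (metis add.commute add_diff_cancel_right' dvdE mult.commute uminus_add_conv_diff)
  then have "gcost ns h P v = gcost ns h P (- n)" using gcost_shift[OF assms(1)] by metis
  then show ?thesis by (simp add: gcost_def)
qed

text \<open>By periodicity \<open>v\<close> may be replaced by \<open>h + r + 1\<close>. There each
  pole term loses 1 through the reflection \<open>(- a - 1) div P = - (a div P) - 1\<close>, which
  cancels \<open>length ns\<close>, and the two zero terms become \<open>(2 * h) div P + 1\<close>
  and -1.\<close>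

lemma gcost_zero_candidate:
  assumes "P = 2 * r + 1" "P > 0" "P dvd h + r + 1 - v" "\<forall>n\<in>set ns. \<not> P dvd n + v"
  shows "gcost ns h P v = (\<Sum>i\<leftarrow>ns. (h + i + r) div P - (h - i + r) div P) - (2 * h) div P"
proof -
  have r: "P div 2 = r" using assms(1) by simp
  from assms(3) obtain t where t: "v = (h + r + 1) + t * P"
    by (metis (no_types, opaque_lifting) add_diff_cancel_left' diff_diff_eq2 dvdE minus_diff_eq mult.commute mult_minus_right uminus_add_conv_diff add.commute diff_add_cancel)
  have "gcost ns h P v = gcost ns h P (h + r + 1)" unfolding t using gcost_shift[OF assms(2)] .
  also have "\<dots> = (\<Sum>i\<leftarrow>ns. (h + i + r) div P - (h - i + r) div P) - (2 * h) div P"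
  proof -
    have 1: "(i + (h + r + 1)) div P + (i - (h + r + 1)) div P = (h + i + r) div P - (h - i + r) div P - 1"
      if "i \<in> set ns" for i
    proof -
      have "\<not> P dvd i + (h + r + 1)"
      proof
        assume "P dvd i + (h + r + 1)"
        then have "P dvd i + (h + r + 1) + t * P" by simp
        then show False using assms(4) that t by (auto simp: algebra_simps)
      qed
      then have "(i + (h + r + 1)) div P = (h + i + r) div P"
        using div_add_one_eq[of P "h + i + r"] assms(2) by (simp add: algebra_simps)
      moreover have "(i - (h + r + 1)) div P = - ((h - i + r) div P) - 1"
      proof -
        let ?a = "h - i + r"
        have "- ?a - 1 = P * (- (?a div P) - 1) + (P - 1 - ?a mod P)"
          by (simp add: algebra_simps)
        moreover have "0 \<le> P - 1 - ?a mod P" "P - 1 - ?a mod P < P" 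
          using assms(2) pos_mod_bound[of P ?a] pos_mod_sign[of P ?a] by linarith+
        ultimately have "(- ?a - 1) div P = - (?a div P) - 1"
          by (metis add.commute add_0 assms(2) div_mult_self4 div_pos_pos_trivial order_less_irrefl)
        then show ?thesis by (simp add: algebra_simps)
      qed
      ultimately show ?thesis by linarith
    qed
    have 2: "(h + (h + r + 1) + r) div P = (2 * h) div P + 1"
    proof -
      have "h + (h + r + 1) + r = 2 * h + 1 * P" using assms(1) by simp
      then show ?thesis using assms(2) by (metis div_mult_self1 less_irrefl add.commute)
    qed
    have 3: "(h - (h + r + 1) + r) div P = - 1"
      using assms(2) by (simp add: zdiv_eq_0_iff div_eq_minus1)
    have "(\<Sum>i\<leftarrow>ns. (i + (h + r + 1)) div P + (i - (h + r + 1)) div P)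
        = (\<Sum>i\<leftarrow>ns. (h + i + r) div P - (h - i + r) div P - 1)"
      using 1 by (intro arg_cong[of _ _ sum_list] map_cong) auto
    also have "\<dots> = (\<Sum>i\<leftarrow>ns. (h + i + r) div P - (h - i + r) div P) - int (length ns)"
      by (induction ns) auto
    finally show ?thesis unfolding gcost_def r using 2 3 by simp
  qed
  finally show ?thesis .
qed

section \<open>The cost is bounded by a step function\<close>

definition Bs :: "int list" where "Bs = [3, 4, 4, 5, 5, 6, 6, 7, 7, 8, 8]"

text \<open>A triple \<open>(a, b, c)\<close> gives the value \<open>c\<close> on the cell from \<open>m / P = a / b\<close> to the next breakpoint. The values are
  essentially the maxima of the cost over the poles, computed numerically.\<close>
definition cells :: "(int \<times> int \<times> int) list" where
  "cells = [(0,1,11), (1,36,9), (3,58,9), (1,12,2), (5,56,2), (1,11,4), (3,32,3), (5,52,3), (1,10,4), (1,9,6), (1,8,8),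
    (7,50,8), (7,48,8), (5,34,7), (2,13,8), (9,56,8), (1,6,2), (9,50,2), (2,11,3), (3,16,5), (4,21,4),
    (5,26,3), (11,56,3), (1,5,5), (11,52,5), (3,14,7), (13,58,7), (3,13,9), (7,30,8), (13,54,8), (1,4,4),
    (11,42,3), (9,34,2), (4,15,3), (7,26,2), (3,11,4), (2,7,6), (3,10,7), (11,36,6), (4,13,8), (17,54,8),
    (17,52,8), (1,3,4), (11,32,3), (19,54,3), (21,58,3), (4,11,5), (3,8,7), (13,34,5), (5,13,7), (23,58,7),
    (2,5,9), (17,42,8), (23,56,8), (5,12,2), (23,54,2), (3,7,4), (7,16,4), (25,56,4), (5,11,5), (6,13,7),
    (27,58,8), (25,52,8), (1,2,5), (31,58,5), (27,50,5), (6,11,6), (31,56,6), (5,9,8), (19,34,7), (33,58,7),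
    (4,7,8), (29,50,8), (7,12,2), (31,52,2), (3,5,4), (11,18,4), (8,13,5), (31,50,5), (5,8,6), (33,52,7),
    (9,14,8), (33,50,8), (2,3,4), (23,34,3), (37,54,3), (9,13,5), (7,10,7), (5,7,6), (13,18,7), (41,56,8),
    (37,50,8), (3,4,4), (37,48,4), (7,9,6), (25,32,5), (41,52,5), (43,54,5), (4,5,7), (47,58,6), (9,11,8),
    (43,52,8), (5,6,2), (49,58,3), (6,7,5), (13,15,7), (7,8,9), (23,26,7), (9,10,7), (49,54,8), (53,58,8),
    (11,12,2), (12,13,4), (13,14,6), (14,15,8), (15,16,10), (25,26,8), (49,50,8)]"

text \<open>For \<open>m / P < 1 / 12\<close> the values in \<open>cells\<close> are improved because only poles with \<open>P \<le> \<bar>v\<bar> + 8 m\<close> matter; in particular the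
  step function vanishes for \<open>m / P < 1 / 16\<close>. From \<open>m / P = 1\<close> on, periodicity of the cost in \<open>m / P\<close> is used.\<close>
definition breaks :: "(int \<times> int \<times> int) list" where
  "breaks = [(1,16,1), (1,15,3), (1,14,5), (1,13,7)] @ drop 3 cells @ [(1,1,11), (37,36,9), (31,16,11)]"

fun stepval :: "(int \<times> int \<times> int) list \<Rightarrow> int \<Rightarrow> int \<Rightarrow> int \<Rightarrow> int" where
  "stepval [] c m P = c"
| "stepval ((a, b, c') # xs) c m P = (if a * P \<le> b * m then stepval xs c' m P else c)"

text \<open>Bounds, uniform over the cell \<open>a / b < m / P < a1 / b1\<close>, for \<open>pole_val\<close> and \<open>zero_val\<close> below.\<close>
definition pole_bound :: "int \<Rightarrow> int \<Rightarrow> int \<Rightarrow> int \<Rightarrow> int \<Rightarrow> int" where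
  "pole_bound j a b a1 b1 = 11 + (\<Sum>i\<leftarrow>Bs. (if i < j then - ((j - i) * a div b) - 1
       else if i = j then 0 else ((i - j) * a1 - 1) div b1) + ((i + j) * a1 - 1) div b1)
     - ((2 * (21 - j) * a + b) div (2 * b) + (2 * (21 + j) * a + b) div (2 * b))"

definition zero_bound :: "int \<Rightarrow> int \<Rightarrow> int \<Rightarrow> int \<Rightarrow> int" where
  "zero_bound a b a1 b1 = (\<Sum>i\<leftarrow>Bs. (2 * (21 + i) * a1 + b1 - 1) div (2 * b1) - (2 * (21 - i) * a + b) div (2 * b))
     - 42 * a div b"

text \<open>The part \<open>7 * (12 * a div b)\<close> is paid for by the seven factorials of
  \<open>12 * m\<close>; on the cell, \<open>12 * a div b\<close> is a lower bound for
  \<open>(12 * m) div P\<close>. Each triple is compared with its successor, which supplies the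
  right end of the cell.\<close>

fun cells_ok :: "(int \<times> int \<times> int) list \<Rightarrow> bool" where
  "cells_ok ((a, b, c) # (a1, b1, c1) # xs) \<longleftrightarrow> b > 0 \<and> b1 > 0 \<and>
     list_all (\<lambda>j. pole_bound j a b a1 b1 \<le> c + 7 * (12 * a div b)) [3, 4, 5, 6, 7, 8] \<and>
     zero_bound a b a1 b1 \<le> c + 7 * (12 * a div b) \<and> cells_ok ((a1, b1, c1) # xs)"
| "cells_ok _ \<longleftrightarrow> True"

text \<open>The finite computation behind the arithmetic of the proof. The appended triple closes
  the last cell at 1.\<close>

lemma cells_ok_cells: "cells_ok (cells @ [(1, 1, 11)])"
  by code_simp

text \<open>The cost at the two kinds of candidates in \<open>gcost_le_candidate\<close>.\<close>
definition pole_val :: "int \<Rightarrow> int \<Rightarrow> int \<Rightarrow> int" where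
  "pole_val j m P = 11 + (\<Sum>i\<leftarrow>Bs. ((i - j) * m) div P + ((i + j) * m) div P)
     - (((21 - j) * m + P div 2) div P + ((21 + j) * m + P div 2) div P)"

definition zero_val :: "int \<Rightarrow> int \<Rightarrow> int" where
  "zero_val m P = (\<Sum>i\<leftarrow>Bs. ((21 + i) * m + P div 2) div P - ((21 - i) * m + P div 2) div P) - (42 * m) div P"

lemma int_div_mult_le: "P > 0 \<Longrightarrow> a div P * P \<le> a" for a P :: int
  by (simp add: minus_mod_eq_div_mult[symmetric])

context
  fixes a b a1 b1 m P :: int
  assumes ab: "a * P < b * m" "b1 * m < a1 * P" "b > 0" "b1 > 0" "P > 0"
begin

text \<open>As m / P lies strictly below a1 / b1, the floor of k m / P is at most the largest
  integer strictly below k a1 / b1. In the same way \<open>div_neg\<close> gains its -1 from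
  strictness at the left end.\<close>

lemma div_upper:
  assumes "k > 0" shows "(k * m) div P \<le> (k * a1 - 1) div b1"
proof -
  define q where "q = (k * m) div P"
  have "q * P \<le> k * m" unfolding q_def using ab by (simp add: int_div_mult_le)
  then have "q * P * b1 \<le> k * m * b1" using ab by (intro mult_right_mono) auto
  also have "\<dots> = k * (b1 * m)" by simp
  also have "\<dots> < k * (a1 * P)" using ab assms by (intro mult_strict_left_mono) auto
  finally have "(q * b1) * P < (k * a1) * P" by (simp add: algebra_simps)
  then have "q * b1 \<le> k * a1 - 1" using ab by simp
  then have "q * b1 div b1 \<le> (k * a1 - 1) div b1" using ab by (intro zdiv_mono1) auto
  then show ?thesis using ab by (simp add: q_def)
qed

lemma div_lower:
  assumes "k \<ge> 0" shows "(k * a) div b \<le> (k * m) div P"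
proof -
  define q where "q = (k * a) div b"
  have "q * b \<le> k * a" unfolding q_def using ab by (simp add: int_div_mult_le)
  then have "q * b * P \<le> k * a * P" using ab by (intro mult_right_mono) auto
  also have "\<dots> = k * (a * P)" by simp
  also have "\<dots> \<le> k * (b * m)" using ab assms by (intro mult_left_mono) auto
  finally have "b * (q * P) \<le> b * (k * m)" by (simp add: algebra_simps)
  then have "q * P \<le> k * m" using ab by simp
  then show ?thesis unfolding q_def[symmetric] using ab
    by (metis nonzero_mult_div_cancel_right less_irrefl zdiv_mono1)
qed

lemma div_neg:
  assumes "k > 0" shows "(- k * m) div P \<le> - ((k * a) div b) - 1"
proof -
  define q where "q = (k * a) div b"
  have "q * b \<le> k * a" unfolding q_def using ab by (simp add: int_div_mult_le)
  then have "q * b * P \<le> k * a * P" using ab by (intro mult_right_mono) auto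
  also have "\<dots> = k * (a * P)" by simp
  also have "\<dots> < k * (b * m)" using ab assms by (intro mult_strict_left_mono) auto
  finally have "b * (q * P) < b * (k * m)" by (simp add: algebra_simps)
  then have "q * P < k * m" using ab by simp
  then have "- k * m \<le> (- q) * P - 1" by simp
  moreover have "((- q) * P - 1) div P = - q - 1"
  proof -
    have e: "(- q) * P - 1 = (P - 1) + (- q - 1) * P" by (simp add: algebra_simps)
    show ?thesis unfolding e using ab by (subst div_mult_self1) auto
  qed
  ultimately show ?thesis unfolding q_def[symmetric] using ab by (metis zdiv_mono1)
qed

text \<open>For odd \<open>P\<close> the expression \<open>(k * m + P div 2) div P\<close> is the
  floor of k m / P + 1/2, hence the comparison with doubled numerators and denominators.\<close>

lemma round_lower:
  assumes "k \<ge> 0" "odd P" shows "(2 * k * a + b) div (2 * b) \<le> (k * m + P div 2) div P"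
proof -
  define q where "q = (2 * k * a + b) div (2 * b)"
  have "q * (2 * b) \<le> 2 * k * a + b" unfolding q_def using ab by (simp add: int_div_mult_le)
  then have "q * (2 * b) * P \<le> (2 * k * a + b) * P" using ab by (intro mult_right_mono) auto
  also have "\<dots> = 2 * k * (a * P) + b * P" by (simp add: algebra_simps)
  also have "\<dots> \<le> 2 * k * (b * m) + b * P" using ab assms by (intro add_right_mono mult_left_mono) auto
  finally have "b * (2 * (q * P)) \<le> b * (2 * k * m + P)" by (simp add: algebra_simps)
  then have "2 * (q * P) \<le> 2 * k * m + P" using ab by simp
  moreover obtain r where r: "P = 2 * r + 1" using assms by (elim oddE)
  ultimately have "q * P \<le> k * m + P div 2" by simp
  then show ?thesis unfolding q_def[symmetric] using ab
    by (metis nonzero_mult_div_cancel_right less_irrefl zdiv_mono1)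
qed

lemma round_upper:
  assumes "k \<ge> 0" "odd P" shows "(k * m + P div 2) div P \<le> (2 * k * a1 + b1 - 1) div (2 * b1)"
proof -
  define q where "q = (k * m + P div 2) div P"
  obtain r where r: "P = 2 * r + 1" using assms by (elim oddE)
  have "q * P \<le> k * m + P div 2" unfolding q_def using ab by (simp add: int_div_mult_le)
  then have "2 * q * P \<le> 2 * k * m + P - 1" using r by simp
  then have "b1 * (2 * q * P) \<le> b1 * (2 * k * m + P - 1)" using ab by (intro mult_left_mono) auto
  also have "\<dots> = 2 * k * (b1 * m) + b1 * P - b1" by (simp add: algebra_simps)
  also have "\<dots> < 2 * k * (a1 * P) + b1 * P" using ab assms mult_left_mono[of "b1 * m" "a1 * P" "2 * k"] by linarith
  finally have "(q * (2 * b1)) * P < (2 * k * a1 + b1) * P" by (simp add: algebra_simps)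
  then have "q * (2 * b1) \<le> 2 * k * a1 + b1 - 1" using ab by simp
  then have "q * (2 * b1) div (2 * b1) \<le> (2 * k * a1 + b1 - 1) div (2 * b1)" using ab by (intro zdiv_mono1) auto
  then show ?thesis using ab by (simp add: q_def)
qed

lemma pole_val_le:
  assumes "odd P" "3 \<le> j" "j \<le> 8" shows "pole_val j m P \<le> pole_bound j a b a1 b1"
proof -
  have "((i - j) * m) div P + ((i + j) * m) div P \<le> (if i < j then - ((j - i) * a div b) - 1
       else if i = j then 0 else ((i - j) * a1 - 1) div b1) + ((i + j) * a1 - 1) div b1" if "i \<in> set Bs" for i
  proof -
    have "i > 0" using that by (auto simp: Bs_def)
    then show ?thesis using div_upper[of "i - j"] div_upper[of "i + j"] div_neg[of "j - i"] assms by auto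
  qed
  then have "(\<Sum>i\<leftarrow>Bs. ((i - j) * m) div P + ((i + j) * m) div P) \<le> (\<Sum>i\<leftarrow>Bs. (if i < j then - ((j - i) * a div b) - 1
       else if i = j then 0 else ((i - j) * a1 - 1) div b1) + ((i + j) * a1 - 1) div b1)"
    by (intro sum_list_mono) auto
  moreover have "(2 * (21 - j) * a + b) div (2 * b) \<le> ((21 - j) * m + P div 2) div P"
    "(2 * (21 + j) * a + b) div (2 * b) \<le> ((21 + j) * m + P div 2) div P"
    using assms by (intro round_lower; simp)+
  ultimately show ?thesis unfolding pole_val_def pole_bound_def by linarith
qed

lemma zero_val_le:
  assumes "odd P" shows "zero_val m P \<le> zero_bound a b a1 b1"
proof -
  have "((21 + i) * m + P div 2) div P - ((21 - i) * m + P div 2) div P \<le>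
    (2 * (21 + i) * a1 + b1 - 1) div (2 * b1) - (2 * (21 - i) * a + b) div (2 * b)" if "i \<in> set Bs" for i
  proof -
    have "0 \<le> 21 + i" "0 \<le> 21 - i" using that by (auto simp: Bs_def)
    then show ?thesis using round_upper[of "21 + i"] round_lower[of "21 - i"] assms by linarith
  qed
  then have "(\<Sum>i\<leftarrow>Bs. ((21 + i) * m + P div 2) div P - ((21 - i) * m + P div 2) div P) \<le>
     (\<Sum>i\<leftarrow>Bs. (2 * (21 + i) * a1 + b1 - 1) div (2 * b1) - (2 * (21 - i) * a + b) div (2 * b))"
    by (intro sum_list_mono) auto
  moreover have "42 * a div b \<le> (42 * m) div P" by (intro div_lower) auto
  ultimately show ?thesis unfolding zero_val_def zero_bound_def by linarith
qed

end

text \<open>Walks along the list to the cell that contains m / P. No breakpoint equals m / P, so the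
  point lies strictly inside its cell, as the floor bounds require; the last assumption stops the
  walk before the list ends.\<close>

lemma cells_ok_bound:
  assumes "cells_ok ((a, b, c) # ys)" "a * P < b * m" "P > 0" "odd P" "ys \<noteq> []"
    "\<And>a' b' c'. (a', b', c') \<in> set ys \<Longrightarrow> a' * P \<noteq> b' * m"
    "\<not> fst (last ys) * P \<le> fst (snd (last ys)) * m"
  shows "(\<forall>j\<in>{3..8}. pole_val j m P \<le> stepval ys c m P + 7 * ((12 * m) div P)) \<and>
    zero_val m P \<le> stepval ys c m P + 7 * ((12 * m) div P)"
  using assms
proof (induction ys arbitrary: a b c)
  case (Cons y zs)
  obtain a1 b1 c1 where y: "y = (a1, b1, c1)" by (cases y)
  show ?case
  proof (cases "a1 * P \<le> b1 * m")
    case True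
    then have lt: "a1 * P < b1 * m" using Cons.prems(6)[of a1 b1 c1] y by fastforce
    have "zs \<noteq> []" using Cons.prems(7) True y by auto
    then show ?thesis using Cons.IH[of a1 b1 c1] Cons.prems y lt True by auto
  next
    case False
    note cell = Cons.prems(2) False[unfolded not_le]
    have pos: "b > 0" "b1 > 0" using Cons.prems(1) y by auto
    have sv: "stepval (y # zs) c m P = c" using False y by simp
    have low: "(12 * a) div b \<le> (12 * m) div P"
      using div_lower[OF cell pos Cons.prems(3), of 12] by simp
    have *: "pole_bound j a b a1 b1 \<le> c + 7 * (12 * a div b)" if "j \<in> {3..8}" for j
    proof -
      have "{3..8} = {3, 4, 5, 6, 7, 8 :: int}" by auto
      then have "j \<in> set [3, 4, 5, 6, 7, 8]" using that by simp
      then show ?thesis using Cons.prems(1) y by (auto simp: list_all_iff)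
    qed
    have "pole_val j m P \<le> c + 7 * ((12 * m) div P)" if "j \<in> {3..8}" for j
      using pole_val_le[OF cell pos Cons.prems(3,4), of j] *[OF that] low that by auto
    moreover have "zero_val m P \<le> c + 7 * ((12 * m) div P)"
      using zero_val_le[OF cell pos Cons.prems(3,4)] Cons.prems(1) y low by auto
    ultimately show ?thesis using sv by auto
  qed
qed simp

lemma stepval_append_all:
  assumes "\<And>a b c. (a, b, c) \<in> set xs \<Longrightarrow> a * P \<le> b * m"
  shows "stepval (xs @ ys) c m P = stepval ys (if xs = [] then c else snd (snd (last xs))) m P"
  using assms
proof (induction xs arbitrary: c)
  case (Cons x xs)
  obtain a b c' where x: "x = (a, b, c')" by (cases x)
  have "stepval (xs @ ys) c' m P = stepval ys (if xs = [] then c' else snd (snd (last xs))) m P"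
    using Cons.prems by (intro Cons.IH) auto
  moreover have "a * P \<le> b * m" using Cons.prems x by auto
  ultimately show ?case using x by auto
qed simp

lemma stepval_append_stop:
  assumes "\<not> a * P \<le> b * m"
  shows "stepval (xs @ (a, b, c') # ys) c m P = stepval xs c m P"
  using assms by (induction xs c m P rule: stepval.induct) auto

lemma stepval_le:
  assumes "\<And>a b c'. (a, b, c') \<in> set xs \<Longrightarrow> a * P \<le> b * m \<Longrightarrow> c' \<le> K" "c \<le> K"
  shows "stepval xs c m P \<le> K"
  using assms by (induction xs c m P rule: stepval.induct) auto

text \<open>The bound 58 on denominators is the origin of the condition \<open>P > 58\<close>: such
  a prime makes m / P miss all breakpoints. The second fact, that values on the range from 1/36 to
  15/16 are at most 9, justifies the value 9 between 37/36 and 31/16 in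
  \<open>breaks\<close>.\<close>

lemma cells_list:
  "list_all (\<lambda>(a, b, c). 0 \<le> a \<and> a < b \<and> b \<le> 58 \<and> c \<le> 11) cells"
  "list_all (\<lambda>(a, b, c). c \<le> 9 \<or> 15 * b \<le> 16 * a) (tl cells)"
  "cells \<noteq> []" "hd cells = (0, 1, 11)" "cells = (0, 1, 11) # (1, 36, 9) # drop 2 cells" "cells = (0, 1, 11) # (1, 36, 9) # (3, 58, 9) # drop 3 cells"
  by code_simp+

definition weight :: "int \<Rightarrow> int \<Rightarrow> int" where
  "weight m P = stepval breaks 0 m P"

lemma weight_ge_2:
  assumes "2 * P \<le> m" "P > 0"
  shows "weight m P = 11"
proof -
  have "a * P \<le> b * m" if "(a, b, c) \<in> set breaks" for a b c
  proof -
    have "list_all (\<lambda>(a, b, c). 0 \<le> b \<and> a \<le> 2 * b) breaks" by code_simp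
    then have "0 \<le> b" "a \<le> 2 * b" using that by (auto simp: list_all_iff)
    then have "a * P \<le> (2 * b) * P" "b * (2 * P) \<le> b * m" using assms by (auto intro: mult_right_mono mult_left_mono)
    then show ?thesis by (simp add: algebra_simps)
  qed
  then have "stepval (breaks @ []) 0 m P = 11"
    by (subst stepval_append_all) (auto simp: breaks_def)
  then show ?thesis by (simp add: weight_def)
qed

lemma weight_ge_1:
  assumes "P \<le> m" "P > 0"
  shows "weight m P = stepval [(1,1,11), (37,36,9), (31,16,11)] 0 m P"
proof -
  let ?xs = "[(1,16,1), (1,15,3), (1,14,5), (1,13,7)] @ drop 3 cells"
  have "a * P \<le> b * m" if "(a, b, c) \<in> set ?xs" for a b c
  proof -
    have "list_all (\<lambda>(a, b, c). 0 \<le> b \<and> a \<le> b) ?xs" by code_simp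
    then have "0 \<le> b" "a \<le> b" using that by (auto simp: list_all_iff)
    then have "a * P \<le> b * P" "b * P \<le> b * m" using assms by (auto intro: mult_right_mono mult_left_mono)
    then show ?thesis by (simp add: algebra_simps)
  qed
  then show ?thesis unfolding weight_def breaks_def append_assoc[symmetric]
    by (subst stepval_append_all) (use assms in auto)
qed

text \<open>Both lists contain the breakpoint 1/12, and once it is passed the values before it are
  forgotten; below 1 the later breakpoints are not reached.\<close>

lemma weight_generic:
  assumes "m < P" "P \<le> 12 * m"
  shows "weight m P = stepval (tl cells @ [(1,1,11)]) 11 m P"
proof -
  have 1: "weight m P = stepval (drop 3 cells @ (1,1,11) # [(37,36,9), (31,16,11)]) 7 m P"
    unfolding weight_def breaks_def using assms by simp
  have 2: "stepval (tl cells @ [(1,1,11)]) 11 m P = stepval (drop 3 cells @ (1,1,11) # []) 9 m P"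
    using assms by (subst cells_list(6)) simp
  have 3: "stepval (drop 3 cells) c m P = stepval (drop 3 cells) c' m P" for c c'
  proof -
    have "drop 3 cells = (1,12,2) # drop 4 cells" by code_simp
    then show ?thesis using assms by simp
  qed
  show ?thesis unfolding 1 2 using assms by (subst (1 2) stepval_append_stop) (auto intro: 3)
qed

text \<open>84 = 2 * 63 - 42, where 63 is the sum of \<open>Bs\<close>. It is also 7 * 12, so the
  factorial part \<open>7 * ((12 * m) div P)\<close> grows by the same amount.\<close>

lemma pole_val_shift:
  assumes "P > 0"
  shows "pole_val j (m + P) P = pole_val j m P + 84" "zero_val (m + P) P = zero_val m P + 84"
proof -
  have d: "(k * (m + P)) div P = k * m div P + k" "(k * (m + P) + e) div P = (k * m + e) div P + k" for k e
  proof -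
    have e: "k * (m + P) + e = k * m + e + k * P" for e by (simp add: algebra_simps)
    show "(k * (m + P) + e) div P = (k * m + e) div P + k" for e
      unfolding e using assms by (subst div_mult_self1) auto
    from this[of 0] show "(k * (m + P)) div P = k * m div P + k" by simp
  qed
  show "pole_val j (m + P) P = pole_val j m P + 84" "zero_val (m + P) P = zero_val m P + 84"
    unfolding pole_val_def zero_val_def d by (simp_all add: Bs_def)
qed

lemma pole_val_shift':
  assumes "P > 0"
  shows "pole_val j (m + int k * P) P = pole_val j m P + 84 * int k \<and> zero_val (m + int k * P) P = zero_val m P + 84 * int k"
proof (induction k)
  case (Suc k)
  have e: "m + int (Suc k) * P = (m + int k * P) + P" by (simp add: algebra_simps)
  show ?case unfolding e using Suc pole_val_shift(1)[OF assms, of j "m + int k * P"]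
      pole_val_shift(2)[OF assms, of "m + int k * P"] by simp
qed simp

lemma vals_le_lt:
  assumes "prime P" "P > 58" "0 < m" "m < P"
  shows "(\<forall>j\<in>{3..8}. pole_val j m P \<le> stepval (tl cells @ [(1,1,11)]) 11 m P + 7 * ((12 * m) div P)) \<and>
    zero_val m P \<le> stepval (tl cells @ [(1,1,11)]) 11 m P + 7 * ((12 * m) div P)"
proof (rule cells_ok_bound[of 0 1 11])
  show "cells_ok ((0, 1, 11) # tl cells @ [(1, 1, 11)])"
    using cells_ok_cells cells_list(3,4) by (metis append_Cons list.collapse)
  show "odd P" using assms by (simp add: prime_odd_int)
  \<comment> \<open>Equality would make the prime \<open>P\<close> divide \<open>b'\<close> or
    \<open>m\<close>, but \<open>b' \<le> 58 < P\<close> and \<open>0 < m < P\<close>.\<close>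
  show "a' * P \<noteq> b' * m" if "(a', b', c') \<in> set (tl cells @ [(1, 1, 11)])" for a' b' c'
  proof (cases "(a', b', c') = (1, 1, 11)")
    case False
    then have "(a', b', c') \<in> set cells" using that by (auto dest: list.set_sel(2)[OF cells_list(3)])
    then have b: "0 < b'" "b' \<le> 58" using cells_list(1) by (auto simp: list_all_iff)
    show ?thesis
    proof
      assume "a' * P = b' * m"
      then have "P dvd b' * m" by (metis dvd_triv_right)
      then have "P dvd b' \<or> P dvd m" using assms(1) by (simp add: prime_dvd_mult_iff)
      then show False using assms b by (auto dest: zdvd_imp_le)
    qed
  qed (use assms in auto)
qed (use assms in auto)

lemma stepval_cells_le:
  assumes "0 < m" "m < P"
  shows "stepval (tl cells @ [(1,1,11)]) 11 m P \<le> 11"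
    "P \<le> 36 * m \<Longrightarrow> 16 * m < 15 * P \<Longrightarrow> stepval (tl cells @ [(1,1,11)]) 11 m P \<le> 9"
proof -
  show "stepval (tl cells @ [(1,1,11)]) 11 m P \<le> 11"
  proof (rule stepval_le)
    fix a b c assume "(a, b, c) \<in> set (tl cells @ [(1, 1, 11)])"
    then have "(a, b, c) = (1, 1, 11) \<or> (a, b, c) \<in> set cells"
      by (auto dest: list.set_sel(2)[OF cells_list(3)])
    then show "c \<le> 11" using cells_list(1) by (auto simp: list_all_iff)
  qed simp
  assume le: "P \<le> 36 * m" "16 * m < 15 * P"
  have tl: "tl cells = (1, 36, 9) # drop 2 cells" using cells_list(5) by (metis list.sel(3))
  have "stepval (tl cells @ [(1,1,11)]) 11 m P = stepval (drop 2 cells @ [(1,1,11)]) 9 m P"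
    unfolding tl using le by simp
  also have "\<dots> \<le> 9"
  proof (rule stepval_le)
    fix a b c assume *: "(a, b, c) \<in> set (drop 2 cells @ [(1, 1, 11)])" "a * P \<le> b * m"
    then have "(a, b, c) = (1, 1, 11) \<or> (a, b, c) \<in> set (tl cells)" by (auto simp: tl)
    then have c: "c \<le> 9 \<or> 15 * b \<le> 16 * a \<and> a > 0"
      using cells_list(1,2) list.set_sel(2)[OF cells_list(3), of "(a, b, c)"] by (fastforce simp: list_all_iff)
    have "\<not> (15 * b \<le> 16 * a \<and> a > 0)"
    proof
      assume **: "15 * b \<le> 16 * a \<and> a > 0"
      have "15 * (a * P) \<le> 15 * b * m" using *(2) by simp
      also have "\<dots> \<le> 16 * a * m" using ** assms by (intro mult_right_mono) auto
      also have "\<dots> = a * (16 * m)" by simp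
      also have "\<dots> < a * (15 * P)" using ** le by (intro mult_strict_left_mono) auto
      finally show False by simp
    qed
    with c show "c \<le> 9" by blast
  qed simp
  finally show "stepval (tl cells @ [(1,1,11)]) 11 m P \<le> 9" .
qed

lemma vals_at_0:
  assumes "P > 0" "3 \<le> j" "j \<le> 8"
  shows "pole_val j 0 P \<le> 11" "zero_val 0 P \<le> 11"
  using assms by (simp_all add: pole_val_def zero_val_def Bs_def)

text \<open>Reduces \<open>m\<close> modulo \<open>P\<close>. Since both sides of the bound gain 84
  per period, only the step value of the remainder has to be compared with
  \<open>weight m P\<close>.\<close>

lemma vals_le_weight:
  assumes P: "prime P" "P > 58" and m: "0 < m" "P \<le> 12 * m"
  shows "(\<forall>j\<in>{3..8}. pole_val j m P \<le> weight m P + 7 * ((12 * m) div P)) \<and>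
    zero_val m P \<le> weight m P + 7 * ((12 * m) div P)"
proof (cases "m < P")
  case True
  then show ?thesis using vals_le_lt[OF P m(1) True] weight_generic[OF True m(2)] by simp
next
  case False
  define r k where "r = m mod P" and "k = nat (m div P)"
  have "m div P \<ge> P div P" using P False by (intro zdiv_mono1) auto
  then have kd: "int k = m div P" and k: "k \<ge> 1" using P by (auto simp: k_def)
  have r: "0 \<le> r" "r < P" and mr: "m = r + int k * P" using P unfolding kd r_def by auto
  have dv: "(12 * m) div P = (12 * r) div P + 12 * int k"
  proof -
    have "12 * m = 12 * r + (12 * int k) * P" unfolding mr by (simp add: algebra_simps)
    then show ?thesis using P by simp
  qed
  note sh = pole_val_shift'[of P _ r k, folded mr]
  define c where "c = weight m P"
  have "(\<forall>j\<in>{3..8}. pole_val j r P \<le> c + 7 * ((12 * r) div P)) \<and> zero_val r P \<le> c + 7 * ((12 * r) div P)"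
  proof (cases "r = 0")
    case True
    \<comment> \<open>If m / P is an integer, the remainder lies in no open cell and is treated
      directly.\<close>
    have "c = 11"
    proof (cases "k \<ge> 2")
      case k2: True
      then have "2 * P \<le> m" unfolding mr True using P by (simp add: mult_right_mono)
      then show ?thesis unfolding c_def using P by (intro weight_ge_2) auto
    next
      case False
      then have "k = 1" using k by simp
      then have "m = P" using mr True by simp
      then show ?thesis unfolding c_def using P by (subst weight_ge_1) auto
    qed
    then show ?thesis using True vals_at_0(1)[of P] vals_at_0(2)[of P 3] P by auto
  next
    case r0: False
    then have r1: "0 < r" using r by simp
    have "stepval (tl cells @ [(1,1,11)]) 11 r P \<le> c"
    proof (cases "k \<ge> 2")
      case k2: True
      then have "2 * P \<le> int k * P" using P by (intro mult_right_mono) auto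
      then have "2 * P \<le> m" unfolding mr using r by linarith
      then have "c = 11" unfolding c_def using P by (intro weight_ge_2) auto
      then show ?thesis using stepval_cells_le(1)[OF r1 r(2)] by simp
    next
      case False
      then have mr1: "m = r + P" using k mr by (cases "k = 1") auto
      have c: "c = stepval [(1,1,11), (37,36,9), (31,16,11)] 0 m P"
        unfolding c_def using P mr1 r1 by (intro weight_ge_1) auto
      show ?thesis
      proof (cases "37 * P \<le> 36 * m \<and> 16 * m < 31 * P")
        case True
        then have "c = 9" unfolding c using mr1 r1 by simp
        then show ?thesis using stepval_cells_le(2)[OF r1 r(2)] True mr1 by simp
      next
        case False
        then have "c = 11" unfolding c using mr1 r1 by auto
        then show ?thesis using stepval_cells_le(1)[OF r1 r(2)] by simp
      qed
    qed
    then show ?thesis using vals_le_lt[OF P r1 r(2)] by fastforce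
  qed
  then show ?thesis using sh P dv unfolding c_def by simp
qed

text \<open>The condition \<open>P \<le> (8 + j) * m\<close> discards the costly small radii: for m
  / P between 1/16 and 1/15 only j = 8 survives, up to 1/14 also j = 7, and so on. This produces the
  small initial values in \<open>breaks\<close>.\<close>

lemma pole_val_special:
  assumes P: "prime P" "P > 58" and m: "12 * m < P" "P \<le> 16 * m" "m > 0" and j: "3 \<le> j" "j \<le> 8" "P \<le> (8 + j) * m"
  shows "pole_val j m P \<le> weight m P"
proof -
  have odd: "odd P" using P by (simp add: prime_odd_int)
  \<comment> \<open>Excludes the breakpoints themselves: \<open>m\<close> would divide the prime
    \<open>P\<close>, so m = 1 and P is at most 16.\<close>
  have ne: "P \<noteq> k * m" if "k > 1" for k
  proof
    assume e: "P = k * m"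
    then have "m dvd P" by simp
    moreover have "\<forall>k. 0 \<le> k \<and> k dvd P \<longrightarrow> k = 1 \<or> k = P" using P(1) by (simp add: prime_int_iff)
    ultimately have "m = 1 \<or> m = P" using m(3) by (metis order_less_imp_le)
    then show False using e that m P by auto
  qed
  note b = pole_val_le[of _ P _ m _ _ j, OF _ _ _ _ _ odd j(1,2)]
  have gt: "k < 8 + j" if "k * m < P" for k
    using less_le_trans[OF that j(3)] m(3) by (simp add: mult_less_cancel_right_pos)
  consider "15 * m < P" | "14 * m < P" "P < 15 * m" | "13 * m < P" "P < 14 * m" | "P < 13 * m"
    using ne[of 15] ne[of 14] ne[of 13] by linarith
  then show ?thesis
  proof cases
    case 1
    then have "j = 8" using j gt[of 15] by simp
    moreover have "weight m P = 1" using m 1 by (simp add: weight_def breaks_def)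
    moreover have "P < 16 * m" using m ne[of 16] by simp
    ultimately show ?thesis using b[of 1 16 15 1] 1 m P by (simp add: pole_bound_def Bs_def)
  next
    case 2
    then have "j \<ge> 7" using gt[of 14] by simp
    then have "j \<in> {7, 8}" using j by auto
    moreover have "weight m P = 3" using m 2 by (simp add: weight_def breaks_def)
    ultimately show ?thesis using b[of 1 15 14 1] 2 m P by (auto simp: pole_bound_def Bs_def)
  next
    case 3
    then have "j \<ge> 6" using gt[of 13] by simp
    then have "j \<in> {6, 7, 8}" using j by auto
    moreover have "weight m P = 5" using m 3 by (simp add: weight_def breaks_def)
    ultimately show ?thesis using b[of 1 14 13 1] 3 m P by (auto simp: pole_bound_def Bs_def)
  next
    case 4
    then have "j \<ge> 5" using m gt[of 12] by simp
    then have "j \<in> {5, 6, 7, 8}" using j by auto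
    moreover have "weight m P = 7" using m 4
    proof -
      have "drop 3 cells = (1,12,2) # drop 4 cells" by code_simp
      then show ?thesis using m 4 by (simp add: weight_def breaks_def)
    qed
    ultimately show ?thesis using b[of 1 13 12 1] 4 m P by (auto simp: pole_bound_def Bs_def)
  qed
qed

definition pole_radii :: "int \<Rightarrow> int list" where
  "pole_radii m = map (\<lambda>B. B * m) Bs"

text \<open>Symmetry allows \<open>v\<close> to be nonnegative, and
  \<open>gcost_le_candidate\<close> moves it to a candidate, where the cost is
  \<open>pole_val\<close> or \<open>zero_val\<close>. For \<open>P\<close> beyond
  \<open>12 * m\<close> the range left for candidates is so short that zero candidates drop out and
  few radii remain.\<close>

proposition gcost_le_weight:
  assumes P: "prime P" "P > 58" and m: "m > 0" and v: "\<bar>v\<bar> \<le> 8 * m" "P \<le> \<bar>v\<bar> + 8 * m"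
  shows "gcost (pole_radii m) (21 * m) P v \<le> 7 * ((12 * m) div P) + weight m P"
proof -
  define v' where "v' = \<bar>v\<bar>"
  have g: "gcost (pole_radii m) (21 * m) P v = gcost (pole_radii m) (21 * m) P v'"
    unfolding v'_def using gcost_uminus[of "pole_radii m" "21 * m" P v] by (simp add: abs_if)
  have v': "P - 8 * m \<le> v'" "v' \<le> 8 * m" using v unfolding v'_def by auto
  have P0: "P > 0" using P by simp
  have "pole_radii m \<noteq> []" by (simp add: pole_radii_def Bs_def)
  from gcost_le_candidate[OF P0 this, of "21 * m" v'] obtain v0 where v0:
    "gcost (pole_radii m) (21 * m) P v' \<le> gcost (pole_radii m) (21 * m) P v0" "v0 \<le> v'"
    "(\<exists>n\<in>set (pole_radii m). P dvd n + v0) \<or> P dvd 21 * m + P div 2 + 1 - v0"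
    "\<And>u. u \<le> v' \<Longrightarrow> (\<exists>n\<in>set (pole_radii m). P dvd n + u) \<Longrightarrow> u \<le> v0" by metis
  \<comment> \<open>The largest radius makes \<open>P - 8 * m\<close> a pole candidate not above
    \<open>v'\<close>, so the last candidate \<open>v0\<close> lies at or above it.\<close>
  have "8 * m \<in> set (pole_radii m)" by (simp add: pole_radii_def Bs_def)
  moreover have "P dvd 8 * m + (P - 8 * m)" by simp
  ultimately have v0_ge: "P - 8 * m \<le> v0" using v' v0(4) by blast
  have radii: "\<exists>j. 3 \<le> j \<and> j \<le> 8 \<and> n = j * m" if "n \<in> set (pole_radii m)" for n
  proof -
    have "\<forall>B\<in>set Bs. 3 \<le> B \<and> B \<le> 8" by (simp add: Bs_def)
    then show ?thesis using that by (auto simp: pole_radii_def)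
  qed
  have "odd P" using P by (simp add: prime_odd_int)
  then obtain r where r: "P = 2 * r + 1" by (elim oddE)
  show ?thesis
  proof (cases "\<exists>n\<in>set (pole_radii m). P dvd n + v0")
    case True
    then obtain j where j: "3 \<le> j" "j \<le> 8" "P dvd j * m + v0" using radii by blast
    have "gcost (pole_radii m) (21 * m) P v0 = pole_val j m P"
      unfolding gcost_pole_candidate[OF P0 j(3)] pole_val_def
      by (simp add: pole_radii_def Bs_def algebra_simps)
    also have "\<dots> \<le> 7 * ((12 * m) div P) + weight m P"
    proof (cases "P \<le> 12 * m")
      case True
      then show ?thesis using vals_le_weight[OF P m True] j by (auto simp: add.commute)
    next
      case False
      have "0 \<le> j * m" using j m by simp
      then have "0 < j * m + v0" using v0_ge m False by linarith
      then have "P \<le> j * m + v0" using j by (intro zdvd_imp_le)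
      then have "P \<le> (8 + j) * m" using v0(2) v' by (simp add: algebra_simps)
      moreover have "(12 * m) div P = 0" using False m by (intro div_pos_pos_trivial) auto
      ultimately show ?thesis using pole_val_special[OF P, of m j] False m j v' by simp
    qed
    finally show ?thesis using g v0(1) by simp
  next
    case False
    then have d: "P dvd 21 * m + r + 1 - v0" using v0(3) r by simp
    have "gcost (pole_radii m) (21 * m) P v0 = zero_val m P"
      unfolding zero_val_def using False
      by (subst gcost_zero_candidate[OF r P0 d]) (simp_all add: pole_radii_def Bs_def algebra_simps r)
    also have "\<dots> \<le> 7 * ((12 * m) div P) + weight m P"
    proof (cases "P \<le> 12 * m")
      case True
      then show ?thesis using vals_le_weight[OF P m True] by (auto simp: add.commute)
    next
      case False
      from d obtain t where t: "21 * m + r + 1 - v0 = P * t" by (elim dvdE)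
      \<comment> \<open>\<open>v0\<close> lies between \<open>P - 8 * m\<close> and
        \<open>8 * m\<close>. The first bound leaves \<open>t\<close> at most 1; the second then
        puts \<open>P\<close> above \<open>26 * m\<close>, against \<open>P\<close> at most
        \<open>16 * m\<close>.\<close>
      have "P * t \<le> 29 * m + r + 1 - P" "13 * m + r + 1 \<le> P * t" using t v0_ge v0(2) v' by auto
      then have *: "2 * (P * t) \<le> 58 * m + 1 - P" "26 * m + 1 + P \<le> 2 * (P * t)" using r by auto
      have "P * t < P * 2"
        using *(1) False m by linarith
      then have "t \<le> 1" using P0 by simp
      then have "P * t \<le> P * 1" using P0 by (intro mult_left_mono) auto
      then have "26 * m + 1 \<le> P" using * by linarith
      then show ?thesis using v' m by linarith
    qed
    finally show ?thesis using g v0(1) by simp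
  qed
qed

section \<open>Valuations at the poles\<close>

definition pole_order :: "int list \<Rightarrow> int \<Rightarrow> nat" where
  "pole_order ns w = length (filter (\<lambda>n. \<bar>w\<bar> \<le> n) ns)"

text \<open>This is \<open>local_series\<close> for \<open>wp_num\<close> and \<open>pole_order\<close> below; the zeros are the half-integers \<open>i + 1 / 2\<close>.\<close>
definition pole_series :: "int list \<Rightarrow> int \<Rightarrow> int \<Rightarrow> int \<Rightarrow> real fps" where
  "pole_series ns h M v = (fps_X + fps_const (of_int v)) *
     (\<Prod>i\<in>{- h..<h}. fps_X + fps_const (of_int (2 * (v - i) - 1) / 2)) *
     (\<Prod>w\<in>{- M..M} - {v}. inverse (fps_X + fps_const (of_int (v - w))) ^ pole_order ns w)"

text \<open>The block of radius \<open>n\<close> contributes the multiples of \<open>P\<close>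
  between v - n and v + n. Each block that contains \<open>v\<close> counts the excluded point w = v
  once, hence the subtraction of \<open>pole_order ns v\<close>.\<close>

lemma sum_pole_order_dvd:
  assumes "P > 0" "\<forall>n\<in>set ns. 0 \<le> n \<and> n \<le> M" "\<bar>v\<bar> \<le> M"
  shows "(\<Sum>w\<in>{- M..M} - {v}. int (pole_order ns w) * (if P dvd v - w then 1 else 0))
    = int (length ns) - int (pole_order ns v) + (\<Sum>n\<leftarrow>ns. (n + v) div P + (n - v) div P)"
  using assms(2)
proof (induction ns)
  case (Cons n ns)
  let ?d = "\<lambda>w. if P dvd v - w then 1 else 0 :: int"
  have n: "0 \<le> n" "n \<le> M" using Cons.prems by auto
  have "(\<Sum>w\<in>{- M..M} - {v}. (if \<bar>w\<bar> \<le> n then 1 else 0) * ?d w)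
      = (\<Sum>w\<in>{- M..M}. (if \<bar>w\<bar> \<le> n then 1 else 0) * ?d w) - (if \<bar>v\<bar> \<le> n then 1 else 0)"
    using assms(3) by (subst sum.remove[of "{- M..M}" v]) auto
  also have "(\<Sum>w\<in>{- M..M}. (if \<bar>w\<bar> \<le> n then 1 else 0) * ?d w) = (\<Sum>w\<in>{- n..n}. ?d w)"
    using n by (intro sum.mono_neutral_cong_right) auto
  also have "\<dots> = (\<Sum>w\<in>{v - n..v + n}. if P dvd w then 1 else 0)"
    by (rule sum.reindex_bij_witness[of _ "\<lambda>w. v - w" "\<lambda>w. v - w"]) auto
  also have "\<dots> = int (card {w \<in> {v - n..v + n}. P dvd w})"
    by (simp add: sum.If_cases Int_def)
  also have "\<dots> = (n + v) div P + (n - v) div P + 1"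
    using card_multiples[OF assms(1), of "v - n" "v + n"] n by (simp add: add.commute)
  finally have 1: "(\<Sum>w\<in>{- M..M} - {v}. (if \<bar>w\<bar> \<le> n then 1 else 0) * ?d w)
      = (n + v) div P + (n - v) div P + 1 - (if \<bar>v\<bar> \<le> n then 1 else 0)" .
  have "(\<Sum>w\<in>{- M..M} - {v}. int (pole_order (n # ns) w) * ?d w)
      = (\<Sum>w\<in>{- M..M} - {v}. (if \<bar>w\<bar> \<le> n then 1 else 0) * ?d w) + (\<Sum>w\<in>{- M..M} - {v}. int (pole_order ns w) * ?d w)"
    unfolding sum.distrib[symmetric] by (intro sum.cong) (auto simp: pole_order_def algebra_simps)
  then show ?case using Cons 1 by (simp add: pole_order_def)
qed (simp add: pole_order_def)

text \<open>Modulo the odd number P = 2 r + 1, twice the half-integer difference is 2 (v - i + r),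
  so the zeros behave like integers shifted by \<open>r\<close>.\<close>

lemma sum_zeros_dvd:
  fixes P r h v :: int
  assumes "P = 2 * r + 1" "P > 0" "h \<ge> 0"
  shows "(\<Sum>i\<in>{- h..<h}. if P dvd 2 * (v - i) - 1 then 1 else 0) = (h + v + P div 2) div P + (h - v + P div 2) div P"
proof -
  have dv: "P dvd 2 * (v - i) - 1 \<longleftrightarrow> P dvd v - i + r" for i
  proof -
    have "P dvd 2 * (v - i) - 1 \<longleftrightarrow> P dvd 2 * (v - i) - 1 + P" by simp
    also have "2 * (v - i) - 1 + P = 2 * (v - i + r)" using assms by simp
    also have "P dvd 2 * (v - i + r) \<longleftrightarrow> P dvd v - i + r"
      using assms(1) by (intro coprime_dvd_mult_right_iff) simp
    finally show ?thesis .
  qed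
  have "(\<Sum>i\<in>{- h..<h}. if P dvd 2 * (v - i) - 1 then 1 else 0 :: int) = (\<Sum>w\<in>{v - h + 1 + r..v + h + r}. if P dvd w then 1 else 0)"
    unfolding dv by (rule sum.reindex_bij_witness[of _ "\<lambda>w. v + r - w" "\<lambda>i. v - i + r"]) auto
  also have "\<dots> = int (card {w \<in> {v - h + 1 + r..v + h + r}. P dvd w})"
    by (simp add: sum.If_cases Int_def)
  also have "\<dots> = (v + h + r) div P + (- (v - h + 1 + r)) div P + 1"
    using assms by (intro card_multiples) auto
  also have "\<dots> = (v + h + r) div P + ((- (v - h + 1 + r)) div P + 1)" by simp
  also have "(- (v - h + 1 + r)) div P + 1 = (h - v + r) div P"
  proof -
    have e: "h - v + r = - (v - h + 1 + r) + 1 * P" using assms by simp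
    show ?thesis unfolding e using assms(2) by (subst div_mult_self1) auto
  qed
  finally show ?thesis using assms by (simp add: add.commute)
qed

lemma vge_half:
  assumes "prime p" "odd p"
  shows "vge p 0 (1 / 2)"
proof -
  have "\<not> int p dvd 2"
  proof
    assume "int p dvd 2"
    then have "p dvd 2" by (metis int_dvd_int_iff of_nat_numeral)
    then show False using assms primes_dvd_imp_eq[of p 2] by auto
  qed
  then show ?thesis unfolding vge_def by (intro exI[of _ 1] exI[of _ 2]) simp
qed

text \<open>For each prime power, \<open>gcost\<close> counts the pole \<open>v\<close> itself with
  its order, although \<open>v\<close> is omitted from the product. This surplus of \<open>L\<close>
  times the order, less the loss of \<open>L\<close> per index, leaves \<open>L\<close> times the
  order of the partial fraction: exactly what the denominators in \<open>beta_tail\<close>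
  consume.\<close>

lemma pole_series_vge:
  assumes p: "prime p" "odd p"
    and ns: "\<forall>n\<in>set ns. 0 \<le> n \<and> n \<le> M" and v: "\<bar>v\<bar> \<le> M" "M < h"
    and L: "4 * h < int p ^ Suc L"
  shows "vge p (int L * (int (pole_order ns v) - int k) - (\<Sum>l=1..L. gcost ns h (int p ^ l) v)) (pole_series ns h M v $ k)"
proof -
  define ez where "ez i = int (multiplicity (int p) (2 * (v - i) - 1))" for i
  define ep where "ep w = int (multiplicity (int p) (v - w))" for w
  have p0: "int p > 0" using p by (simp add: prime_gt_0_nat)
  note vge2 = vge_half[OF p]
  have F1: "fps_vge p L 0 (fps_X + fps_const (of_int v))"
    using p by (intro fps_vge_linear vge_of_int) auto
  have odd_nz: "2 * (v - i) - 1 \<noteq> 0" for i by presburger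
  have bz: "\<bar>2 * (v - i) - 1\<bar> < int p ^ Suc L" if "i \<in> {- h..<h}" for i
    using that v L by auto
  have F2: "fps_vge p L (ez i) (fps_X + fps_const (of_int (2 * (v - i) - 1) / 2))" if "i \<in> {- h..<h}" for i
  proof (rule fps_vge_linear[OF p(1)])
    show "vge p (ez i) (of_int (2 * (v - i) - 1) / 2)"
      using vge_mult[OF p(1) vge_multiplicity[OF p(1) odd_nz] vge2, of i] by (simp add: ez_def)
    show "ez i \<le> int L" using multiplicity_eq_sum(2)[OF p(1) odd_nz bz[OF that]] by (simp add: ez_def)
  qed
  have bp: "\<bar>v - w\<bar> < int p ^ Suc L" if "w \<in> {- M..M}" for w
    using that v L by auto
  have F3: "fps_vge p L (- ep w) (inverse (fps_X + fps_const (of_int (v - w))))" if "w \<in> {- M..M} - {v}" for w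
    unfolding ep_def using that multiplicity_eq_sum(2)[OF p(1) _ bp, of w] p(1) by (intro fps_vge_inverse_linear) auto
  have F: "fps_vge p L (0 + (\<Sum>i\<in>{- h..<h}. ez i) + (\<Sum>w\<in>{- M..M} - {v}. int (pole_order ns w) * - ep w)) (pole_series ns h M v)"
    unfolding pole_series_def
    by (intro fps_vge_mult fps_vge_prod fps_vge_power p F1 F2 F3)
  have Sz: "(\<Sum>i\<in>{- h..<h}. ez i) = (\<Sum>l=1..L. (h + v + int p ^ l div 2) div int p ^ l + (h - v + int p ^ l div 2) div int p ^ l)"
  proof -
    have "(\<Sum>i\<in>{- h..<h}. ez i) = (\<Sum>i\<in>{- h..<h}. \<Sum>l=1..L. if int p ^ l dvd 2 * (v - i) - 1 then 1 else 0)"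
      unfolding ez_def using multiplicity_eq_sum(1)[OF p(1) odd_nz bz] by (intro sum.cong refl) auto
    also have "\<dots> = (\<Sum>l=1..L. \<Sum>i\<in>{- h..<h}. if int p ^ l dvd 2 * (v - i) - 1 then 1 else 0)"
      by (rule sum.swap)
    also have "\<dots> = (\<Sum>l=1..L. (h + v + int p ^ l div 2) div int p ^ l + (h - v + int p ^ l div 2) div int p ^ l)"
    proof (intro sum.cong refl)
      fix l
      have "odd (int p ^ l)" using p by simp
      then obtain r where r: "int p ^ l = 2 * r + 1" by (elim oddE)
      have pl: "int p ^ l > 0" using p0 by simp
      show "(\<Sum>i\<in>{- h..<h}. if int p ^ l dvd 2 * (v - i) - 1 then 1 else 0) =
        (h + v + int p ^ l div 2) div int p ^ l + (h - v + int p ^ l div 2) div int p ^ l"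
        by (rule sum_zeros_dvd[OF r pl]) (use v in linarith)
    qed
    finally show ?thesis .
  qed
  have Sp: "(\<Sum>w\<in>{- M..M} - {v}. int (pole_order ns w) * ep w) =
     (\<Sum>l=1..L. int (length ns) - int (pole_order ns v) + (\<Sum>n\<leftarrow>ns. (n + v) div int p ^ l + (n - v) div int p ^ l))"
  proof -
    have "(\<Sum>w\<in>{- M..M} - {v}. int (pole_order ns w) * ep w)
      = (\<Sum>w\<in>{- M..M} - {v}. \<Sum>l=1..L. int (pole_order ns w) * (if int p ^ l dvd v - w then 1 else 0))"
      unfolding ep_def sum_distrib_left[symmetric]
      using multiplicity_eq_sum(1)[OF p(1) _ bp] by (intro sum.cong refl arg_cong2[of _ _ _ _ times]) auto
    also have "\<dots> = (\<Sum>l=1..L. \<Sum>w\<in>{- M..M} - {v}. int (pole_order ns w) * (if int p ^ l dvd v - w then 1 else 0))"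
      by (rule sum.swap)
    also have "\<dots> = (\<Sum>l=1..L. int (length ns) - int (pole_order ns v) + (\<Sum>n\<leftarrow>ns. (n + v) div int p ^ l + (n - v) div int p ^ l))"
      using p0 ns v by (intro sum.cong refl sum_pole_order_dvd) auto
    finally show ?thesis .
  qed
  have "0 + (\<Sum>i\<in>{- h..<h}. ez i) + (\<Sum>w\<in>{- M..M} - {v}. int (pole_order ns w) * - ep w) - int L * int k
      = int L * (int (pole_order ns v) - int k) - (\<Sum>l=1..L. gcost ns h (int p ^ l) v)"
    unfolding mult_minus_right sum_negf Sz Sp gcost_def sum.distrib sum_subtractf
    by (simp add: algebra_simps)
  then show ?thesis using F unfolding fps_vge_def by metis
qed

text \<open>At 2 the zeros give no gain: each of the \<open>2 * h\<close> half-integers has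
  valuation -1, and only the poles remain to be counted.\<close>

lemma pole_series_vge_2:
  assumes ns: "\<forall>n\<in>set ns. 0 \<le> n \<and> n \<le> M" and v: "\<bar>v\<bar> \<le> M" "M < h"
    and L: "4 * h < 2 ^ Suc L"
  shows "vge 2 (int L * (int (pole_order ns v) - int k) - 2 * h -
    (\<Sum>l=1..L. int (length ns) + (\<Sum>n\<leftarrow>ns. (n + v) div 2 ^ l + (n - v) div 2 ^ l))) (pole_series ns h M v $ k)"
proof -
  define ep where "ep w = int (multiplicity 2 (v - w))" for w
  have p: "prime (2 :: nat)" by simp
  have F1: "fps_vge 2 L 0 (fps_X + fps_const (of_int v))"
    by (intro fps_vge_linear vge_of_int) auto
  have F2: "fps_vge 2 L (- 1) (fps_X + fps_const (of_int (2 * (v - i) - 1) / 2))" for i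
  proof (rule fps_vge_linear[OF p])
    show "vge 2 (- 1) (of_int (2 * (v - i) - 1) / 2)"
      unfolding vge_def by (intro exI[of _ "2 * (v - i) - 1"] exI[of _ 1]) (simp add: power_int_minus)
  qed simp
  have bp: "\<bar>v - w\<bar> < int 2 ^ Suc L" if "w \<in> {- M..M}" for w
    using that v L by auto
  have F3: "fps_vge 2 L (- ep w) (inverse (fps_X + fps_const (of_int (v - w))))" if "w \<in> {- M..M} - {v}" for w
    using fps_vge_inverse_linear[OF p, of "v - w" L] multiplicity_eq_sum(2)[OF p _ bp, of w] that
    by (simp add: ep_def)
  have F: "fps_vge 2 L (0 + (\<Sum>i\<in>{- h..<h}. - 1) + (\<Sum>w\<in>{- M..M} - {v}. int (pole_order ns w) * - ep w)) (pole_series ns h M v)"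
    unfolding pole_series_def
    by (intro fps_vge_mult fps_vge_prod fps_vge_power p F1 F2 F3)
  have Sp: "(\<Sum>w\<in>{- M..M} - {v}. int (pole_order ns w) * ep w) =
     (\<Sum>l=1..L. int (length ns) - int (pole_order ns v) + (\<Sum>n\<leftarrow>ns. (n + v) div 2 ^ l + (n - v) div 2 ^ l))"
  proof -
    have "(\<Sum>w\<in>{- M..M} - {v}. int (pole_order ns w) * ep w)
      = (\<Sum>w\<in>{- M..M} - {v}. \<Sum>l=1..L. int (pole_order ns w) * (if 2 ^ l dvd v - w then 1 else 0))"
      unfolding ep_def sum_distrib_left[symmetric]
      using multiplicity_eq_sum(1)[OF p _ bp] by (intro sum.cong refl arg_cong2[of _ _ _ _ times]) auto
    also have "\<dots> = (\<Sum>l=1..L. \<Sum>w\<in>{- M..M} - {v}. int (pole_order ns w) * (if 2 ^ l dvd v - w then 1 else 0))"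
      by (rule sum.swap)
    also have "\<dots> = (\<Sum>l=1..L. int (length ns) - int (pole_order ns v) + (\<Sum>n\<leftarrow>ns. (n + v) div 2 ^ l + (n - v) div 2 ^ l))"
      using ns v by (intro sum.cong refl sum_pole_order_dvd) auto
    finally show ?thesis .
  qed
  have "0 + (\<Sum>i\<in>{- h..<h}. - 1) + (\<Sum>w\<in>{- M..M} - {v}. int (pole_order ns w) * - ep w) - int L * int k
      = int L * (int (pole_order ns v) - int k) - 2 * h -
        (\<Sum>l=1..L. int (length ns) + (\<Sum>n\<leftarrow>ns. (n + v) div 2 ^ l + (n - v) div 2 ^ l))"
    unfolding mult_minus_right sum_negf Sp sum.distrib sum_subtractf using v
    by (simp add: algebra_simps)
  then show ?thesis using F unfolding fps_vge_def by metis
qed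

text \<open>Here \<open>p\<close> exceeds all differences between \<open>v\<close> and other poles,
  so every factor has \<open>p\<close>-integral coefficients and \<open>L = 0\<close> is
  possible.\<close>

lemma pole_series_vge_unit:
  assumes p: "prime p" "odd p" and v: "\<bar>v\<bar> + M < int p"
  shows "vge p 0 (pole_series ns h M v $ k)"
proof -
  note vge2 = vge_half[OF p]
  have F1: "fps_vge p 0 0 (fps_X + fps_const (of_int v))"
    using p by (intro fps_vge_linear vge_of_int) auto
  have F2: "fps_vge p 0 0 (fps_X + fps_const (of_int (2 * (v - i) - 1) / 2))" for i
    using vge_mult[OF p(1) vge_of_int[OF p(1)] vge2, of "2 * (v - i) - 1"] p by (intro fps_vge_linear) auto
  have F3: "fps_vge p 0 0 (inverse (fps_X + fps_const (of_int (v - w))))" if "w \<in> {- M..M} - {v}" for w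
  proof -
    have "\<bar>v - w\<bar> < int p ^ Suc 0" using that v by auto
    then have "multiplicity (int p) (v - w) \<le> 0" using that by (intro multiplicity_eq_sum(2)[OF p(1)]) auto
    then show ?thesis using fps_vge_inverse_linear[OF p(1), of "v - w" 0] that by simp
  qed
  have "fps_vge p 0 (0 + (\<Sum>i\<in>{- h..<h}. 0) + (\<Sum>w\<in>{- M..M} - {v}. int (pole_order ns w) * 0)) (pole_series ns h M v)"
    unfolding pole_series_def
    by (intro fps_vge_mult fps_vge_prod fps_vge_power p F1 F2 F3)
  then show ?thesis unfolding fps_vge_def by simp
qed

section \<open>Size of the well-poised series\<close>

text \<open>Dividing the coefficients of \<open>f\<close> by \<open>n + a\<close> gives the solution \<open>g\<close> of \<open>z g' + a g = f\<close>, that is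
  \<open>z\<^sup>a g(z) = \<integral> t\<^bsup>a-1\<^esup> f(t) dt\<close> over \<open>[0, z]\<close>, so positivity and power bounds are inherited, even at the boundary point \<open>z = 1\<close>.\<close>
lemma power_series_divide_step:
  fixes b :: "nat \<Rightarrow> real" and a s K Z :: real
  assumes conv: "\<And>z. \<bar>z\<bar> < 1 \<Longrightarrow> summable (\<lambda>n. b n * z ^ n)"
    and bounds: "\<And>z. 0 < z \<Longrightarrow> z < 1 \<Longrightarrow> 0 < (\<Sum>n. b n * z ^ n) \<and> (\<Sum>n. b n * z ^ n) \<le> K * z powr (- s)"
    and a: "0 \<le> s" "s < a" and Z: "0 < Z" "Z \<le> 1"
    and summ: "summable (\<lambda>n. \<bar>b n / (real n + a)\<bar> * Z ^ n)"
  shows "0 < (\<Sum>n. b n / (real n + a) * Z ^ n) \<and> (\<Sum>n. b n / (real n + a) * Z ^ n) \<le> K / (a - s) * Z powr (- s)"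
proof -
  let ?c = "\<lambda>n. b n / (real n + a)"
  define f where "f z = (\<Sum>n. b n * z ^ n)" for z
  define g where "g z = (\<Sum>n. ?c n * z ^ n)" for z
  have convg: "summable (\<lambda>n. ?c n * z ^ n)" if "\<bar>z\<bar> < 1" for z
  proof (rule summable_comparison_test)
    define y where "y = (1 + \<bar>z\<bar>) / 2"
    have y: "\<bar>z\<bar> < y" "y < 1" using that by (auto simp: y_def)
    have "summable (\<lambda>n. norm (b n * z ^ n))"
      by (rule powser_insidea[OF conv[of y]]) (use y in auto)
    then show "summable (\<lambda>n. norm (b n * z ^ n) / a)" by (rule summable_divide)
    show "\<exists>N. \<forall>n\<ge>N. norm (?c n * z ^ n) \<le> norm (b n * z ^ n) / a"
    proof (intro exI allI impI)
      fix n :: nat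
      have "norm (?c n * z ^ n) = norm (b n * z ^ n) / (real n + a)"
        using a by (simp add: abs_mult)
      also have "\<dots> \<le> norm (b n * z ^ n) / a" using a by (intro divide_left_mono) auto
      finally show "norm (?c n * z ^ n) \<le> norm (b n * z ^ n) / a" .
    qed
  qed
  have deriv: "((\<lambda>z. z powr a * g z) has_real_derivative z powr (a - 1) * f z) (at z)" if z: "0 < z" "z < 1" for z
  proof -
    define y where "y = (1 + z) / 2"
    have y: "\<bar>z\<bar> < \<bar>y\<bar>" "\<bar>y\<bar> < 1" using z by (auto simp: y_def)
    have D: "(g has_real_derivative (\<Sum>n. diffs ?c n * z ^ n)) (at z)"
      unfolding g_def by (rule termdiffs_strong[OF convg[OF y(2)]]) (use y in auto)
    have sd: "summable (\<lambda>n. diffs ?c n * z ^ n)"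
      by (rule termdiff_converges[of z 1]) (use z convg in auto)
    from sums_mult[OF diffs_equiv[OF this], of z]
    have "(\<lambda>n. z * (real n * ?c n * z ^ (n - Suc 0))) sums (z * (\<Sum>n. diffs ?c n * z ^ n))" .
    moreover have "z * (real n * ?c n * z ^ (n - Suc 0)) = real n * ?c n * z ^ n" for n by (cases n) auto
    ultimately have "(\<lambda>n. real n * ?c n * z ^ n) sums (z * (\<Sum>n. diffs ?c n * z ^ n))" by (simp only:)
    moreover have "(\<lambda>n. a * (?c n * z ^ n)) sums (a * g z)"
      unfolding g_def using z by (intro sums_mult summable_sums convg) auto
    ultimately have "(\<lambda>n. real n * ?c n * z ^ n + a * (?c n * z ^ n)) sums (z * (\<Sum>n. diffs ?c n * z ^ n) + a * g z)"
      by (rule sums_add)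
    moreover have "real n * ?c n * z ^ n + a * (?c n * z ^ n) = b n * z ^ n" for n
    proof -
      have "real n * ?c n * z ^ n + a * (?c n * z ^ n) = (real n + a) * ?c n * z ^ n"
        by (simp only: distrib_right mult.assoc)
      also have "(real n + a) * ?c n = b n" using a by simp
      finally show ?thesis .
    qed
    ultimately have e: "z * (\<Sum>n. diffs ?c n * z ^ n) + a * g z = f z" unfolding f_def by (simp add: sums_iff)
    have "((\<lambda>z. z powr a * g z) has_real_derivative (a * z powr (a - 1)) * g z + (\<Sum>n. diffs ?c n * z ^ n) * z powr a) (at z)"
      by (rule DERIV_mult[OF has_real_derivative_powr[OF z(1)] D])
    also have "(a * z powr (a - 1)) * g z + (\<Sum>n. diffs ?c n * z ^ n) * z powr a = z powr (a - 1) * f z"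
    proof -
      have "z powr a = z powr (a - 1) * z" using z powr_add[of z "a - 1" 1] by simp
      then show ?thesis unfolding e[symmetric] by (simp add: algebra_simps)
    qed
    finally show ?thesis .
  qed
  \<comment> \<open>Absolute convergence at \<open>Z\<close> gives uniform convergence on the closed
    interval, hence continuity of \<open>g\<close> at the end point, also for Z = 1.\<close>
  have contg: "continuous_on {0..Z} g"
    unfolding g_def
  proof (rule uniform_limit_theorem[where F = sequentially])
    show "uniform_limit {0..Z} (\<lambda>n x. \<Sum>i<n. ?c i * x ^ i) (\<lambda>x. \<Sum>i. ?c i * x ^ i) sequentially"
    proof (rule Weierstrass_m_test[OF _ summ])
      fix n x assume "x \<in> {0..Z}"
      then have "x ^ n \<le> Z ^ n" "0 \<le> x" by (auto intro: power_mono)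
      then show "norm (?c n * x ^ n) \<le> \<bar>?c n\<bar> * Z ^ n" by (simp add: abs_mult mult_left_mono divide_right_mono)
    qed
  qed (use a in \<open>auto intro!: always_eventually continuous_intros\<close>)
  have contG: "continuous_on {0..Z} (\<lambda>z. z powr a * g z)"
    using a by (intro continuous_on_mult continuous_on_powr' continuous_on_id continuous_on_const contg) auto
  have "(0::real) powr a * g 0 < Z powr a * g Z"
  proof (rule DERIV_pos_imp_increasing_open[OF Z(1) _ contG])
    fix x assume x: "0 < x" "x < Z"
    then have "0 < x powr (a - 1) * f x" using bounds[of x] Z unfolding f_def by auto
    then show "\<exists>y. ((\<lambda>z. z powr a * g z) has_real_derivative y) (at x) \<and> 0 < y"
      using deriv[of x] x Z by (intro exI[of _ "x powr (a - 1) * f x"]) auto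
  qed
  then have pos: "0 < g Z" using Z by (simp add: zero_less_mult_iff)
  \<comment> \<open>The first summand is an antiderivative of K z^(a - s - 1), which dominates the
    derivative of z^a g(z). So \<open>?D\<close> does not decrease, and it vanishes at 0 because s <
    a.\<close>
  let ?D = "\<lambda>z. K / (a - s) * z powr (a - s) - z powr a * g z"
  have "?D 0 \<le> ?D Z"
  proof (rule DERIV_nonneg_imp_increasing_open[where f = ?D])
    fix x assume x: "0 < x" "x < Z"
    have "((\<lambda>z. K / (a - s) * z powr (a - s)) has_real_derivative K * x powr (a - s - 1)) (at x)"
      using DERIV_cmult[OF has_real_derivative_powr[OF x(1)], of "K / (a - s)" "a - s"] a by simp
    then have "(?D has_real_derivative K * x powr (a - s - 1) - x powr (a - 1) * f x) (at x)"
      using deriv[of x] x Z by (intro DERIV_diff) auto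
    moreover have "x powr (a - 1) * f x \<le> x powr (a - 1) * (K * x powr (- s))"
      using bounds[of x] x Z unfolding f_def by (intro mult_left_mono) auto
    moreover have "x powr (a - 1) * (K * x powr (- s)) = K * x powr (a - s - 1)"
      by (simp add: powr_add[symmetric] algebra_simps)
    ultimately show "\<exists>y. (?D has_real_derivative y) (at x) \<and> 0 \<le> y"
      by (intro exI[of _ "K * x powr (a - s - 1) - x powr (a - 1) * f x"]) auto
  next
    show "continuous_on {0..Z} ?D"
      using a by (intro continuous_on_diff continuous_on_mult continuous_on_powr' continuous_on_id continuous_on_const contG) auto
  qed (use Z in auto)
  then have "Z powr a * g Z \<le> K / (a - s) * Z powr (a - s)" using a by simp
  also have "\<dots> = Z powr a * (K / (a - s) * Z powr (- s))" using powr_add[of Z a "- s"] by simp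
  finally have "g Z \<le> K / (a - s) * Z powr (- s)"
    using Z by (subst (asm) mult_le_cancel_left_pos) auto
  then show ?thesis using pos unfolding g_def by simp
qed

text \<open>(-1)^n times the numerator of R at u = n + h + 1/2: the factors u - (i + 1/2) become n +
  1, ..., n + 2 h.\<close>

definition wp_coeff :: "nat \<Rightarrow> nat \<Rightarrow> real" where
  "wp_coeff h n = (- 1) ^ n * (\<Prod>i=1..2 * h. real n + real i) * (real n + real h + 1 / 2)"

lemma prod_shift_eq_fact: "(\<Prod>i=1..k. real n + real i) = fact (n + k) / fact n"
proof (induction k)
  case (Suc k)
  have "(\<Prod>i=1..Suc k. real n + real i) = (\<Prod>i=1..k. real n + real i) * (real n + real (Suc k))" by simp
  also have "\<dots> = fact (n + k) / fact n * (real n + real (Suc k))" by (simp only: Suc)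
  also have "\<dots> = fact (n + Suc k) / fact n" by (simp add: algebra_simps)
  finally show ?case .
qed simp

text \<open>Splitting 2 n + 2 h + 1 as (n + 2 h + 1) + n writes the coefficient as a sum of two
  neighbouring binomial coefficients; with the alternating signs this is 1 - z times the binomial
  series of (1 + z)^(-(2 h + 2)).\<close>

lemma wp_coeff_sums:
  assumes "\<bar>z\<bar> < 1"
  shows "(\<lambda>n. wp_coeff h n * z ^ n) sums (fact (2 * h) * (h + 1 / 2) * (1 - z) / (1 + z) ^ (2 * h + 2))"
proof -
  let ?c = "2 * h + 1"
  let ?B = "\<lambda>n. (- 1) ^ n * real ((n + ?c) choose n)"
  have B: "(- real (2 * h + 2) gchoose n) = ?B n" for n
  proof -
    have "(- real (2 * h + 2) gchoose n) = (- 1) ^ n * ((real (2 * h + 2) + real n - 1) gchoose n)"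
      by (subst gbinomial_minus) simp
    also have "real (2 * h + 2) + real n - 1 = real (n + ?c)" by simp
    finally show ?thesis by (simp add: binomial_gbinomial)
  qed
  have z: "1 + z > 0" using assms by simp
  have S: "(\<lambda>n. ?B n * z ^ n) sums (1 / (1 + z) ^ (2 * h + 2))"
  proof -
    have "(1 + z) powr (- real (2 * h + 2)) = 1 / (1 + z) ^ (2 * h + 2)"
      by (simp only: powr_minus_divide powr_realpow[OF z])
    then show ?thesis using gen_binomial_real[OF assms, of "- real (2 * h + 2)"] B by simp
  qed
  have S': "(\<lambda>n. (if n = 0 then 0 else ?B (n - 1)) * z ^ n) sums (z * (1 / (1 + z) ^ (2 * h + 2)))"
  proof -
    have "(\<lambda>n. z * (?B n * z ^ n)) sums (z * (1 / (1 + z) ^ (2 * h + 2)))"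
      by (intro sums_mult S)
    then have "(\<lambda>n. (if Suc n = 0 then 0 else ?B (Suc n - 1)) * z ^ Suc n) sums (z * (1 / (1 + z) ^ (2 * h + 2)))"
      by (simp add: mult_ac)
    then show ?thesis by (subst (asm) sums_Suc_iff) simp
  qed
  have "(\<lambda>n. fact (2 * h) * (h + 1 / 2) * (?B n * z ^ n - (if n = 0 then 0 else ?B (n - 1)) * z ^ n))
      sums (fact (2 * h) * (h + 1 / 2) * (1 / (1 + z) ^ (2 * h + 2) - z * (1 / (1 + z) ^ (2 * h + 2))))"
    by (intro sums_mult sums_diff S S')
  moreover have "fact (2 * h) * (h + 1 / 2) * (?B n * z ^ n - (if n = 0 then 0 else ?B (n - 1)) * z ^ n) = wp_coeff h n * z ^ n" for n
  proof (cases n)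
    case 0
    then show ?thesis by (simp add: wp_coeff_def fact_prod)
  next
    case (Suc k)
    have f1: "real ((n + ?c) choose n) = fact (n + ?c) / (fact n * fact ?c)"
      by (subst binomial_fact) auto
    have f2: "real ((k + ?c) choose k) = fact (k + ?c) / (fact k * fact ?c)"
      by (subst binomial_fact) auto
    have n: "real n > 0" using Suc by simp
    have e1: "fact (n + ?c) = (real n + 2 * real h + 1) * fact (n + 2 * h)" by (simp add: algebra_simps)
    have e2: "fact (k + ?c) = (fact (n + 2 * h) :: real)" unfolding Suc by simp
    have e3: "fact n = real n * fact k" unfolding Suc by simp
    have e4: "fact ?c = (2 * real h + 1) * fact (2 * h)" by simp
    have "real ((n + ?c) choose n) + real ((k + ?c) choose k)
        = (2 * real n + 2 * real h + 1) * fact (n + 2 * h) / (fact n * ((2 * real h + 1) * fact (2 * h)))"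
      unfolding f1 f2 e1 e2 e4 unfolding e3 using n by (simp add: divide_simps) (simp add: algebra_simps)
    moreover have "fact (2 * h) * (h + 1 / 2) * ((2 * real n + 2 * real h + 1) * F / (f * ((2 * real h + 1) * fact (2 * h))))
        = F / f * (real n + real h + 1 / 2)" for F f :: real
      by (simp add: divide_simps) (simp add: algebra_simps)
    ultimately have "fact (2 * h) * (h + 1 / 2) * (real ((n + ?c) choose n) + real ((k + ?c) choose k)) = (fact (n + 2 * h) / fact n) * (real n + real h + 1 / 2)"
      by simp
    moreover have "?B n - ?B (n - 1) = (- 1) ^ n * (real ((n + ?c) choose n) + real ((k + ?c) choose k))"
    proof -
      have nk: "n - 1 = k" and sg: "(- 1 :: real) ^ n = - ((- 1) ^ k)" by (simp_all add: Suc)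
      have "(- s) * X - s * Y = (- s) * (X + Y)" for s X Y :: real by (simp add: algebra_simps)
      then show ?thesis unfolding nk sg .
    qed
    moreover have "F * (s * X) = s * (F * X)" for F s X :: real by simp
    ultimately have *: "fact (2 * h) * (h + 1 / 2) * (?B n - ?B (n - 1)) = wp_coeff h n"
      unfolding wp_coeff_def prod_shift_eq_fact mult.assoc[of "(- 1) ^ n"] by (simp only:)
    have B1: "(if n = 0 then 0 else ?B (n - 1)) = ?B (n - 1)" using Suc by simp
    have "F * (X * y - Y * y) = F * (X - Y) * y" for F X Y y :: real by (simp add: algebra_simps)
    then show ?thesis unfolding B1 *[symmetric] .
  qed
  moreover have "fact (2 * h) * (h + 1 / 2) * (1 / (1 + z) ^ (2 * h + 2) - z * (1 / (1 + z) ^ (2 * h + 2))) =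
     fact (2 * h) * (h + 1 / 2) * (1 - z) / (1 + z) ^ (2 * h + 2)"
    by (simp add: algebra_simps diff_divide_distrib)
  ultimately show ?thesis by (metis (no_types, lifting) sums_cong)
qed

text \<open>The maximum of z / (1 + z)^(N + 1) is attained at z = 1 / N. Bernoulli's inequality is
  applied with \<open>?y\<close>, which vanishes exactly there.\<close>

lemma times_power_le_power_Suc:
  assumes "0 \<le> (z::real)" "N > 0"
  shows "z * real (Suc N) ^ Suc N \<le> real N ^ N * (1 + z) ^ Suc N"
proof -
  let ?y = "(real N * z - 1) / real (Suc N)"
  have "0 \<le> real N * z" using assms by simp
  then have "- 1 \<le> ?y" by (subst pos_le_divide_eq) auto
  then have "1 + real (Suc N) * ?y \<le> (1 + ?y) ^ Suc N" by (rule Bernoulli_inequality)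
  moreover have "1 + real (Suc N) * ?y = real N * z" by simp
  moreover have "1 + ?y = real N * (1 + z) / real (Suc N)" by (simp add: field_simps)
  ultimately have "real N * z \<le> real N ^ Suc N * (1 + z) ^ Suc N / real (Suc N) ^ Suc N"
    by (simp only: power_divide power_mult_distrib)
  then have "real N * (z * real (Suc N) ^ Suc N) \<le> real N * (real N ^ N * (1 + z) ^ Suc N)"
    by (simp add: field_simps del: power_Suc) (simp add: power_Suc[of "real N"] mult_ac del: power_Suc)
  then show ?thesis using assms by simp
qed

definition wp_term :: "nat \<Rightarrow> real list \<Rightarrow> nat \<Rightarrow> real" where
  "wp_term h as n = wp_coeff h n / (\<Prod>a\<leftarrow>as. real n + a)"

lemma wp_term_Cons: "wp_term h (a # as) n = wp_term h as n / (real n + a)"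
  by (simp add: wp_term_def)

text \<open>Induction over the factors: the closed form of the undivided series is at most a
  multiple of z^(-s), and each division by n + a costs the factor 1 / (a - s).\<close>

lemma wp_term_powser:
  assumes "\<forall>a\<in>set as. s < a" "0 \<le> s" "\<And>z. 0 < z \<Longrightarrow> z < 1 \<Longrightarrow> z powr s \<le> \<kappa> * (1 + z) ^ (2 * h + 2)"
  shows "(\<forall>z. \<bar>z\<bar> < 1 \<longrightarrow> summable (\<lambda>n. wp_term h as n * z ^ n)) \<and>
    (\<forall>z. 0 < z \<longrightarrow> z < 1 \<longrightarrow> 0 < (\<Sum>n. wp_term h as n * z ^ n) \<and>
      (\<Sum>n. wp_term h as n * z ^ n) \<le> fact (2 * h) * (h + 1 / 2) * \<kappa> / (\<Prod>a\<leftarrow>as. a - s) * z powr (- s))"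
  using assms(1)
proof (induction as)
  case Nil
  have "0 < fact (2 * h) * (h + 1 / 2) * (1 - z) / (1 + z) ^ (2 * h + 2) \<and>
     fact (2 * h) * (h + 1 / 2) * (1 - z) / (1 + z) ^ (2 * h + 2) \<le> fact (2 * h) * (h + 1 / 2) * \<kappa> * z powr (- s)"
    if z: "0 < z" "z < 1" for z :: real
  proof -
    have "1 - z \<le> 1" using z by simp
    also have "1 = z powr s * z powr (- s)" using z by (simp add: powr_add[symmetric])
    also have "\<dots> \<le> \<kappa> * (1 + z) ^ (2 * h + 2) * z powr (- s)"
      using z assms(3) by (intro mult_right_mono) auto
    finally have "(1 - z) / (1 + z) ^ (2 * h + 2) \<le> \<kappa> * z powr (- s)"
      using z by (simp add: divide_le_eq mult_ac)
    then have "fact (2 * h) * (h + 1 / 2) * ((1 - z) / (1 + z) ^ (2 * h + 2)) \<le> fact (2 * h) * (h + 1 / 2) * (\<kappa> * z powr (- s))"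
      by (intro mult_left_mono) auto
    then show ?thesis using z by (simp add: mult_ac)
  qed
  then show ?case using wp_coeff_sums[of _ h] by (auto simp: wp_term_def sums_iff)
next
  case (Cons a as)
  then have as: "\<forall>a\<in>set as. s < a" "s < a" by auto
  let ?K = "fact (2 * h) * (h + 1 / 2) * \<kappa> / (\<Prod>a\<leftarrow>as. a - s)"
  from Cons.IH[OF as(1)] have conv: "\<And>z. \<bar>z\<bar> < 1 \<Longrightarrow> summable (\<lambda>n. wp_term h as n * z ^ n)"
    and bnd: "\<And>z. 0 < z \<Longrightarrow> z < 1 \<Longrightarrow> 0 < (\<Sum>n. wp_term h as n * z ^ n) \<and>
      (\<Sum>n. wp_term h as n * z ^ n) \<le> ?K * z powr (- s)" by auto
  have absconv: "summable (\<lambda>n. \<bar>wp_term h as n / (real n + a)\<bar> * \<bar>z\<bar> ^ n)" if "\<bar>z\<bar> < 1" for z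
  proof (rule summable_comparison_test)
    define y where "y = (1 + \<bar>z\<bar>) / 2"
    have y: "\<bar>z\<bar> < y" "y < 1" using that by (auto simp: y_def)
    have "summable (\<lambda>n. norm (wp_term h as n * z ^ n))"
      by (rule powser_insidea[OF conv[of y]]) (use y in auto)
    then show "summable (\<lambda>n. norm (wp_term h as n * z ^ n) / a)" by (rule summable_divide)
    show "\<exists>N. \<forall>n\<ge>N. norm (\<bar>wp_term h as n / (real n + a)\<bar> * \<bar>z\<bar> ^ n) \<le> norm (wp_term h as n * z ^ n) / a"
    proof (intro exI allI impI)
      fix n :: nat
      have "norm (\<bar>wp_term h as n / (real n + a)\<bar> * \<bar>z\<bar> ^ n) = norm (wp_term h as n * z ^ n) / (real n + a)"
        using as assms(2) by (simp add: abs_mult power_abs)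
      also have "\<dots> \<le> norm (wp_term h as n * z ^ n) / a" using as assms(2) by (intro divide_left_mono) auto
      finally show "norm (\<bar>wp_term h as n / (real n + a)\<bar> * \<bar>z\<bar> ^ n) \<le> norm (wp_term h as n * z ^ n) / a" .
    qed
  qed
  have "summable (\<lambda>n. wp_term h (a # as) n * z ^ n)" if "\<bar>z\<bar> < 1" for z
    using absconv[OF that] unfolding wp_term_Cons
    by (intro summable_norm_cancel[of "\<lambda>n. _ n * z ^ n"]) (simp add: abs_mult power_abs)
  moreover have "0 < (\<Sum>n. wp_term h (a # as) n * z ^ n) \<and>
      (\<Sum>n. wp_term h (a # as) n * z ^ n) \<le> fact (2 * h) * (h + 1 / 2) * \<kappa> / (\<Prod>a\<leftarrow>a # as. a - s) * z powr (- s)"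
    if z: "0 < z" "z < 1" for z
  proof -
    have "\<bar>z\<bar> < 1" "\<bar>z\<bar> = z" using z by auto
    then have "summable (\<lambda>n. \<bar>wp_term h as n / (real n + a)\<bar> * z ^ n)" using absconv[of z] by metis
    from power_series_divide_step[OF conv bnd assms(2) as(2) z(1) less_imp_le[OF z(2)] this]
    show ?thesis by (simp add: wp_term_Cons mult.commute)
  qed
  ultimately show ?case by blast
qed

text \<open>All divisions but one take place for z < 1; the last is carried out at Z = 1, where
  absolute convergence is assumed only for the complete series.\<close>

proposition wp_series_bounds:
  assumes "\<forall>a\<in>set as. s < a" "0 \<le> s" "\<And>z. 0 < z \<Longrightarrow> z < 1 \<Longrightarrow> z powr s \<le> \<kappa> * (1 + z) ^ (2 * h + 2)"
    and "as \<noteq> []" "summable (\<lambda>n. \<bar>wp_term h as n\<bar>)"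
  shows "0 < (\<Sum>n. wp_term h as n)" "(\<Sum>n. wp_term h as n) \<le> fact (2 * h) * (h + 1 / 2) * \<kappa> / (\<Prod>a\<leftarrow>as. a - s)"
proof -
  obtain a bs where as: "as = a # bs" using assms(4) by (meson neq_Nil_conv)
  have bs: "\<forall>a\<in>set bs. s < a" "s < a" using assms(1) as by auto
  let ?K = "fact (2 * h) * (h + 1 / 2) * \<kappa> / (\<Prod>a\<leftarrow>bs. a - s)"
  from wp_term_powser[OF bs(1) assms(2,3)] have conv: "\<And>z. \<bar>z\<bar> < 1 \<Longrightarrow> summable (\<lambda>n. wp_term h bs n * z ^ n)"
    and bnd: "\<And>z. 0 < z \<Longrightarrow> z < 1 \<Longrightarrow> 0 < (\<Sum>n. wp_term h bs n * z ^ n) \<and>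
      (\<Sum>n. wp_term h bs n * z ^ n) \<le> ?K * z powr (- s)" by auto
  have "0 < (\<Sum>n. wp_term h as n) \<and> (\<Sum>n. wp_term h as n) \<le> ?K / (a - s)"
    using power_series_divide_step[OF conv bnd assms(2) bs(2), of 1] assms(5)
    by (simp add: as wp_term_Cons)
  then show "0 < (\<Sum>n. wp_term h as n)" "(\<Sum>n. wp_term h as n) \<le> fact (2 * h) * (h + 1 / 2) * \<kappa> / (\<Prod>a\<leftarrow>as. a - s)"
    by (auto simp: as mult.commute)
qed

section \<open>Linear forms in beta values\<close>

definition wp_num :: "int \<Rightarrow> real poly" where
  "wp_num h = [:0, 1:] * (\<Prod>i\<in>{- h..<h}. [:- (of_int i + 1 / 2), 1:])"

definition wp_ratio :: "int list \<Rightarrow> int \<Rightarrow> int \<Rightarrow> real \<Rightarrow> real" where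
  "wp_ratio ns h M u = poly (wp_num h) u / (\<Prod>w\<in>{- M..M}. (u - of_int w) ^ pole_order ns w)"

lemma degree_wp_num: "h \<ge> 0 \<Longrightarrow> degree (wp_num h) = nat (2 * h) + 1"
  unfolding wp_num_def
  by (subst degree_mult_eq) (auto simp: degree_prod_sum_eq)

lemma pole_series_eq_local_series:
  "local_series (wp_num h) (of_int ` {- M..M}) (\<lambda>x. pole_order ns \<lfloor>x\<rfloor>) (of_int v) = pole_series ns h M v"
proof -
  have "fps_of_poly (pcompose (wp_num h) [:of_int v, 1:]) =
    (fps_X + fps_const (of_int v)) * (\<Prod>i\<in>{- h..<h}. fps_X + fps_const (of_int (2 * (v - i) - 1) / 2))"
  proof -
    have lin: "fps_of_poly (pcompose [:- (of_int i + 1 / 2), 1:] [:of_int v, 1:]) = fps_X + fps_const (of_int (2 * (v - i) - 1) / 2 :: real)" for i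
      by (simp add: pcompose_pCons fps_of_poly_linear field_simps)
    then show ?thesis
      unfolding wp_num_def pcompose_mult fps_of_poly_mult pcompose_prod fps_of_poly_prod lin
      by (simp add: pcompose_pCons fps_of_poly_linear)
  qed
  moreover have "(\<Prod>w\<in>of_int ` {- M..M} - {of_int v}. inverse (fps_X + fps_const (of_int v - w)) ^ pole_order ns \<lfloor>w\<rfloor>)
     = (\<Prod>w\<in>{- M..M} - {v}. inverse (fps_X + fps_const (of_int (v - w) :: real)) ^ pole_order ns w)"
  proof -
    have "of_int ` {- M..M} - {of_int v} = (of_int ` ({- M..M} - {v}) :: real set)" by auto
    then show ?thesis by (simp add: prod.reindex inj_on_def)
  qed
  ultimately show ?thesis unfolding local_series_def pole_series_def by simp
qed

lemma sum_pole_order: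
  assumes "\<forall>n\<in>set ns. 0 \<le> n \<and> n \<le> M"
  shows "(\<Sum>w\<in>{- M..M}. pole_order ns w) = (\<Sum>n\<leftarrow>ns. nat (2 * n + 1))"
  using assms
proof (induction ns)
  case (Cons n ns)
  then have n: "0 \<le> n" "n \<le> M" by auto
  have "(\<Sum>w\<in>{- M..M}. pole_order (n # ns) w) = (\<Sum>w\<in>{- M..M}. (if w \<in> {- n..n} then 1 else 0)) + (\<Sum>w\<in>{- M..M}. pole_order ns w)"
    unfolding sum.distrib[symmetric] by (intro sum.cong) (auto simp: pole_order_def)
  also have "(\<Sum>w\<in>{- M..M}. (if w \<in> {- n..n} then 1 else 0)) = card ({- M..M} \<inter> {- n..n})"
    by (simp add: sum.If_cases Int_def)
  also have "{- M..M} \<inter> {- n..n} = {- n..n}" using n by auto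
  finally show ?case using Cons by simp
qed (simp add: pole_order_def)

lemma wp_ratio_partial_fractions:
  assumes "h \<ge> 0" "\<forall>n\<in>set ns. 0 \<le> n \<and> n \<le> M" "nat (2 * h) + 1 < (\<Sum>n\<leftarrow>ns. nat (2 * n + 1))" "u \<notin> of_int ` {- M..M}"
  shows "wp_ratio ns h M u = (\<Sum>v\<in>{- M..M}. \<Sum>k<pole_order ns v. pole_series ns h M v $ k / (u - of_int v) ^ (pole_order ns v - k))"
proof -
  have inj: "inj_on (of_int :: int \<Rightarrow> real) {- M..M}" by (simp add: inj_on_def)
  have "(\<Sum>x\<in>of_int ` {- M..M}. pole_order ns \<lfloor>x :: real\<rfloor>) = (\<Sum>n\<leftarrow>ns. nat (2 * n + 1))"
    by (simp add: sum.reindex[OF inj] sum_pole_order[OF assms(2)])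
  then have deg: "degree (wp_num h) < (\<Sum>x\<in>of_int ` {- M..M}. pole_order ns \<lfloor>x :: real\<rfloor>)"
    using assms by (simp add: degree_wp_num)
  show ?thesis
    using partial_fractions[OF _ deg assms(4)]
    by (simp add: wp_ratio_def sum.reindex[OF inj] prod.reindex[OF inj] pole_series_eq_local_series)
qed

text \<open>This encodes \<open>G(X) = (-1)\<^sup>s F(-X)\<close>.\<close>
definition sym_coeffs :: "nat \<Rightarrow> real fps \<Rightarrow> real fps \<Rightarrow> bool" where
  "sym_coeffs s F G \<longleftrightarrow> (\<forall>k. G $ k = (- 1) ^ (s + k) * F $ k)"

lemma sym_coeffs_mult:
  assumes "sym_coeffs s F G" "sym_coeffs t F' G'"
  shows "sym_coeffs (s + t) (F * F') (G * G')"
  unfolding sym_coeffs_def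
proof
  fix k
  have "(G * G') $ k = (\<Sum>i=0..k. ((- 1) ^ (s + i) * F $ i) * ((- 1) ^ (t + (k - i)) * F' $ (k - i)))"
    using assms by (simp add: fps_mult_nth sym_coeffs_def)
  also have "\<dots> = (\<Sum>i=0..k. (- 1) ^ (s + t + k) * (F $ i * F' $ (k - i)))"
  proof (intro sum.cong refl)
    fix i assume "i \<in> {0..k}"
    then have e: "s + t + k = (s + i) + (t + (k - i))" by simp
    show "((- 1) ^ (s + i) * F $ i) * ((- 1) ^ (t + (k - i)) * F' $ (k - i)) = (- 1) ^ (s + t + k) * (F $ i * F' $ (k - i))"
      unfolding e power_add by (simp only: mult_ac)
  qed
  finally show "(G * G') $ k = (- 1) ^ (s + t + k) * (F * F') $ k" by (simp add: fps_mult_nth sum_distrib_left)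
qed

lemma sym_coeffs_1: "sym_coeffs 0 1 1"
  by (simp add: sym_coeffs_def)

lemma sym_coeffs_power: "sym_coeffs s F G \<Longrightarrow> sym_coeffs (n * s) (F ^ n) (G ^ n)"
  by (induction n) (auto intro: sym_coeffs_mult sym_coeffs_1)

lemma sym_coeffs_prod:
  "(\<And>i. i \<in> A \<Longrightarrow> sym_coeffs (s i) (F i) (G i)) \<Longrightarrow> sym_coeffs (sum s A) (prod F A) (prod G A)"
  by (induction A rule: infinite_finite_induct) (auto intro: sym_coeffs_mult sym_coeffs_1)

lemma sym_coeffs_linear: "sym_coeffs 1 (fps_X + fps_const d) (fps_X + fps_const (- d))"
  unfolding sym_coeffs_def by (auto simp: not_less_eq)

lemma sym_coeffs_inverse_linear:
  "d \<noteq> 0 \<Longrightarrow> sym_coeffs 1 (inverse (fps_X + fps_const d)) (inverse (fps_X + fps_const (- d)))"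
  unfolding sym_coeffs_def by (auto simp: inverse_fps_linear power_minus[of d] simp del: fps_const_neg) 

lemma pole_order_uminus [simp]: "pole_order ns (- w) = pole_order ns w"
  by (simp add: pole_order_def)

text \<open>R is even: the numerator is an odd polynomial, and so is the denominator, a product of
  an odd number of odd blocks. In terms of degrees, \<open>s\<close> and the order of the pole
  \<open>v\<close> have the same parity.\<close>

lemma pole_series_uminus:
  assumes "h \<ge> 0" "\<forall>n\<in>set ns. 0 \<le> n \<and> n \<le> M" "odd (length ns)" "v \<in> {- M..M}" "k < pole_order ns v"
  shows "pole_series ns h M (- v) $ k = (- 1) ^ (pole_order ns v - k) * pole_series ns h M v $ k"
proof -
  have e: "pole_series ns h M (- v) = (fps_X + fps_const (- of_int v)) *
     (\<Prod>i\<in>{- h..<h}. fps_X + fps_const (- (of_int (2 * (v - i) - 1) / 2))) *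
     (\<Prod>w\<in>{- M..M} - {v}. inverse (fps_X + fps_const (- of_int (v - w))) ^ pole_order ns w)"
  proof -
    have "(\<Prod>i\<in>{- h..<h}. fps_X + fps_const (of_int (2 * (- v - i) - 1) / 2 :: real))
       = (\<Prod>i\<in>{- h..<h}. fps_X + fps_const (- (of_int (2 * (v - i) - 1) / 2)))"
      by (rule prod.reindex_bij_witness[of _ "\<lambda>i. - 1 - i" "\<lambda>i. - 1 - i"]) (auto simp: field_simps)
    moreover have "(\<Prod>w\<in>{- M..M} - {- v}. inverse (fps_X + fps_const (of_int (- v - w) :: real)) ^ pole_order ns w)
       = (\<Prod>w\<in>{- M..M} - {v}. inverse (fps_X + fps_const (- of_int (v - w))) ^ pole_order ns w)"
    proof -
      have c: "- real_of_int a - real_of_int v = - real_of_int v - real_of_int a" for a by simp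
      show ?thesis
        by (rule prod.reindex_bij_witness[of _ uminus uminus]) (auto simp: algebra_simps c)
    qed
    ultimately show ?thesis unfolding pole_series_def by simp
  qed
  define s where "s = 1 + (\<Sum>i\<in>{- h..<h}. 1) + (\<Sum>w\<in>{- M..M} - {v}. pole_order ns w * 1)"
  have "sym_coeffs s (pole_series ns h M v) (pole_series ns h M (- v))"
    unfolding s_def e unfolding pole_series_def
    by (intro sym_coeffs_mult sym_coeffs_prod sym_coeffs_power sym_coeffs_linear sym_coeffs_inverse_linear) auto
  then have "pole_series ns h M (- v) $ k = (- 1) ^ (s + k) * pole_series ns h M v $ k"
    unfolding sym_coeffs_def by blast
  moreover have "even (s + k) \<longleftrightarrow> even (pole_order ns v - k)"
  proof -
    have "(\<Sum>w\<in>{- M..M}. pole_order ns w) = pole_order ns v + (\<Sum>w\<in>{- M..M} - {v}. pole_order ns w)"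
      using assms(4) by (simp add: sum.remove)
    moreover have "odd (\<Sum>w\<in>{- M..M}. pole_order ns w)"
    proof -
      have "even (\<Sum>n\<leftarrow>ns. nat (2 * n + 1)) \<longleftrightarrow> even (length ns)" if "\<forall>n\<in>set ns. 0 \<le> n" for ns
        using that by (induction ns) (auto simp: even_nat_iff)
      then show ?thesis unfolding sum_pole_order[OF assms(2)] using assms(2,3) by simp
    qed
    moreover have "even (\<Sum>i\<in>{- h..<h}. 1 :: nat)" using assms(1) by (simp add: even_nat_iff)
    ultimately show ?thesis using assms(5) unfolding s_def by (auto simp: even_diff_nat)
  qed
  ultimately show ?thesis by (simp add: minus_one_power_iff)
qed

text \<open>The finite correction caused by shifting the alternating beta series by
  \<open>v\<close>: additional initial terms for positive \<open>v\<close>, missing ones for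
  negative \<open>v\<close>. The 2 clears the half in 1 / (t + 1/2 - v).\<close>

definition beta_tail :: "nat \<Rightarrow> int \<Rightarrow> real" where
  "beta_tail i v = (if v \<ge> 0 then \<Sum>t<nat v. (- 1) ^ (t + nat v) * (2 / of_int (2 * (int t - v) + 1)) ^ i
     else - (\<Sum>t<nat (- v). (- 1) ^ t * (2 / of_int (2 * int t + 1)) ^ i))"

lemma shifted_beta_sums:
  assumes "i \<ge> 1"
  shows "(\<lambda>t. (- 1) ^ t / (real t + 1 / 2 - of_int v) ^ i) sums ((- 1) ^ nat \<bar>v\<bar> * (2 ^ i * dirichlet_beta i + beta_tail i v))"
proof -
  have B: "(\<lambda>t. (- 1) ^ t * (2 / of_int (2 * int t + 1)) ^ i) sums (2 ^ i * dirichlet_beta i)"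
    using sums_mult[OF dirichlet_beta_sums[OF assms], of "2 ^ i"]
    by (simp add: power_divide mult_ac add.commute)
  show ?thesis
  proof (cases "v \<ge> 0")
    case True
    define n where "n = nat v"
    have v: "v = int n" using True by (simp add: n_def)
    let ?f = "\<lambda>t. (- 1) ^ (t + n) * (2 / of_int (2 * (int t - v) + 1)) ^ i :: real"
    have "?f (t + n) = (- 1) ^ t * (2 / of_int (2 * int t + 1)) ^ i" for t
      unfolding v by (simp add: power_add flip: power_mult_distrib)
    then have "(\<lambda>t. ?f (t + n)) sums (2 ^ i * dirichlet_beta i)" using B by simp
    then have "?f sums (2 ^ i * dirichlet_beta i + (\<Sum>t<n. ?f t))" by (rule sums_iff_shift[THEN iffD1])
    then have "(\<lambda>t. (- 1) ^ n * ?f t) sums ((- 1) ^ n * (2 ^ i * dirichlet_beta i + (\<Sum>t<n. ?f t)))"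
      by (rule sums_mult)
    moreover have "(- 1) ^ n * ?f t = (- 1) ^ t / (real t + 1 / 2 - of_int v) ^ i" for t
    proof -
      have "(2 / of_int (2 * (int t - v) + 1)) = 1 / (real t + 1 / 2 - of_int v)"
      proof -
        have e: "of_int (2 * (int t - v) + 1) = 2 * (real t + 1 / 2 - of_int v)" by (simp add: algebra_simps)
        have "2 / (2 * x) = 1 / x" for x :: real by simp
        then show ?thesis unfolding e .
      qed
      moreover have "(- 1) ^ n * (- 1) ^ (t + n) = (- 1 :: real) ^ t" by (simp add: power_add flip: power_mult_distrib)
      ultimately show ?thesis by (simp add: power_divide mult.assoc[symmetric])
    qed
    ultimately show ?thesis using True by (simp add: beta_tail_def n_def)
  next
    case False
    define n where "n = nat (- v)"
    have v: "v = - int n" using False by (simp add: n_def)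
    let ?f = "\<lambda>t. (- 1) ^ t * (2 / of_int (2 * int t + 1)) ^ i :: real"
    have "(\<lambda>t. ?f (t + n)) sums (2 ^ i * dirichlet_beta i - (\<Sum>t<n. ?f t))"
      by (rule sums_iff_shift'[where f = ?f, THEN iffD2]) (rule B)
    then have "(\<lambda>t. (- 1) ^ n * ?f (t + n)) sums ((- 1) ^ n * (2 ^ i * dirichlet_beta i - (\<Sum>t<n. ?f t)))"
      by (rule sums_mult)
    moreover have "(- 1) ^ n * ?f (t + n) = (- 1) ^ t / (real t + 1 / 2 - of_int v) ^ i" for t
    proof -
      have "(2 / of_int (2 * int (t + n) + 1)) = 1 / (real t + 1 / 2 - of_int v)"
      proof -
        have e: "of_int (2 * int (t + n) + 1) = 2 * (real t + 1 / 2 - of_int v)" by (simp add: v algebra_simps)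
        have "2 / (2 * x) = 1 / x" for x :: real by simp
        then show ?thesis unfolding e .
      qed
      moreover have "(- 1) ^ n * (- 1) ^ (t + n) = (- 1 :: real) ^ t" by (simp add: power_add flip: power_mult_distrib)
      ultimately show ?thesis by (simp only: power_divide mult.assoc[symmetric] power_one) simp
    qed
    ultimately show ?thesis using False by (simp add: beta_tail_def n_def)
  qed
qed

lemma beta_tail_vge:
  assumes "prime p" "2 * \<bar>v\<bar> \<le> int p ^ Suc L"
  shows "vge p (- (int L * int i)) (beta_tail i v)"
proof -
  have odd_vge: "vge p (- (int L * int i)) ((2 / of_int (2 * s + 1)) ^ i)" if "\<bar>2 * s + 1\<bar> < 2 * \<bar>v\<bar>" for s
  proof -
    have nz: "2 * s + 1 \<noteq> 0" by presburger
    have "multiplicity (int p) (2 * s + 1) \<le> L"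
      using assms that by (intro multiplicity_eq_sum(2) nz) auto
    then have "vge p (- int L) (1 / of_int (2 * s + 1))"
      by (intro vge_mono[OF assms(1) vge_inverse[OF assms(1) nz]]) simp
    from vge_mult[OF assms(1) vge_of_int[OF assms(1), of 2] this] have "vge p (- int L) (2 / of_int (2 * s + 1))" by simp
    from vge_power[OF assms(1) this, of i] show ?thesis by (simp add: mult.commute)
  qed
  have sgn: "vge p e ((- 1) ^ j * x)" if "vge p e x" for e j x
    using that by (cases "even j") auto
  show ?thesis
  proof (cases "v \<ge> 0")
    case True
    show ?thesis unfolding beta_tail_def if_P[OF True]
      by (intro vge_sum assms(1) sgn odd_vge) (use True in auto)
  next
    case False
    show ?thesis unfolding beta_tail_def if_not_P[OF False] vge_minus_iff
      by (intro vge_sum assms(1) sgn odd_vge) (use False in auto)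
  qed
qed

text \<open>The coefficients of odd order at \<open>v\<close> and \<open>- v\<close> are opposite,
  so the sum \<open>Od\<close> of the odd beta contributions equals its own negative. The tails
  depend on \<open>v\<close> and are kept for all orders.\<close>

proposition wp_ratio_linear_form:
  assumes "h \<ge> 0" "\<forall>n\<in>set ns. 0 \<le> n \<and> n \<le> M" "nat (2 * h) + 1 < (\<Sum>n\<leftarrow>ns. nat (2 * n + 1))" "odd (length ns)"
  shows "(\<lambda>t. (- 1) ^ t * wp_ratio ns h M (real t + 1 / 2)) sums
    (\<Sum>v\<in>{- M..M}. \<Sum>k<pole_order ns v. (- 1) ^ nat \<bar>v\<bar> * pole_series ns h M v $ k *
       ((if even (pole_order ns v - k) then 2 ^ (pole_order ns v - k) * dirichlet_beta (pole_order ns v - k) else 0)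
        + beta_tail (pole_order ns v - k) v))"
proof -
  let ?q = "pole_order ns" and ?S = "pole_series ns h M"
  let ?B = "\<lambda>i. 2 ^ i * dirichlet_beta i"
  have S1: "(\<lambda>t. \<Sum>v\<in>{- M..M}. \<Sum>k<?q v. ?S v $ k * ((- 1) ^ t / (real t + 1 / 2 - of_int v) ^ (?q v - k))) sums
      (\<Sum>v\<in>{- M..M}. \<Sum>k<?q v. ?S v $ k * ((- 1) ^ nat \<bar>v\<bar> * (?B (?q v - k) + beta_tail (?q v - k) v)))"
    by (intro sums_sum sums_mult shifted_beta_sums) auto
  have S2: "(\<Sum>v\<in>{- M..M}. \<Sum>k<?q v. ?S v $ k * ((- 1) ^ t / (real t + 1 / 2 - of_int v) ^ (?q v - k)))
      = (- 1) ^ t * wp_ratio ns h M (real t + 1 / 2)" for t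
  proof -
    have "real t + 1 / 2 \<notin> of_int ` {- M..M}"
    proof
      assume "real t + 1 / 2 \<in> of_int ` {- M..M}"
      then obtain w where "real t + 1 / 2 = of_int w" by auto
      then have "real_of_int (2 * int t + 1) = of_int (2 * w)" by simp
      then have "2 * int t + 1 = 2 * w" by linarith
      then show False by presburger
    qed
    then show ?thesis
      using assms by (subst wp_ratio_partial_fractions) (auto simp: sum_distrib_left mult_ac)
  qed
  have S3: "(\<Sum>v\<in>{- M..M}. \<Sum>k<?q v. ?S v $ k * ((- 1) ^ nat \<bar>v\<bar> * (?B (?q v - k) + beta_tail (?q v - k) v)))
     = (\<Sum>v\<in>{- M..M}. \<Sum>k<?q v. (- 1) ^ nat \<bar>v\<bar> * ?S v $ k * ((if even (?q v - k) then ?B (?q v - k) else 0) + beta_tail (?q v - k) v))"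
  proof -
    define Od where "Od = (\<Sum>v\<in>{- M..M}. \<Sum>k<?q v. (- 1) ^ nat \<bar>v\<bar> * ?S v $ k * (if odd (?q v - k) then ?B (?q v - k) else 0))"
    have "Od = (\<Sum>v\<in>{- M..M}. \<Sum>k<?q (- v). (- 1) ^ nat \<bar>- v\<bar> * ?S (- v) $ k * (if odd (?q (- v) - k) then ?B (?q (- v) - k) else 0))"
      unfolding Od_def by (rule sum.reindex_bij_witness[of _ uminus uminus]) (auto cong: if_cong)
    also have "\<dots> = (\<Sum>v\<in>{- M..M}. \<Sum>k<?q v. - ((- 1) ^ nat \<bar>v\<bar> * ?S v $ k * (if odd (?q v - k) then ?B (?q v - k) else 0)))"
      unfolding pole_order_uminus abs_minus_cancel
      using assms by (intro sum.cong refl) (auto simp: pole_series_uminus)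
    also have "\<dots> = - Od" by (simp add: Od_def sum_negf)
    finally have "Od = 0" by simp
    moreover have "(\<Sum>v\<in>{- M..M}. \<Sum>k<?q v. ?S v $ k * ((- 1) ^ nat \<bar>v\<bar> * (?B (?q v - k) + beta_tail (?q v - k) v)))
     = (\<Sum>v\<in>{- M..M}. \<Sum>k<?q v. (- 1) ^ nat \<bar>v\<bar> * ?S v $ k * ((if even (?q v - k) then ?B (?q v - k) else 0) + beta_tail (?q v - k) v)) + Od"
      unfolding Od_def sum.distrib[symmetric] by (intro sum.cong refl) (auto simp: algebra_simps)
    ultimately show ?thesis by simp
  qed
  show ?thesis using S1 unfolding S2 S3 .
qed

text \<open>With i the order of the partial fraction, the valuation \<open>L * i - C\<close> of its
  coefficient meets \<open>- L * i\<close> from the tail and \<open>C\<close> from \<open>N\<close>.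
  While \<open>C\<close> must serve all poles, \<open>L\<close> may depend on
  \<open>v\<close>.\<close>

lemma linear_form_integral:
  fixes N :: real and Q :: int
  assumes beta: "\<And>i. even i \<Longrightarrow> 2 \<le> i \<Longrightarrow> i \<le> length ns \<Longrightarrow> of_int Q * dirichlet_beta i \<in> \<int>"
    and adm: "\<And>p. prime p \<Longrightarrow> \<exists>C. vge p C N \<and> (\<forall>v\<in>{- M..M}. \<exists>L. 2 * \<bar>v\<bar> \<le> int p ^ Suc L \<and>
       (\<forall>k<pole_order ns v. vge p (int L * (int (pole_order ns v) - int k) - C) (pole_series ns h M v $ k)))"
  shows "of_int Q * N * (\<Sum>v\<in>{- M..M}. \<Sum>k<pole_order ns v. (- 1) ^ nat \<bar>v\<bar> * pole_series ns h M v $ k *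
       ((if even (pole_order ns v - k) then 2 ^ (pole_order ns v - k) * dirichlet_beta (pole_order ns v - k) else 0)
        + beta_tail (pole_order ns v - k) v)) \<in> \<int>" (is "_ * _ * ?T \<in> _")
proof (rule Ints_if_vge)
  fix p :: nat assume p: "prime p"
  let ?q = "pole_order ns" and ?S = "pole_series ns h M"
  from adm[OF p] obtain C where C: "vge p C N" and adm': "\<forall>v\<in>{- M..M}. \<exists>L. 2 * \<bar>v\<bar> \<le> int p ^ Suc L \<and>
       (\<forall>k<?q v. vge p (int L * (int (?q v) - int k) - C) (?S v $ k))" by blast
  have "vge p 0 (\<Sum>v\<in>{- M..M}. \<Sum>k<?q v. of_int Q * N * ((- 1) ^ nat \<bar>v\<bar> * ?S v $ k *
       ((if even (?q v - k) then 2 ^ (?q v - k) * dirichlet_beta (?q v - k) else 0) + beta_tail (?q v - k) v)))"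
  proof (intro vge_sum p)
    fix v k assume v: "v \<in> {- M..M}" and "k \<in> {..<?q v}"
    then have k: "k < ?q v" by simp
    define i where "i = ?q v - k"
    from adm' v k obtain L where L: "2 * \<bar>v\<bar> \<le> int p ^ Suc L" and S: "vge p (int L * (int (?q v) - int k) - C) (?S v $ k)" by blast
    have S': "vge p (int L * int i - C) (?S v $ k)" using S k by (simp add: i_def of_nat_diff)
    have sgn: "vge p e ((- 1) ^ j * x)" if "vge p e x" for e j x
      using that by (cases "even j") auto
    have NS: "vge p (int L * int i) (N * ((- 1) ^ nat \<bar>v\<bar> * ?S v $ k))"
      using vge_mult[OF p C sgn[OF S']] by simp
    have "vge p 0 (of_int Q * (if even i then 2 ^ i * dirichlet_beta i else 0))"
    proof (cases "even i")
      case True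
      have "i \<le> length ns" using i_def by (simp add: pole_order_def le_diff_conv le_trans[OF length_filter_le] trans_le_add1)
      moreover have "i \<ge> 2" using True k unfolding i_def by presburger
      ultimately obtain z where z: "of_int Q * dirichlet_beta i = of_int z" using beta[OF True] by (auto elim: Ints_cases)
      have "of_int Q * (2 ^ i * dirichlet_beta i) = 2 ^ i * (of_int Q * dirichlet_beta i)" by simp
      also have "\<dots> = of_int (2 ^ i * z)" unfolding z by simp
      finally have e: "of_int Q * (2 ^ i * dirichlet_beta i) = of_int (2 ^ i * z)" .
      have "vge p 0 (of_int Q * (2 ^ i * dirichlet_beta i))" unfolding e by (rule vge_of_int[OF p])
      then show ?thesis using True by simp
    qed (simp add: p)
    then have "vge p (- (int L * int i)) (of_int Q * (if even i then 2 ^ i * dirichlet_beta i else 0))"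
      by (rule vge_mono[OF p]) simp
    moreover have "vge p (- (int L * int i)) (of_int Q * beta_tail i v)"
      using vge_mult[OF p vge_of_int[OF p] beta_tail_vge[OF p L]] by simp
    ultimately have "vge p (- (int L * int i)) (of_int Q * ((if even i then 2 ^ i * dirichlet_beta i else 0) + beta_tail i v))"
      unfolding distrib_left by (rule vge_add[OF p])
    from vge_mult[OF p NS this]
    show "vge p 0 (of_int Q * N * ((- 1) ^ nat \<bar>v\<bar> * ?S v $ k *
       ((if even (?q v - k) then 2 ^ (?q v - k) * dirichlet_beta (?q v - k) else 0) + beta_tail (?q v - k) v)))"
      unfolding i_def[symmetric] by (simp add: mult_ac)
  qed
  then show "vge p 0 (of_int Q * N * ?T)" by (simp only: sum_distrib_left)
qed

text \<open>The numbers \<open>a\<close> with n + a = u - w at u = n + h + 1/2, listed with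
  multiplicity so that each entry is one simple division step.\<close>

definition shifted_poles :: "int list \<Rightarrow> nat \<Rightarrow> real list" where
  "shifted_poles ns h = concat (map (\<lambda>n. map (\<lambda>w. real h + 1 / 2 - of_int w) [- n..n]) ns)"

lemma prod_pole_order:
  assumes "\<forall>n\<in>set ns. 0 \<le> n \<and> n \<le> M"
  shows "(\<Prod>w\<in>{- M..M}. f w ^ pole_order ns w) = (\<Prod>n\<leftarrow>ns. \<Prod>w\<leftarrow>[- n..n]. f w :: real)"
  using assms
proof (induction ns)
  case (Cons n ns)
  then have n: "0 \<le> n" "n \<le> M" by auto
  have "(\<Prod>w\<in>{- M..M}. f w ^ pole_order (n # ns) w) = (\<Prod>w\<in>{- M..M}. if w \<in> {- n..n} then f w else 1) * (\<Prod>w\<in>{- M..M}. f w ^ pole_order ns w)"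
    unfolding prod.distrib[symmetric] by (intro prod.cong) (auto simp: pole_order_def)
  also have "(\<Prod>w\<in>{- M..M}. if w \<in> {- n..n} then f w else 1) = (\<Prod>w\<in>{- n..n}. f w)"
    using n by (intro prod.mono_neutral_cong_right) auto
  also have "\<dots> = (\<Prod>w\<leftarrow>[- n..n]. f w)"
    by (subst prod.distinct_set_conv_list[symmetric]) auto
  finally show ?case using Cons by simp
qed (simp add: pole_order_def)

lemma wp_ratio_eq_wp_term:
  assumes "\<forall>n\<in>set ns. 0 \<le> n \<and> n \<le> M"
  shows "(- 1) ^ n * wp_ratio ns (int h) M (real (n + h) + 1 / 2) = wp_term h (shifted_poles ns h) n"
proof -
  have "(\<Prod>i\<in>{- int h..<int h}. real (n + h) - of_int i) = (\<Prod>i=1..2 * h. real n + real i)"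
    by (rule prod.reindex_bij_witness[of _ "\<lambda>j. int h - int j" "\<lambda>i. nat (int h - i)"]) auto
  then have "poly (wp_num (int h)) (real (n + h) + 1 / 2) = (real n + real h + 1 / 2) * (\<Prod>i=1..2 * h. real n + real i)"
    unfolding wp_num_def by (simp add: poly_prod)
  moreover have "(\<Prod>w\<in>{- M..M}. (real (n + h) + 1 / 2 - of_int w) ^ pole_order ns w) = (\<Prod>a\<leftarrow>shifted_poles ns h. real n + a)"
    unfolding prod_pole_order[OF assms] shifted_poles_def
    by (induction ns) (simp_all add: o_def algebra_simps)
  ultimately show ?thesis unfolding wp_ratio_def wp_term_def wp_coeff_def by simp
qed

lemma wp_ratio_zero:
  assumes "t < h"
  shows "wp_ratio ns (int h) M (real t + 1 / 2) = 0"
proof -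
  have "poly (wp_num (int h)) (real t + 1 / 2) = 0"
    unfolding wp_num_def poly_mult poly_prod using assms
    by (intro mult_eq_0_iff[THEN iffD2] disjI2 prod_zero) (auto intro!: bexI[of _ "int t"])
  then show ?thesis by (simp add: wp_ratio_def)
qed

text \<open>The zeros of the numerator remove the terms with t < h, so shifting the index by
  \<open>h\<close> only changes the sign.\<close>

lemma suminf_wp_ratio:
  assumes "\<forall>n\<in>set ns. 0 \<le> n \<and> n \<le> M" "(\<lambda>t. (- 1) ^ t * wp_ratio ns (int h) M (real t + 1 / 2)) sums T"
  shows "wp_term h (shifted_poles ns h) sums ((- 1) ^ h * T)"
proof -
  let ?f = "\<lambda>t. (- 1) ^ t * wp_ratio ns (int h) M (real t + 1 / 2)"
  have "(\<Sum>t<h. ?f t) = 0" by (simp add: wp_ratio_zero)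
  then have "(\<lambda>n. ?f (n + h)) sums T" using assms(2) sums_iff_shift[of ?f h T] by simp
  then have "(\<lambda>n. (- 1) ^ h * ?f (n + h)) sums ((- 1) ^ h * T)" by (rule sums_mult)
  moreover have "(- 1) ^ h * ?f (n + h) = wp_term h (shifted_poles ns h) n" for n
  proof -
    have "(- 1) ^ h * (- 1) ^ (n + h) = (- 1 :: real) ^ n" by (simp add: power_add flip: power_mult_distrib)
    then show ?thesis
      unfolding wp_ratio_eq_wp_term[OF assms(1), symmetric] by (simp add: mult.assoc[symmetric])
  qed
  ultimately show ?thesis by simp
qed

lemma summable_abs_wp_term:
  assumes "\<forall>a\<in>set as. 1 \<le> a" "2 * h + 3 \<le> length as"
  shows "summable (\<lambda>n. \<bar>wp_term h as n\<bar>)"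
proof (rule summable_comparison_test)
  let ?C = "real (2 * h + 1) ^ (2 * h + 1)"
  show "summable (\<lambda>n. ?C * inverse (real (Suc n) ^ 2))"
  proof (rule summable_mult)
    have "summable (\<lambda>n. inverse (real n ^ 2))" using inverse_power_summable[of 2, where ?'a = real] by simp
    then show "summable (\<lambda>n. inverse (real (Suc n) ^ 2))" by (subst summable_Suc_iff)
  qed
  show "\<exists>N. \<forall>n\<ge>N. norm \<bar>wp_term h as n\<bar> \<le> ?C * inverse (real (Suc n) ^ 2)"
  proof (intro exI allI impI)
    fix n :: nat
    have "real (Suc n) ^ length as \<le> (\<Prod>a\<leftarrow>as. real n + a)"
      using assms(1) by (induction as) (auto intro!: mult_mono)
    moreover have "real (Suc n) ^ (2 * h + 3) \<le> real (Suc n) ^ length as"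
      using assms(2) by (intro power_increasing) auto
    ultimately have den: "real (Suc n) ^ (2 * h + 3) \<le> (\<Prod>a\<leftarrow>as. real n + a)" by linarith
    have b: "real n + real i \<le> real (2 * h + 1) * real (Suc n)" if "i \<le> 2 * h" for i
    proof -
      have "real n + real i \<le> real n + real (2 * h)" using that by simp
      also have "\<dots> \<le> real (2 * h + 1) * real (Suc n)" by (simp add: algebra_simps)
      finally show ?thesis .
    qed
    have "\<bar>wp_coeff h n\<bar> = (\<Prod>i=1..2 * h. real n + real i) * (real n + real h + 1 / 2)"
      unfolding wp_coeff_def by (simp add: abs_mult abs_prod)
    also have "\<dots> \<le> (\<Prod>i=1..2 * h. real (2 * h + 1) * real (Suc n)) * (real (2 * h + 1) * real (Suc n))"
    proof (intro mult_mono prod_mono conjI)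
      show "real n + real h + 1 / 2 \<le> real (2 * h + 1) * real (Suc n)" by (simp add: algebra_simps)
    qed (use b in \<open>auto intro!: prod_nonneg\<close>)
    also have "\<dots> = ?C * real (Suc n) ^ (2 * h + 1)" by (simp add: power_mult_distrib)
    finally have num: "\<bar>wp_coeff h n\<bar> \<le> ?C * real (Suc n) ^ (2 * h + 1)" .
    have "\<bar>wp_term h as n\<bar> = \<bar>wp_coeff h n\<bar> / (\<Prod>a\<leftarrow>as. real n + a)"
      unfolding wp_term_def using den by (simp add: abs_divide) (metis abs_of_pos less_le_trans of_nat_0_less_iff zero_less_Suc zero_less_power of_nat_Suc)
    also have "\<dots> \<le> ?C * real (Suc n) ^ (2 * h + 1) / real (Suc n) ^ (2 * h + 3)"
      using num den by (intro frac_le) auto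
    also have "\<dots> = ?C * inverse (real (Suc n) ^ 2)"
      by (simp add: power_add power2_eq_square field_simps numeral_3_eq_3 del: of_nat_Suc)
    finally show "norm \<bar>wp_term h as n\<bar> \<le> ?C * inverse (real (Suc n) ^ 2)" by simp
  qed
qed

section \<open>Averages of Chebyshev's function\<close>

definition theta :: "real \<Rightarrow> real" where
  "theta x = (\<Sum>p | prime p \<and> real p \<le> x. ln (real p))"

lemma finite_primes_le [simp]: "finite {p :: nat. prime p \<and> real p \<le> x}"
  by (rule finite_subset[of _ "{..nat \<lfloor>x\<rfloor>}"]) (auto simp: le_nat_floor)

lemma primes_less_2: "x < 2 \<Longrightarrow> {p :: nat. prime p \<and> real p \<le> x} = {}"
  by (auto dest: prime_ge_2_nat)

lemma ln_prime_nonneg: "prime p \<Longrightarrow> 0 \<le> ln (real p)"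
  using prime_ge_1_nat[of p] by simp

lemma theta_mono: "x \<le> y \<Longrightarrow> theta x \<le> theta y"
  unfolding theta_def by (intro sum_mono2) (auto simp: ln_prime_nonneg)

lemma prod_primes_dvd:
  fixes N :: nat
  assumes "finite A" "\<And>p. p \<in> A \<Longrightarrow> prime p \<and> p dvd N"
  shows "\<Prod>A dvd N"
  using assms
proof (induction A rule: finite_induct)
  case (insert p A)
  have "coprime p (\<Prod>A)"
    using insert by (intro prod_coprime_right primes_coprime) auto
  then show ?case using insert by (auto intro: divides_mult)
qed simp

text \<open>The primes above n and up to 2 n divide the central binomial coefficient, which is at
  most 4^n.\<close>

lemma theta_double_le: "theta (real (2 * n)) \<le> theta (real n) + 2 * real n * ln 2"
proof -
  let ?A = "{p. prime p \<and> n < p \<and> p \<le> 2 * n}"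
  have fin: "finite ?A" by (rule finite_subset[of _ "{..2 * n}"]) auto
  have "\<Prod>?A dvd (2 * n) choose n"
  proof (rule prod_primes_dvd[OF fin])
    fix p assume p: "p \<in> ?A"
    have "fact n * fact n * ((2 * n) choose n) = (fact (2 * n) :: nat)"
      using binomial_fact_lemma[of n "2 * n"] by (simp add: mult_2)
    moreover have "p dvd fact (2 * n)" using p by (simp add: prime_dvd_fact_iff)
    ultimately have "p dvd fact n * fact n * ((2 * n) choose n)" by simp
    then show "prime p \<and> p dvd (2 * n) choose n" using p by (auto simp: prime_dvd_mult_iff prime_dvd_fact_iff)
  qed
  then have "\<Prod>?A \<le> (2 * n) choose n" by (rule dvd_imp_le) (simp add: zero_less_binomial_iff)
  also have "\<dots> \<le> 2 ^ (2 * n)" by (rule binomial_le_pow2)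
  finally have "real (\<Prod>?A) \<le> real (2 ^ (2 * n))" by (rule of_nat_mono)
  moreover have "0 < real (\<Prod>?A)" by (auto simp: prime_gt_0_nat intro!: prod_pos)
  ultimately have "ln (real (\<Prod>?A)) \<le> ln (real (2 ^ (2 * n)))" by simp
  also have "ln (real (\<Prod>?A)) = (\<Sum>p\<in>?A. ln (real p))"
    by (subst of_nat_prod, subst ln_prod) (auto simp: fin prime_gt_0_nat)
  also have "ln (real (2 ^ (2 * n))) = 2 * real n * ln 2" by (simp add: ln_realpow)
  finally have *: "(\<Sum>p\<in>?A. ln (real p)) \<le> 2 * real n * ln 2" .
  have "{p. prime p \<and> real p \<le> real (2 * n)} = {p. prime p \<and> real p \<le> real n} \<union> ?A" by auto
  then have "theta (real (2 * n)) = theta (real n) + (\<Sum>p\<in>?A. ln (real p))"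
    unfolding theta_def by (simp, subst sum.union_disjoint) (auto simp: fin finite_primes_le[of "real n", simplified])
  with * show ?thesis by simp
qed

lemma theta_le:
  assumes "x \<ge> 0" shows "theta x \<le> 4 * x"
proof (cases "x < 1")
  case True
  then have "x < 2" by simp
  then show ?thesis unfolding theta_def primes_less_2[OF \<open>x < 2\<close>] using assms by simp
next
  case False
  have pow: "theta (real (2 ^ k)) \<le> 2 * 2 ^ k * ln 2" for k
  proof (induction k)
    case 0
    have "theta 1 = 0" unfolding theta_def by (subst primes_less_2) simp_all
    then show ?case by simp
  next
    case (Suc k)
    show ?case using theta_double_le[of "2 ^ k"] Suc by (simp add: algebra_simps)
  qed
  define k where "k = nat \<lfloor>log 2 x\<rfloor>"
  have lx: "log 2 x \<ge> 0" using False by simp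
  have "real k \<le> log 2 x" "log 2 x < real k + 1" using lx unfolding k_def by linarith+
  then have "2 powr real k \<le> x" "x < 2 powr (real k + 1)"
    using False by (simp_all add: le_log_iff log_less_iff)
  then have k: "2 ^ k \<le> x" "x \<le> 2 ^ Suc k" by (simp_all add: powr_add powr_realpow)
  have "theta x \<le> theta (real (2 ^ Suc k))" using k by (intro theta_mono) simp
  also have "\<dots> \<le> 2 * 2 ^ Suc k * ln 2" using pow[of "Suc k"] by simp
  also have "\<dots> = 4 * 2 ^ k * ln 2" by simp
  also have "\<dots> \<le> 4 * x * ln 2" using k by (intro mult_right_mono) auto
  also have "\<dots> \<le> 4 * x * 1" using assms ln_2_less_1 by (intro mult_left_mono) auto
  finally show ?thesis by simp
qed

section \<open>Mertens' theorem\<close>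

definition lnp_sum :: "real \<Rightarrow> real" where
  "lnp_sum x = (\<Sum>p | prime p \<and> real p \<le> x. ln (real p) / real p)"

lemma sum_ln_over_square_bounded:
  obtains C where "C \<ge> 0" "\<And>x. (\<Sum>p | prime p \<and> real p \<le> x. ln (real p) / (real p) ^ 2) \<le> C"
proof -
  let ?f = "\<lambda>n. 2 * real n powr (- 3 / 2)"
  have s: "summable ?f" by (intro summable_mult) (simp add: summable_real_powr_iff)
  have "(\<Sum>p | prime p \<and> real p \<le> x. ln (real p) / (real p) ^ 2) \<le> suminf ?f" for x
  proof -
    have "ln (real p) / (real p) ^ 2 \<le> ?f p" if "prime p" for p
    proof -
      have p: "real p > 0" using that by (simp add: prime_gt_0_nat)
      have "ln (real p) = 2 * ln (sqrt (real p))" using p by (simp add: ln_sqrt)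
      also have "\<dots> \<le> 2 * sqrt (real p)" using p ln_le_minus_one[of "sqrt (real p)"] by simp
      finally have "ln (real p) / (real p) ^ 2 \<le> 2 * sqrt (real p) / real p ^ 2" by (intro divide_right_mono) auto
      also have "2 * sqrt (real p) / real p ^ 2 = 2 * (real p powr (1 / 2) / real p powr 2)"
        using p by (simp add: powr_half_sqrt powr_numeral)
      also have "real p powr (1 / 2) / real p powr 2 = real p powr (1 / 2 - 2)" by (rule powr_diff[symmetric])
      finally show ?thesis by simp
    qed
    then have "(\<Sum>p | prime p \<and> real p \<le> x. ln (real p) / (real p) ^ 2) \<le> (\<Sum>p | prime p \<and> real p \<le> x. ?f p)"
      by (intro sum_mono) auto
    also have "\<dots> \<le> suminf ?f" by (intro sum_le_suminf s) auto
    finally show ?thesis .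
  qed
  moreover have "suminf ?f \<ge> 0" by (intro suminf_nonneg s) auto
  ultimately show ?thesis using that by blast
qed

text \<open>Both bounds follow from Legendre's recursion \<open>rec\<close>. Iterated, it gives at
  most n / (p - 1), which exceeds n / p by no more than 2 n / p^2.\<close>

lemma multiplicity_fact_bounds:
  assumes "prime p" "n > 0"
  shows "real n / real p - 1 \<le> real (multiplicity p (fact n))"
    "real (multiplicity p (fact n)) \<le> real n / real p + 2 * real n / real p ^ 2"
proof -
  have p: "real p \<ge> 2" using assms by (simp add: prime_ge_2_nat)
  have pe: "prime_elem p" using assms by simp
  have mf: "multiplicity p (fact (Suc n) :: nat) = multiplicity p (Suc n) + multiplicity p (fact n :: nat)" for n
    unfolding fact_Suc of_nat_id by (rule prime_elem_multiplicity_mult_distrib[OF pe]) auto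
  have rec: "multiplicity p (fact n :: nat) = n div p + multiplicity p (fact (n div p))" for n
  proof (induction n)
    case (Suc n)
    have "multiplicity p (fact (Suc n) :: nat) = multiplicity p (Suc n) + multiplicity p (fact n :: nat)"
      by (rule mf)
    also have "\<dots> = Suc n div p + multiplicity p (fact (Suc n div p))"
    proof (cases "p dvd Suc n")
      case True
      then obtain k where k: "Suc n = p * k" by (elim dvdE)
      have k0: "k > 0" using k by (cases k) auto
      have "n div p = k - 1" using k p assms(1)
        by (intro div_nat_eqI) (auto simp: algebra_simps diff_mult_distrib2 prime_gt_0_nat)
      moreover have "multiplicity p (Suc n) = Suc (multiplicity p k)"
        unfolding k using k0 assms(1) by (intro multiplicity_times_same) (auto simp: not_prime_1 not_prime_0)
      moreover have "multiplicity p (fact k :: nat) = multiplicity p k + multiplicity p (fact (k - 1) :: nat)"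
        using k0 mf[of "k - 1"] by simp
      moreover have "Suc n div p = k" using k p by simp
      ultimately show ?thesis using Suc k0 by simp
    next
      case False
      then have "Suc n div p = n div p" by (simp add: div_Suc dvd_eq_mod_eq_0)
      moreover have "multiplicity p (Suc n) = 0" using False by (simp add: not_dvd_imp_multiplicity_0)
      ultimately show ?thesis using Suc by simp
    qed
    finally show ?case .
  qed simp
  have div_le: "real (n div p) \<le> real n / real p" for n
  proof -
    have "real (n div p * p) \<le> real n" by (intro of_nat_mono) simp
    then show ?thesis using p by (simp add: le_divide_eq)
  qed
  have le: "real (multiplicity p (fact n :: nat)) \<le> real n / (real p - 1)" for n
  proof (induction n rule: less_induct)
    case (less n)
    show ?case
    proof (cases "n = 0")
      case False
      have "n div p < n" using False prime_gt_1_nat[OF assms(1)] by simp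
      then have "real (multiplicity p (fact (n div p) :: nat)) \<le> real (n div p) / (real p - 1)" by (rule less)
      then have "real (multiplicity p (fact n :: nat)) \<le> real (n div p) + real (n div p) / (real p - 1)" by (subst rec) simp
      also have "\<dots> = real (n div p) * (real p / (real p - 1))" using p by (simp add: field_simps)
      also have "\<dots> \<le> (real n / real p) * (real p / (real p - 1))"
        using p div_le by (intro mult_right_mono) auto
      also have "\<dots> = real n / (real p - 1)" using p by simp
      finally show ?thesis .
    qed simp
  qed
  have fl: "real n / real p - 1 \<le> real (n div p)"
  proof -
    have "n < p + n div p * p" using assms(1) by (intro dividend_less_div_times) (simp add: prime_gt_0_nat)
    then have "real n < real (p + n div p * p)" by (rule of_nat_less_iff[THEN iffD2])
    then show ?thesis using p by (simp add: field_simps)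
  qed
  then show "real n / real p - 1 \<le> real (multiplicity p (fact n))" by (subst rec) simp
  have "real (multiplicity p (fact n)) \<le> real n / (real p - 1)" by (rule le)
  also have "\<dots> \<le> real n / real p + 2 * real n / real p ^ 2"
  proof -
    have "1 / (real p - 1) = 1 / real p + 1 / (real p * (real p - 1))" using p by (simp add: field_simps)
    moreover have "1 / (real p * (real p - 1)) \<le> 1 / (real p * (real p / 2))"
      using p by (intro divide_left_mono mult_left_mono) auto
    ultimately have "1 / (real p - 1) \<le> 1 / real p + 2 / real p ^ 2" by (simp add: power2_eq_square)
    then have "real n * (1 / (real p - 1)) \<le> real n * (1 / real p + 2 / real p ^ 2)" by (intro mult_left_mono) auto
    then show ?thesis by (simp add: algebra_simps)
  qed
  finally show "real (multiplicity p (fact n)) \<le> real n / real p + 2 * real n / real p ^ 2" .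
qed

lemma ln_fact_eq_sum:
  assumes "n > 0"
  shows "ln (fact n :: real) = (\<Sum>p | prime p \<and> real p \<le> real n. real (multiplicity p (fact n :: nat)) * ln (real p))"
proof -
  have pf: "prime_factors (fact n :: nat) = {p. prime p \<and> real p \<le> real n}"
    by (auto simp: prime_factors_dvd prime_dvd_fact_iff)
  have "(fact n :: nat) = (\<Prod>p\<in>prime_factors (fact n). p ^ multiplicity p (fact n))"
    by (rule prime_factorization_nat) simp
  then have "ln (real (fact n)) = ln (real (\<Prod>p\<in>prime_factors (fact n :: nat). p ^ multiplicity p (fact n)))" by simp
  also have "\<dots> = (\<Sum>p\<in>prime_factors (fact n :: nat). ln (real p ^ multiplicity p (fact n :: nat)))"
    by (subst of_nat_prod, subst ln_prod) (auto simp: prime_gt_0_nat in_prime_factors_iff)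
  also have "\<dots> = (\<Sum>p | prime p \<and> real p \<le> real n. real (multiplicity p (fact n :: nat)) * ln (real p))"
    unfolding pf by (intro sum.cong refl) (auto simp: ln_realpow prime_gt_0_nat)
  finally show ?thesis by simp
qed

lemma fact_ge_power_exp: "(real n / exp 1) ^ n \<le> fact n"
proof (induction n)
  case (Suc n)
  show ?case
  proof (cases "n = 0")
    case True
    then show ?thesis by simp
  next
    case False
    have "(1 + 1 / real n) ^ n \<le> exp 1"
    proof -
      have "(1 + 1 / real n) ^ n \<le> exp (1 / real n) ^ n" by (intro power_mono exp_ge_add_one_self) auto
      also have "\<dots> = exp 1" using False by (simp flip: exp_of_nat_mult)
      finally show ?thesis .
    qed
    moreover have "(1 + 1 / real n) ^ n = real (Suc n) ^ n / real n ^ n"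
      using False by (simp add: field_simps flip: power_divide)
    ultimately have "real (Suc n) ^ n \<le> exp 1 * real n ^ n" using False by (simp add: divide_le_eq)
    then have "real (Suc n) ^ n / exp 1 ^ n \<le> exp 1 * real n ^ n / exp 1 ^ n" by (rule divide_right_mono) simp
    then have "(real (Suc n) / exp 1) ^ n \<le> exp 1 * (real n / exp 1) ^ n" by (simp only: power_divide times_divide_eq_right)
    also have "\<dots> \<le> exp 1 * fact n" using Suc by (intro mult_left_mono) auto
    finally have "real (Suc n) / exp 1 * (real (Suc n) / exp 1) ^ n \<le> real (Suc n) / exp 1 * (exp 1 * fact n)"
      by (intro mult_left_mono) auto
    then show ?thesis by simp
  qed
qed simp

text \<open>Compares the prime factorization of \<open>fact n\<close> with the bounds n ln n - n and
  n ln n for ln n!. The error -1 per prime is absorbed by Chebyshev's bound on \<open>theta\<close>,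
  the error 2 n / p^2 by the convergent sum of ln p / p^2.\<close>

lemma mertens:
  obtains C where "C \<ge> 0" "\<And>n. n > 0 \<Longrightarrow> \<bar>lnp_sum (real n) - ln (real n)\<bar> \<le> C"
proof -
  obtain C where C: "C \<ge> 0" "\<And>x. (\<Sum>p | prime p \<and> real p \<le> x. ln (real p) / (real p) ^ 2) \<le> C"
    using sum_ln_over_square_bounded by blast
  have "\<bar>lnp_sum (real n) - ln (real n)\<bar> \<le> 4 + 1 + 2 * C" if n: "n > 0" for n
  proof -
    let ?A = "{p. prime p \<and> real p \<le> real n}"
    have "real n * lnp_sum (real n) - theta (real n) = (\<Sum>p\<in>?A. (real n / real p - 1) * ln (real p))"
      unfolding lnp_sum_def theta_def by (simp add: sum_distrib_left sum_subtractf left_diff_distrib)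
    also have "\<dots> \<le> ln (fact n)"
      unfolding ln_fact_eq_sum[OF n]
      by (intro sum_mono mult_right_mono multiplicity_fact_bounds n) (auto simp: ln_prime_nonneg)
    also have "fact n \<le> real n ^ n" using fact_le_power[of n, where 'a = real] by simp
    then have "ln (fact n) \<le> real n * ln (real n)" using n by (simp flip: ln_realpow)
    finally have 1: "real n * lnp_sum (real n) \<le> real n * ln (real n) + 4 * real n"
      using theta_le[of "real n"] by simp
    have "ln ((real n / exp 1) ^ n) \<le> ln (fact n)" using n fact_ge_power_exp[of n] by simp
    then have "real n * ln (real n) - real n \<le> ln (fact n)" using n by (simp add: ln_realpow ln_div algebra_simps)
    also have "\<dots> \<le> (\<Sum>p\<in>?A. (real n / real p + 2 * real n / real p ^ 2) * ln (real p))"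
      unfolding ln_fact_eq_sum[OF n]
      by (intro sum_mono mult_right_mono multiplicity_fact_bounds n) (auto simp: ln_prime_nonneg)
    also have "\<dots> = real n * lnp_sum (real n) + 2 * real n * (\<Sum>p\<in>?A. ln (real p) / real p ^ 2)"
      unfolding lnp_sum_def by (simp add: sum_distrib_left sum.distrib distrib_right)
    also have "\<dots> \<le> real n * lnp_sum (real n) + 2 * real n * C"
      using C(2)[of "real n"] by (intro add_left_mono mult_left_mono) auto
    finally have 2: "real n * ln (real n) \<le> real n * lnp_sum (real n) + real n * (1 + 2 * C)"
      by (simp add: algebra_simps)
    have "real n * lnp_sum (real n) \<le> real n * (ln (real n) + 4)" using 1 by (simp add: algebra_simps)
    moreover have "real n * ln (real n) \<le> real n * (lnp_sum (real n) + (1 + 2 * C))" using 2 by (simp add: algebra_simps)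
    ultimately show ?thesis using n C(1) by (simp add: abs_le_iff)
  qed
  then show ?thesis using that[of "4 + 1 + 2 * C"] C(1) by simp
qed

section \<open>Logarithmic averages of \<open>theta\<close>\<close>

lemma inverse_square_bounds:
  assumes "(x::real) > 0"
  shows "1 / x - 1 / (x + 1) \<le> 1 / x ^ 2" "1 / (x + 1) ^ 2 \<le> 1 / x - 1 / (x + 1)"
proof -
  have e: "1 / x - 1 / (x + 1) = 1 / (x * (x + 1))" using assms by (simp add: field_simps)
  show "1 / x - 1 / (x + 1) \<le> 1 / x ^ 2" "1 / (x + 1) ^ 2 \<le> 1 / x - 1 / (x + 1)"
    unfolding e power2_eq_square using assms by (intro divide_left_mono mult_mono mult_left_mono; simp)+
qed

lemma sum_inverse_squares:
  assumes "0 < a" "a \<le> X"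
  shows "1 / real a - 1 / real (Suc X) \<le> (\<Sum>m=a..X. 1 / real m ^ 2)"
    "(\<Sum>m=a..X. 1 / real m ^ 2) \<le> 1 / real a + 1 / real a ^ 2 - 1 / real X"
  using assms(2)
proof (induction X rule: dec_induct)
  case base
  show "1 / real a - 1 / real (Suc a) \<le> (\<Sum>m=a..a. 1 / real m ^ 2)"
    using inverse_square_bounds(1)[of "real a"] assms by (simp add: add.commute)
  show "(\<Sum>m=a..a. 1 / real m ^ 2) \<le> 1 / real a + 1 / real a ^ 2 - 1 / real a" by simp
next
  case (step X)
  have X: "real X > 0" using step assms by simp
  have "1 / real (Suc X) - 1 / real (Suc (Suc X)) \<le> 1 / real (Suc X) ^ 2"
    using inverse_square_bounds(1)[of "real (Suc X)"] by (simp add: add.commute)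
  then show "1 / real a - 1 / real (Suc (Suc X)) \<le> (\<Sum>m=a..Suc X. 1 / real m ^ 2)"
    using step by simp
  have "1 / real (Suc X) ^ 2 \<le> 1 / real X - 1 / real (Suc X)"
    using inverse_square_bounds(2)[OF X] by (simp add: add.commute)
  then show "(\<Sum>m=a..Suc X. 1 / real m ^ 2) \<le> 1 / real a + 1 / real a ^ 2 - 1 / real (Suc X)"
    using step by simp
qed

lemma sum_inverse_squares_real:
  assumes "0 < y" "y \<le> real X"
  shows "1 / y - 1 / y ^ 2 - 1 / real X \<le> (\<Sum>m | m \<in> {1..X} \<and> y \<le> real m. 1 / real m ^ 2)"
    "(\<Sum>m | m \<in> {1..X} \<and> y \<le> real m. 1 / real m ^ 2) \<le> 1 / y + 1 / y ^ 2"
proof -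
  define a where "a = nat \<lceil>y\<rceil>"
  have a: "y \<le> real a" "real a \<le> y + 1" "0 < a" "a \<le> X" using assms unfolding a_def by linarith+
  have e: "{m. m \<in> {1..X} \<and> y \<le> real m} = {a..X}"
    using assms unfolding a_def by (auto simp: nat_le_iff ceiling_le_iff Suc_le_eq)
  have "1 / y - 1 / y ^ 2 \<le> 1 / (y + 1)" using assms by (simp add: field_simps power2_eq_square)
  also have "\<dots> \<le> 1 / real a" using a assms by (intro divide_left_mono) auto
  finally have "1 / y - 1 / y ^ 2 \<le> 1 / real a" .
  moreover have "1 / real (Suc X) \<le> 1 / real X" using a by (intro divide_left_mono) auto
  ultimately show "1 / y - 1 / y ^ 2 - 1 / real X \<le> (\<Sum>m | m \<in> {1..X} \<and> y \<le> real m. 1 / real m ^ 2)"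
    using sum_inverse_squares(1)[OF a(3,4)] unfolding e by linarith
  have "1 / real a \<le> 1 / y" "1 / real a ^ 2 \<le> 1 / y ^ 2"
    using a assms by (auto intro!: divide_left_mono power_mono)
  moreover have "1 / real X \<ge> 0" by simp
  ultimately show "(\<Sum>m | m \<in> {1..X} \<and> y \<le> real m. 1 / real m ^ 2) \<le> 1 / y + 1 / y ^ 2"
    using sum_inverse_squares(2)[OF a(3,4)] unfolding e by linarith
qed

text \<open>Exchanging the summations leaves the sum of \<open>ln p\<close> times the sum of \<open>1 / m\<^sup>2\<close> over \<open>p / \<alpha> \<le> m \<le> X\<close>, which is close to
  \<open>\<alpha> / p - 1 / X\<close>; so Mertens' estimate for the sum of \<open>ln p / p\<close> applies.\<close>
lemma theta_log_average:
  assumes \<alpha>: "\<alpha> > 0"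
  obtains C where "\<And>X. X > 0 \<Longrightarrow> \<bar>(\<Sum>m=1..X. theta (\<alpha> * real m) / real m ^ 2) - \<alpha> * ln (real X)\<bar> \<le> C"
proof -
  obtain C1 where C1: "C1 \<ge> 0" "\<And>n. n > 0 \<Longrightarrow> \<bar>lnp_sum (real n) - ln (real n)\<bar> \<le> C1" using mertens by blast
  obtain C2 where C2: "C2 \<ge> 0" "\<And>x. (\<Sum>p | prime p \<and> real p \<le> x. ln (real p) / (real p) ^ 2) \<le> C2"
    using sum_ln_over_square_bounded by blast
  define f where "f X = (\<Sum>m=1..X. theta (\<alpha> * real m) / real m ^ 2)" for X
  have main: "\<bar>f X - \<alpha> * lnp_sum (\<alpha> * real X)\<bar> \<le> \<alpha> ^ 2 * C2 + 4 * \<alpha>" if X: "X > 0" for X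
  proof -
    let ?P = "{p. prime p \<and> real p \<le> \<alpha> * real X}"
    have "f X = (\<Sum>m=1..X. \<Sum>p | p \<in> ?P \<and> real p / \<alpha> \<le> real m. ln (real p) * (1 / real m ^ 2))"
    proof -
      have "theta (\<alpha> * real m) / real m ^ 2 = (\<Sum>p | p \<in> ?P \<and> real p / \<alpha> \<le> real m. ln (real p) * (1 / real m ^ 2))"
        if "m \<in> {1..X}" for m
      proof -
        have "{p. prime p \<and> real p \<le> \<alpha> * real m} = {p. p \<in> ?P \<and> real p / \<alpha> \<le> real m}"
        proof -
          have "real p \<le> \<alpha> * real m \<longleftrightarrow> real p \<le> \<alpha> * real X \<and> real p / \<alpha> \<le> real m" for p
          proof -
            have "\<alpha> * real m \<le> \<alpha> * real X" using that \<alpha> by (intro mult_left_mono) auto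
            moreover have "real p / \<alpha> \<le> real m \<longleftrightarrow> real p \<le> \<alpha> * real m" using \<alpha> by (simp add: field_simps)
            ultimately show ?thesis by linarith
          qed
          then show ?thesis by blast
        qed
        then show ?thesis unfolding theta_def by (simp add: sum_divide_distrib)
      qed
      then show ?thesis unfolding f_def by (intro sum.cong) auto
    qed
    also have "\<dots> = (\<Sum>p\<in>?P. \<Sum>m | m \<in> {1..X} \<and> real p / \<alpha> \<le> real m. ln (real p) * (1 / real m ^ 2))"
      by (rule sum.swap_restrict) auto
    also have "\<dots> = (\<Sum>p\<in>?P. ln (real p) * (\<Sum>m | m \<in> {1..X} \<and> real p / \<alpha> \<le> real m. 1 / real m ^ 2))"
      by (simp add: sum_distrib_left)
    finally have f: "f X = \<dots>" .
    have y: "0 < real p / \<alpha>" "real p / \<alpha> \<le> real X" if "p \<in> ?P" for p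
      using that \<alpha> by (auto simp: prime_gt_0_nat field_simps)
    have inv: "1 / (real p / \<alpha>) = \<alpha> / real p" "1 / (real p / \<alpha>) ^ 2 = \<alpha> ^ 2 / real p ^ 2" for p
      using \<alpha> by (auto simp: power_divide)
    have "f X \<le> (\<Sum>p\<in>?P. ln (real p) * (\<alpha> / real p + \<alpha> ^ 2 / real p ^ 2))"
      unfolding f using sum_inverse_squares_real(2)[OF y, unfolded inv]
      by (intro sum_mono mult_left_mono) (auto simp: ln_prime_nonneg)
    also have "\<dots> = \<alpha> * lnp_sum (\<alpha> * real X) + \<alpha> ^ 2 * (\<Sum>p\<in>?P. ln (real p) / real p ^ 2)"
      unfolding lnp_sum_def by (simp add: sum_distrib_left sum.distrib distrib_left mult_ac)
    also have "\<dots> \<le> \<alpha> * lnp_sum (\<alpha> * real X) + \<alpha> ^ 2 * C2"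
      using C2(2) by (intro add_left_mono mult_left_mono) auto
    finally have up: "f X \<le> \<alpha> * lnp_sum (\<alpha> * real X) + \<alpha> ^ 2 * C2" .
    have "\<alpha> * lnp_sum (\<alpha> * real X) - \<alpha> ^ 2 * C2 - 4 * \<alpha> \<le> \<alpha> * lnp_sum (\<alpha> * real X) - \<alpha> ^ 2 * (\<Sum>p\<in>?P. ln (real p) / real p ^ 2) - theta (\<alpha> * real X) / real X"
    proof -
      have "theta (\<alpha> * real X) / real X \<le> 4 * (\<alpha> * real X) / real X"
        using \<alpha> X by (intro divide_right_mono theta_le) auto
      also have "\<dots> = 4 * \<alpha>" using X by simp
      finally have "theta (\<alpha> * real X) / real X \<le> 4 * \<alpha>" .
      moreover have "\<alpha> ^ 2 * (\<Sum>p\<in>?P. ln (real p) / real p ^ 2) \<le> \<alpha> ^ 2 * C2"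
        using C2(2) by (intro mult_left_mono) auto
      ultimately show ?thesis by linarith
    qed
    also have "\<dots> = (\<Sum>p\<in>?P. ln (real p) * (\<alpha> / real p - \<alpha> ^ 2 / real p ^ 2 - 1 / real X))"
      unfolding lnp_sum_def theta_def by (simp add: sum_distrib_left sum_subtractf right_diff_distrib sum_divide_distrib mult_ac)
    also have "\<dots> \<le> f X"
      unfolding f using sum_inverse_squares_real(1)[OF y, unfolded inv]
      by (intro sum_mono mult_left_mono) (auto simp: ln_prime_nonneg)
    finally show ?thesis using up C2(1) \<alpha> by (auto simp: abs_le_iff)
  qed
  have lnp: "\<bar>lnp_sum (\<alpha> * real X) - ln (real X)\<bar> \<le> C1 + ln 2 + \<bar>ln \<alpha>\<bar>" if X: "X > 0" for X
  proof (cases "\<alpha> * real X < 1")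
    case True
    then have "lnp_sum (\<alpha> * real X) = 0" unfolding lnp_sum_def by (subst primes_less_2) simp_all
    moreover have "ln (\<alpha> * real X) < 0" using True X \<alpha> by simp
    then have "ln \<alpha> + ln (real X) < 0" using X \<alpha> by (simp add: ln_mult)
    moreover have "ln (real X) \<ge> 0" using X by simp
    moreover have "ln (2 :: real) > 0" by simp
    ultimately show ?thesis using C1(1) by linarith
  next
    case False
    define n where "n = nat \<lfloor>\<alpha> * real X\<rfloor>"
    have n: "n > 0" "real n \<le> \<alpha> * real X" "\<alpha> * real X < real n + 1" using False unfolding n_def by linarith+
    have "{p :: nat. prime p \<and> real p \<le> \<alpha> * real X} = {p. prime p \<and> real p \<le> real n}" using n by auto
    then have e: "lnp_sum (\<alpha> * real X) = lnp_sum (real n)" by (simp add: lnp_sum_def)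
    have "ln (real n) \<le> ln (\<alpha> * real X)" using n by simp
    moreover have "ln (\<alpha> * real X) \<le> ln (2 * real n)" using n False by (subst ln_le_cancel_iff) (auto intro: order.trans[of _ "real n + 1"])
    ultimately have "ln (real n) \<le> ln \<alpha> + ln (real X)" "ln \<alpha> + ln (real X) \<le> ln 2 + ln (real n)"
      using n \<alpha> X by (simp_all add: ln_mult)
    then show ?thesis using C1(2)[OF n(1)] unfolding e by linarith
  qed
  have fin: "\<bar>f X - \<alpha> * ln (real X)\<bar> \<le> \<alpha> ^ 2 * C2 + 4 * \<alpha> + \<alpha> * (C1 + ln 2 + \<bar>ln \<alpha>\<bar>)" if "X > 0" for X
  proof -
    have "\<bar>\<alpha> * lnp_sum (\<alpha> * real X) - \<alpha> * ln (real X)\<bar> = \<alpha> * \<bar>lnp_sum (\<alpha> * real X) - ln (real X)\<bar>"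
      using \<alpha> by (simp add: abs_mult flip: right_diff_distrib)
    also have "\<dots> \<le> \<alpha> * (C1 + ln 2 + \<bar>ln \<alpha>\<bar>)" using lnp[OF that] \<alpha> by (intro mult_left_mono) auto
    finally show ?thesis using main[OF that] by linarith
  qed
  show ?thesis by (rule that[OF fin[unfolded f_def]])
qed

lemma harm_le_ln:
  assumes "n > 0" shows "harm n \<le> ln (real n) + (1 :: real)"
  using assms
proof (induction n rule: nat_induct_non_zero)
  case (Suc n)
  have "ln (real n / real (Suc n)) \<le> real n / real (Suc n) - 1" using Suc.hyps by (intro ln_le_minus_one) simp
  also have "\<dots> = - (1 / real (Suc n))" by (simp add: field_simps)
  finally have "1 / real (Suc n) \<le> ln (real (Suc n)) - ln (real n)" using Suc.hyps by (simp add: ln_div)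
  then show ?case using Suc.IH by (simp add: harm_Suc inverse_eq_divide)
qed (simp add: harm_def)

text \<open>The prime number theorem would give this for all large \<open>m\<close>; with coefficients \<open>D\<close> of both signs Chebyshev's bounds
  do not suffice, but the logarithmic average provides infinitely many \<open>m\<close>.\<close>
proposition theta_combination_small:
  fixes D :: "'i \<Rightarrow> real"
  assumes "finite I" "\<And>i. i \<in> I \<Longrightarrow> \<alpha> i > 0" "\<epsilon> > 0"
  shows "\<exists>m\<ge>m0. (\<Sum>i\<in>I. D i * theta (\<alpha> i * real m)) \<le> ((\<Sum>i\<in>I. D i * \<alpha> i) + \<epsilon>) * real m"
proof (rule ccontr)
  assume neg: "\<not> ?thesis"
  define A where "A = (\<Sum>i\<in>I. D i * \<alpha> i) + \<epsilon>"
  define W where "W m = (\<Sum>i\<in>I. D i * theta (\<alpha> i * real m))" for m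
  have gt: "A * real m < W m" if "m \<ge> m0" for m
  proof -
    have "\<not> W m \<le> A * real m" using neg that unfolding A_def W_def by blast
    then show ?thesis by simp
  qed
  have "\<forall>i\<in>I. \<exists>C. \<forall>X>0. \<bar>(\<Sum>m=1..X. theta (\<alpha> i * real m) / real m ^ 2) - \<alpha> i * ln (real X)\<bar> \<le> C"
    using theta_log_average[OF assms(2)] by metis
  then obtain C where C: "\<And>i X. i \<in> I \<Longrightarrow> X > 0 \<Longrightarrow> \<bar>(\<Sum>m=1..X. theta (\<alpha> i * real m) / real m ^ 2) - \<alpha> i * ln (real X)\<bar> \<le> C i"
    by metis
  define K where "K = (\<Sum>i\<in>I. \<bar>D i\<bar> * C i) + (\<Sum>m=1..m0. \<bar>A * real m - W m\<bar> / real m ^ 2) + \<bar>A\<bar>"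
  \<comment> \<open>By assumption the sum of W(m) / m^2 is at least A ln X up to a constant, while
    \<open>theta_log_average\<close> bounds it by (A - \<epsilon>) ln X up to a constant.\<close>
  have bound: "\<epsilon> * ln (real X) \<le> K" if X: "X > 0" for X
  proof -
    have "(\<Sum>m=1..X. W m / real m ^ 2) = (\<Sum>i\<in>I. D i * (\<Sum>m=1..X. theta (\<alpha> i * real m) / real m ^ 2))"
    proof -
      have "(\<Sum>m=1..X. W m / real m ^ 2) = (\<Sum>m=1..X. \<Sum>i\<in>I. D i * (theta (\<alpha> i * real m) / real m ^ 2))"
        by (simp add: W_def sum_divide_distrib)
      also have "\<dots> = (\<Sum>i\<in>I. \<Sum>m=1..X. D i * (theta (\<alpha> i * real m) / real m ^ 2))" by (rule sum.swap)
      finally show ?thesis by (simp only: sum_distrib_left)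
    qed
    also have "\<dots> \<le> (\<Sum>i\<in>I. D i * \<alpha> i * ln (real X) + \<bar>D i\<bar> * C i)"
    proof (rule sum_mono)
      fix i assume i: "i \<in> I"
      let ?s = "\<Sum>m=1..X. theta (\<alpha> i * real m) / real m ^ 2"
      have "D i * (?s - \<alpha> i * ln (real X)) \<le> \<bar>D i\<bar> * \<bar>?s - \<alpha> i * ln (real X)\<bar>"
        unfolding abs_mult[symmetric] by (rule abs_ge_self)
      also have "\<dots> \<le> \<bar>D i\<bar> * C i" using C[OF i X] by (intro mult_left_mono) auto
      finally show "D i * ?s \<le> D i * \<alpha> i * ln (real X) + \<bar>D i\<bar> * C i" by (simp add: algebra_simps)
    qed
    also have "\<dots> = (A - \<epsilon>) * ln (real X) + (\<Sum>i\<in>I. \<bar>D i\<bar> * C i)"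
      by (simp add: A_def sum.distrib sum_distrib_right)
    finally have 1: "(\<Sum>m=1..X. W m / real m ^ 2) \<le> (A - \<epsilon>) * ln (real X) + (\<Sum>i\<in>I. \<bar>D i\<bar> * C i)" .
    have "(\<Sum>m=1..X. (A * real m - W m) / real m ^ 2) \<le> (\<Sum>m=1..X. if m \<le> m0 then \<bar>A * real m - W m\<bar> / real m ^ 2 else 0)"
    proof (rule sum_mono)
      fix m assume "m \<in> {1..X}"
      then show "(A * real m - W m) / real m ^ 2 \<le> (if m \<le> m0 then \<bar>A * real m - W m\<bar> / real m ^ 2 else 0)"
        using gt[of m] by (auto intro!: divide_right_mono divide_nonpos_nonneg)
    qed
    also have "\<dots> = (\<Sum>m\<in>{1..X} \<inter> {1..m0}. \<bar>A * real m - W m\<bar> / real m ^ 2)"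
    proof -
      have "{1..X} \<inter> {m. m \<le> m0} = {1..X} \<inter> {1..m0}" by auto
      then show ?thesis by (simp add: sum.If_cases)
    qed
    also have "\<dots> \<le> (\<Sum>m=1..m0. \<bar>A * real m - W m\<bar> / real m ^ 2)"
      by (intro sum_mono2) auto
    finally have 2: "(\<Sum>m=1..X. (A * real m - W m) / real m ^ 2) \<le> (\<Sum>m=1..m0. \<bar>A * real m - W m\<bar> / real m ^ 2)" .
    have 3: "(\<Sum>m=1..X. (A * real m - W m) / real m ^ 2) = A * harm X - (\<Sum>m=1..X. W m / real m ^ 2)"
      unfolding harm_def sum_distrib_left sum_subtractf[symmetric]
    proof (intro sum.cong refl)
      fix m assume "m \<in> {1..X}"
      then have "A * real m / real m ^ 2 = A * inverse (real m)" by (simp add: power2_eq_square inverse_eq_divide)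
      then show "(A * real m - W m) / real m ^ 2 = A * inverse (real m) - W m / real m ^ 2"
        by (simp only: diff_divide_distrib)
    qed
    have "\<bar>A * harm X - A * ln (real X)\<bar> \<le> \<bar>A\<bar>"
    proof -
      have "ln (real X) \<le> ln (real X + 1)" using X by (subst ln_le_cancel_iff) auto
      then have "ln (real X) \<le> harm X" using ln_le_harm[of X] by linarith
      moreover have "harm X \<le> ln (real X) + 1" using harm_le_ln[OF X] by simp
      ultimately have "\<bar>harm X - ln (real X)\<bar> \<le> 1" by simp
      then have "\<bar>A\<bar> * \<bar>harm X - ln (real X)\<bar> \<le> \<bar>A\<bar> * 1" by (intro mult_left_mono) auto
      then show ?thesis by (simp add: abs_mult[symmetric] right_diff_distrib)
    qed
    then show ?thesis using 1 2 3 unfolding K_def by (simp add: left_diff_distrib)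
  qed
  define X where "X = nat \<lceil>exp (K / \<epsilon> + 1)\<rceil>"
  have X: "real X \<ge> exp (K / \<epsilon> + 1)" unfolding X_def by linarith
  then have "0 < real X" using exp_gt_zero less_le_trans by blast
  then have X0: "X > 0" by simp
  have "K / \<epsilon> + 1 \<le> ln (real X)" using X X0 by (simp add: ln_ge_iff)
  then have "\<epsilon> * (K / \<epsilon> + 1) \<le> \<epsilon> * ln (real X)" using assms(3) by (intro mult_left_mono) auto
  also have "\<dots> \<le> K" by (rule bound[OF X0])
  finally have "\<epsilon> * (K / \<epsilon> + 1) \<le> K" .
  then show False using assms(3) by (simp add: distrib_left)
qed

section \<open>A common denominator\<close>

lemma vge_of_nat: "prime p \<Longrightarrow> p ^ e dvd n \<Longrightarrow> vge p (int e) (of_nat n)"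
  using vge_of_dvd[of p e "int n"] by (metis of_int_of_nat_eq of_nat_dvd_iff of_nat_power)

lemma legendre_dvd:
  assumes "prime p" "n < p ^ Suc L"
  shows "p ^ (\<Sum>l=1..L. n div p ^ l) dvd fact n"
proof -
  let ?e = "\<lambda>i. multiplicity (int p) (int i)"
  have b: "\<bar>int i\<bar> < int p ^ Suc L" if "i \<in> {1..n}" for i
  proof -
    have "i < p ^ Suc L" using that assms(2) by auto
    then have "int i < int (p ^ Suc L)" by (rule of_nat_less_iff[THEN iffD2])
    then show ?thesis by simp
  qed
  have "int (\<Sum>i=1..n. ?e i) = (\<Sum>i=1..n. \<Sum>l=1..L. if int p ^ l dvd int i then 1 else 0)"
    using multiplicity_eq_sum(1)[OF assms(1) _ b] by (auto intro!: sum.cong)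
  also have "\<dots> = (\<Sum>l=1..L. \<Sum>i=1..n. if int p ^ l dvd int i then 1 else 0)" by (rule sum.swap)
  also have "\<dots> = (\<Sum>l=1..L. int (n div p ^ l))"
  proof (intro sum.cong refl)
    fix l
    have p0: "int p ^ l > 0" using assms(1) by (simp add: prime_gt_0_nat)
    have "(\<Sum>i=1..n. if int p ^ l dvd int i then 1 else 0 :: int) = (\<Sum>i\<in>{1..int n}. if int p ^ l dvd i then 1 else 0)"
      by (rule sum.reindex_bij_witness[of _ nat int]) auto
    also have "\<dots> = int (card {w \<in> {1..int n}. int p ^ l dvd w})" by (simp add: sum.If_cases Int_def)
    also have "\<dots> = int n div int p ^ l + (- 1) div int p ^ l + 1"
      using p0 by (intro card_multiples) auto
    also have "(- 1) div int p ^ l = - 1" using p0 by (simp add: div_eq_minus1)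
    finally show "(\<Sum>i=1..n. if int p ^ l dvd int i then 1 else 0 :: int) = int (n div p ^ l)" by (simp add: zdiv_int)
  qed
  finally have e: "(\<Sum>i=1..n. ?e i) = (\<Sum>l=1..L. n div p ^ l)" by (simp flip: of_nat_sum)
  have "p ^ ?e i dvd i" for i
  proof -
    have "int p ^ ?e i dvd int i" by (rule multiplicity_dvd)
    then show ?thesis by (metis of_nat_dvd_iff of_nat_power)
  qed
  then have "(\<Prod>i=1..n. p ^ ?e i) dvd (\<Prod>i=1..n. i)" by (intro prod_dvd_prod) auto
  moreover have "(\<Prod>i=1..n. p ^ ?e i) = p ^ (\<Sum>l=1..L. n div p ^ l)" unfolding e[symmetric] by (rule power_sum[symmetric])
  ultimately show ?thesis by (simp only: fact_prod of_nat_id)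
qed

definition log_floor :: "nat \<Rightarrow> nat \<Rightarrow> nat" where
  "log_floor p X = (GREATEST L. p ^ L \<le> X)"

lemma log_floor_bounds:
  assumes "prime p" "X \<ge> 1"
  shows "p ^ log_floor p X \<le> X" "X < p ^ Suc (log_floor p X)"
proof -
  have bd: "L \<le> X" if "p ^ L \<le> X" for L
  proof -
    have "L < 2 ^ L" by simp
    also have "\<dots> \<le> p ^ L" using prime_ge_2_nat[OF assms(1)] by (intro power_mono) auto
    finally show ?thesis using that by simp
  qed
  have "p ^ 0 \<le> X" using assms by simp
  from GreatestI_nat[of "\<lambda>L. p ^ L \<le> X", OF this bd] show "p ^ log_floor p X \<le> X" unfolding log_floor_def .
  show "X < p ^ Suc (log_floor p X)"
  proof (rule ccontr)
    assume "\<not> ?thesis"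
    then have "p ^ Suc (log_floor p X) \<le> X" by simp
    from Greatest_le_nat[of "\<lambda>L. p ^ L \<le> X", OF this bd] show False unfolding log_floor_def by simp
  qed
qed

lemma div_le_real: "P > 0 \<Longrightarrow> real_of_int (a div P) \<le> of_int a / of_int P"
  by (simp add: real_of_int_div4)

lemma div_ge_real:
  assumes "(P::int) > 0" shows "(of_int a + 1) / of_int P - 1 \<le> real_of_int (a div P)"
proof -
  have "a < (a div P) * P + P" using assms by (metis add.commute mult.commute mult_div_mod_eq add_less_cancel_left pos_mod_bound)
  then have "a + 1 \<le> (a div P + 1) * P" by (simp add: algebra_simps)
  then have "real_of_int (a + 1) \<le> of_int ((a div P + 1) * P)" by (rule of_int_le_iff[THEN iffD2])
  then have "(of_int a + 1) / of_int P \<le> real_of_int (a div P) + 1" using assms by (simp add: pos_divide_le_eq)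
  then show ?thesis by linarith
qed

lemma sum_pole_floors_le:
  assumes "P > 0"
  shows "real_of_int (\<Sum>n\<leftarrow>pole_radii m. (n + v) div P + (n - v) div P) \<le> 126 * of_int m / of_int P"
proof -
  have "real_of_int ((B * m + v) div P + (B * m - v) div P) \<le> of_int B * (2 * of_int m / of_int P)" for B
  proof -
    have "real_of_int ((B * m + v) div P + (B * m - v) div P) \<le> of_int (B * m + v) / of_int P + of_int (B * m - v) / of_int P"
      unfolding of_int_add[of "(B * m + v) div P"] by (intro add_mono div_le_real assms)
    also have "\<dots> = of_int B * (2 * of_int m / of_int P)" using assms by (simp add: field_simps)
    finally show ?thesis .
  qed
  then have "(\<Sum>B\<leftarrow>Bs. real_of_int ((B * m + v) div P + (B * m - v) div P)) \<le> (\<Sum>B\<leftarrow>Bs. of_int B * (2 * of_int m / of_int P))"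
    by (intro sum_list_mono) auto
  also have "\<dots> = 126 * of_int m / of_int P" by (simp add: Bs_def)
  finally show ?thesis by (simp add: pole_radii_def Bs_def)
qed

text \<open>19 = 11 + 1 + 7: the length of the list, the rounding of the two zero terms, and seven
  times the rounding of 12 m / P, since 126 - 42 = 84 = 7 * 12.\<close>

lemma gcost_crude:
  assumes "P > 0" "odd P"
  shows "gcost (pole_radii m) (21 * m) P v \<le> 7 * ((12 * m) div P) + 19"
proof -
  obtain r where r: "P = 2 * r + 1" using assms(2) by (elim oddE)
  define x y :: real where "x = of_int (21 * m + v + r + 1) / of_int P" and "y = of_int (21 * m - v + r + 1) / of_int P"
  have "x - 1 \<le> real_of_int ((21 * m + v + P div 2) div P)" "y - 1 \<le> real_of_int ((21 * m - v + P div 2) div P)"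
    using div_ge_real[OF assms(1), of "21 * m + v + P div 2"] div_ge_real[OF assms(1), of "21 * m - v + P div 2"] r
    by (simp_all add: x_def y_def)
  moreover have "x + y = 42 * of_int m / of_int P + 1 + 1 / of_int P"
  proof -
    have "x + y = (42 * of_int m + of_int P + 1) / real_of_int P"
      unfolding x_def y_def add_divide_distrib[symmetric] using r by simp
    then show ?thesis using assms(1) by (simp add: add_divide_distrib)
  qed
  moreover have "1 / real_of_int P > 0" using assms(1) by simp
  ultimately have "42 * of_int m / of_int P - 1 < real_of_int ((21 * m + v + P div 2) div P + (21 * m - v + P div 2) div P)"
    unfolding of_int_add by linarith
  moreover have "12 * of_int m / of_int P - 1 \<le> real_of_int ((12 * m) div P)"
  proof -
    have "12 * of_int m / of_int P \<le> (of_int (12 * m) + 1) / real_of_int P" using assms(1) by (intro divide_right_mono) auto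
    then show ?thesis using div_ge_real[OF assms(1), of "12 * m"] by linarith
  qed
  moreover have "length (pole_radii m) = 11" by (simp add: pole_radii_def Bs_def)
  ultimately have "real_of_int (gcost (pole_radii m) (21 * m) P v) < of_int (7 * ((12 * m) div P) + 20)"
    using sum_pole_floors_le[OF assms(1), where m = m and v = v] unfolding gcost_def by simp
  then show ?thesis by linarith
qed

text \<open>Without zeros to count, 126 m / 2^l exceeds the factorial part by 42 m / 2^l, which sums
  to less than 42 m. Together with the 2 h = 42 m halves this explains the factor
  \<open>2 ^ (84 * m)\<close> in \<open>denom\<close>.\<close>

lemma floors_crude_2:
  assumes "m \<ge> 0"
  shows "(\<Sum>l=1..L. int (length (pole_radii m)) + (\<Sum>n\<leftarrow>pole_radii m. (n + v) div 2 ^ l + (n - v) div 2 ^ l))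
    \<le> 42 * m + (\<Sum>l=1..L. 7 * ((12 * m) div 2 ^ l)) + 19 * int L"
proof -
  have "real_of_int (int (length (pole_radii m)) + (\<Sum>n\<leftarrow>pole_radii m. (n + v) div 2 ^ l + (n - v) div 2 ^ l))
    \<le> of_int (7 * ((12 * m) div 2 ^ l) + 19) + 42 * of_int m / 2 ^ l" for l
  proof -
    have "12 * of_int m / 2 ^ l \<le> (of_int (12 * m) + 1) / (2 ^ l :: real)" by (intro divide_right_mono) auto
    then have "12 * of_int m / 2 ^ l - 1 \<le> real_of_int ((12 * m) div 2 ^ l)"
      using div_ge_real[of "2 ^ l" "12 * m"] by simp
    moreover have "real_of_int (\<Sum>n\<leftarrow>pole_radii m. (n + v) div 2 ^ l + (n - v) div 2 ^ l) \<le> 126 * of_int m / 2 ^ l"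
      using sum_pole_floors_le[of "2 ^ l", where m = m and v = v] by simp
    ultimately show ?thesis by (simp add: pole_radii_def Bs_def)
  qed
  then have "real_of_int (\<Sum>l=1..L. int (length (pole_radii m)) + (\<Sum>n\<leftarrow>pole_radii m. (n + v) div 2 ^ l + (n - v) div 2 ^ l))
     \<le> (\<Sum>l=1..L. of_int (7 * ((12 * m) div 2 ^ l) + 19) + 42 * of_int m / 2 ^ l)"
    unfolding of_int_sum by (intro sum_mono)
  also have "\<dots> = of_int ((\<Sum>l=1..L. 7 * ((12 * m) div 2 ^ l)) + 19 * int L) + 42 * of_int m * (\<Sum>l=1..L. (1 / 2) ^ l)"
    by (simp add: sum.distrib sum_distrib_left power_divide)
  also have "(\<Sum>l=1..L. (1 / 2 :: real) ^ l) = 1 - (1 / 2) ^ L"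
    by (induction L) auto
  also have "42 * of_int m * (1 - (1 / 2) ^ L) \<le> 42 * of_int m * (1 :: real)"
    using assms by (intro mult_left_mono) auto
  finally have "real_of_int (\<Sum>l=1..L. int (length (pole_radii m)) + (\<Sum>n\<leftarrow>pole_radii m. (n + v) div 2 ^ l + (n - v) div 2 ^ l))
     \<le> of_int (42 * m + (\<Sum>l=1..L. 7 * ((12 * m) div 2 ^ l)) + 19 * int L)"
    by (simp only: of_int_add of_int_mult of_int_numeral mult_1_right add_ac)
  then show ?thesis by (rule of_int_le_iff[THEN iffD1])
qed

text \<open>As 84 m = 4 h bounds all relevant differences, primes with p^2 above it enter only
  through their first power. The limit 16 m in \<open>large_primes\<close> is the largest difference
  of two poles.\<close>

definition small_primes :: "nat \<Rightarrow> nat set" where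
  "small_primes m = {p. prime p \<and> p ^ 2 \<le> 84 * m}"

definition large_primes :: "nat \<Rightarrow> nat set" where
  "large_primes m = {p. prime p \<and> 84 * m < p ^ 2 \<and> p \<le> 16 * m}"

text \<open>The factorial absorbs the part \<open>7 * (12 * m div P)\<close> of the bounds for \<open>gcost\<close>, summed over the powers \<open>P\<close> of \<open>p\<close>; the primes with
  \<open>p\<^sup>2 \<le> 84 * m\<close> contribute only \<open>exp (O (m powr (3 / 4)))\<close>.\<close>
definition denom :: "nat \<Rightarrow> nat" where
  "denom m = fact (12 * m) ^ 7 * 2 ^ (84 * m) * (\<Prod>p\<in>small_primes m. p ^ (19 * log_floor p (84 * m)))
     * (\<Prod>p\<in>large_primes m. p ^ nat (weight (int m) (int p)))"

lemma finite_small_primes [simp]: "finite (small_primes m)"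
  by (rule finite_subset[of _ "{..84 * m}"]) (auto simp: small_primes_def power2_nat_le_imp_le)

lemma finite_large_primes [simp]: "finite (large_primes m)"
  by (rule finite_subset[of _ "{..16 * m}"]) (auto simp: large_primes_def)

lemma denom_pos: "denom m > 0"
  by (auto simp: denom_def small_primes_def large_primes_def prime_gt_0_nat intro!: prod_pos)

lemma denom_dvd:
  assumes "prime p" "m > 0" and L: "L = log_floor p (84 * m)"
  shows "p ^ (7 * (\<Sum>l=1..L. (12 * m) div p ^ l) + (if p = 2 then 84 * m else 0)
     + (if p \<in> small_primes m then 19 * L else 0)
     + (if p \<in> large_primes m then nat (weight (int m) (int p)) else 0)) dvd denom m"
  unfolding denom_def power_add
proof (intro mult_dvd_mono)
  have "12 * m < p ^ Suc L" using log_floor_bounds(2)[OF assms(1), of "84 * m"] assms(2) L by simp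
  then have "p ^ (\<Sum>l=1..L. (12 * m) div p ^ l) dvd fact (12 * m)" by (rule legendre_dvd[OF assms(1)])
  then have "(p ^ (\<Sum>l=1..L. (12 * m) div p ^ l)) ^ 7 dvd fact (12 * m) ^ 7" by (rule dvd_power_same)
  then show "p ^ (7 * (\<Sum>l=1..L. (12 * m) div p ^ l)) dvd fact (12 * m) ^ 7" by (simp add: mult.commute flip: power_mult)
  show "p ^ (if p = 2 then 84 * m else 0) dvd 2 ^ (84 * m)" by simp
  show "p ^ (if p \<in> small_primes m then 19 * L else 0) dvd (\<Prod>p\<in>small_primes m. p ^ (19 * log_floor p (84 * m)))"
  proof (cases "p \<in> small_primes m")
    case True
    then have "p ^ (19 * log_floor p (84 * m)) dvd (\<Prod>p\<in>small_primes m. p ^ (19 * log_floor p (84 * m)))"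
      by (intro dvd_prodI) auto
    then show ?thesis using True L by simp
  qed simp
  show "p ^ (if p \<in> large_primes m then nat (weight (int m) (int p)) else 0) dvd (\<Prod>p\<in>large_primes m. p ^ nat (weight (int m) (int p)))"
  proof (cases "p \<in> large_primes m")
    case True
    then have "p ^ nat (weight (int m) (int p)) dvd (\<Prod>p\<in>large_primes m. p ^ nat (weight (int m) (int p)))"
      by (intro dvd_prodI) auto
    then show ?thesis using True by simp
  qed simp
qed

lemma weight_nonneg: "weight m P \<ge> 0"
proof -
  have "0 \<le> stepval xs c m P" if "list_all (\<lambda>(a, b, c). 0 \<le> c) xs" "0 \<le> c" for xs c
    using that by (induction xs c m P rule: stepval.induct) auto
  moreover have "list_all (\<lambda>(a, b, c). 0 \<le> c) breaks" by code_simp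
  ultimately show ?thesis by (simp add: weight_def)
qed

lemma pole_radii_bounds:
  "\<forall>n\<in>set (pole_radii (int m)). 0 \<le> n \<and> n \<le> 8 * int m"
  by (auto simp: pole_radii_def Bs_def)

text \<open>The prime 2 and the small odd primes use the crude bounds, primes above \<bar>v\<bar> +
  8 m have \<open>p\<close>-integral coefficients, and the remaining ones have L = 1 and fall under
  \<open>gcost_le_weight\<close>.\<close>

lemma denom_admissible:
  assumes m: "m \<ge> 42" and p: "prime p"
  shows "\<exists>C. vge p C (denom m) \<and> (\<forall>v\<in>{- (8 * int m)..8 * int m}. \<exists>L. 2 * \<bar>v\<bar> \<le> int p ^ Suc L \<and>
       (\<forall>k<pole_order (pole_radii (int m)) v. vge p (int L * (int (pole_order (pole_radii (int m)) v) - int k) - C)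
          (pole_series (pole_radii (int m)) (21 * int m) (8 * int m) v $ k)))"
proof -
  define L where "L = log_floor p (84 * m)"
  define D where "D = (\<Sum>l=1..L. (12 * m) div p ^ l)"
  define e where "e = 7 * D + (if p = 2 then 84 * m else 0)
     + (if p \<in> small_primes m then 19 * L else 0)
     + (if p \<in> large_primes m then nat (weight (int m) (int p)) else 0)"
  have ve: "vge p (int e) (denom m)"
    using denom_dvd[OF p _ L_def] m unfolding e_def D_def by (intro vge_of_nat p) auto
  have L1: "p ^ L \<le> 84 * m" and L2: "84 * m < p ^ Suc L"
    using log_floor_bounds[OF p, of "84 * m"] m unfolding L_def by auto
  have L2': "4 * (21 * int m) < int p ^ Suc L"
  proof -
    have "int (84 * m) < int (p ^ Suc L)" using L2 by (rule of_nat_less_iff[THEN iffD2])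
    then show ?thesis by simp
  qed
  have fl: "(\<Sum>l=1..L. 7 * ((12 * int m) div int p ^ l)) = 7 * int D"
    by (simp add: D_def zdiv_int sum_distrib_left)
  let ?ns = "pole_radii (int m)" and ?M = "8 * int m"
  note ns = pole_radii_bounds[of m]
  show ?thesis
  proof (rule exI[of _ "int e"], intro conjI ve ballI)
    fix v assume v: "v \<in> {- ?M..?M}"
    then have v': "\<bar>v\<bar> \<le> ?M" by auto
    have vM: "?M < 21 * int m" using m by simp
    have b2: "2 * \<bar>v\<bar> \<le> int p ^ Suc L" using v' L2' by linarith
    let ?q = "pole_order ?ns v" and ?S = "pole_series ?ns (21 * int m) ?M v"
    show "\<exists>L. 2 * \<bar>v\<bar> \<le> int p ^ Suc L \<and> (\<forall>k<?q. vge p (int L * (int ?q - int k) - int e) (?S $ k))"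
    proof (cases "p = 2")
      case True
      have small: "p \<in> small_primes m" using True m by (simp add: small_primes_def)
      have nl: "p \<notin> large_primes m" using small by (simp add: small_primes_def large_primes_def)
      have "int e = 7 * int D + 84 * int m + 19 * int L"
        using True small nl unfolding e_def by simp
      then have "2 * (21 * int m) + (\<Sum>l=1..L. int (length ?ns) + (\<Sum>n\<leftarrow>?ns. (n + v) div 2 ^ l + (n - v) div 2 ^ l)) \<le> int e"
        using floors_crude_2[where m = "int m" and L = L and v = v] fl True by simp
      then have le: "int L * (int ?q - int k) - int e \<le> int L * (int ?q - int k) - 2 * (21 * int m) -
          (\<Sum>l=1..L. int (length ?ns) + (\<Sum>n\<leftarrow>?ns. (n + v) div 2 ^ l + (n - v) div 2 ^ l))" for k
        by linarith
      have L2'': "4 * (21 * int m) < 2 ^ Suc L" using L2' unfolding True of_nat_numeral .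
      have "vge p (int L * (int ?q - int k) - int e) (?S $ k)" for k
        by (rule vge_mono[OF p _ le], unfold True) (rule pole_series_vge_2[OF ns v' vM L2''])
      then show ?thesis using b2 by blast
    next
      case False
      then have odd: "odd p" using p by (metis primes_dvd_imp_eq two_is_prime_nat)
      have *: ?thesis if "(\<Sum>l=1..L. gcost ?ns (21 * int m) (int p ^ l) v) \<le> int e"
      proof -
        have "vge p (int L * (int ?q - int k) - int e) (?S $ k)" for k
          by (rule vge_mono[OF p pole_series_vge[OF p odd ns v' vM L2']]) (use that in linarith)
        then show ?thesis using b2 by blast
      qed
      show ?thesis
      proof (cases "p \<in> small_primes m")
        case True
        have "gcost ?ns (21 * int m) (int p ^ l) v \<le> 7 * ((12 * int m) div int p ^ l) + 19" for l
          using p odd by (intro gcost_crude) (auto simp: prime_gt_0_nat)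
        then have "(\<Sum>l=1..L. gcost ?ns (21 * int m) (int p ^ l) v) \<le> (\<Sum>l=1..L. 7 * ((12 * int m) div int p ^ l) + 19)"
          by (intro sum_mono)
        also have "\<dots> = 7 * int D + 19 * int L" unfolding sum.distrib fl by simp
        also have "\<dots> \<le> int e" using True unfolding e_def by simp
        finally show ?thesis by (rule *)
      next
        case large: False
        then have p2: "84 * m < p ^ 2" using p by (simp add: small_primes_def)
        show ?thesis
        proof (cases "\<bar>v\<bar> + ?M < int p")
          case True
          \<comment> \<open>The witness \<open>L = 0\<close> replaces the logarithm here; it still
            covers the tail because 2 \<bar>v\<bar> is at most \<bar>v\<bar> + 8 m < p.\<close>
          have "vge p (int 0 * (int ?q - int k) - int e) (?S $ k)" for k
            by (rule vge_mono[OF p pole_series_vge_unit[OF p odd True]]) simp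
          moreover have "2 * \<bar>v\<bar> \<le> int p ^ Suc 0" using True v' by simp
          ultimately show ?thesis by blast
        next
          case False
          then have p16: "p \<le> 16 * m" using v' by linarith
          then have lp: "p \<in> large_primes m" using p p2 by (simp add: large_primes_def)
          have "L = 1"
          proof (rule ccontr)
            assume "L \<noteq> 1"
            then consider "L = 0" | "L \<ge> 2" by linarith
            then show False
            proof cases
              case 1
              then show False using L2 p16 m by simp
            next
              case 2
              then have "p ^ 2 \<le> p ^ L" using prime_ge_1_nat[OF p] by (intro power_increasing) auto
              then show False using L1 p2 by simp
            qed
          qed
          \<comment> \<open>58^2 = 3364 is below 84 * 42 = 3528; this is where
            \<open>m \<ge> 42\<close> comes from.\<close>
          have "58 < p"
          proof (rule ccontr)
            assume "\<not> 58 < p"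
            then have "p ^ 2 \<le> 58 ^ 2" by (intro power_mono) auto
            then show False using p2 m by simp
          qed
          then have "gcost ?ns (21 * int m) (int p) v \<le> 7 * ((12 * int m) div int p) + weight (int m) (int p)"
            using p m v' False by (intro gcost_le_weight) auto
          also have "\<dots> = 7 * int D + weight (int m) (int p)" using fl \<open>L = 1\<close> by simp
          also have "\<dots> \<le> int e" using lp weight_nonneg[of "int m" "int p"] unfolding e_def by simp
          finally show ?thesis using \<open>L = 1\<close> by (intro *) simp
        qed
      qed
    qed
  qed
qed

section \<open>Numerical estimates\<close>

text \<open>Abel summation: a step function is the sum of its jumps times indicators of a / b \<le>
  m / P. With \<open>g\<close> left open, the same sum takes indicators, values of
  \<open>theta\<close>, and their main terms.\<close>

fun step_sum :: "(int \<times> int \<times> int) list \<Rightarrow> int \<Rightarrow> (int \<Rightarrow> int \<Rightarrow> real) \<Rightarrow> real" where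
  "step_sum [] c g = 0"
| "step_sum ((a, b, c') # xs) c g = of_int (c' - c) * g a b + step_sum xs c' g"

fun ascending :: "(int \<times> int \<times> int) list \<Rightarrow> bool" where
  "ascending ((a, b, c) # (a1, b1, c1) # xs) \<longleftrightarrow> a * b1 \<le> a1 * b \<and> 0 < b \<and> 0 < b1 \<and> ascending ((a1, b1, c1) # xs)"
| "ascending _ \<longleftrightarrow> True"

lemma step_sum_eq_0:
  assumes "ascending ((a, b, c) # xs)" "\<not> a * P \<le> b * m" "P \<ge> 0"
  shows "step_sum xs c' (\<lambda>a b. if a * P \<le> b * m then 1 else 0) = 0"
  using assms(1,2)
proof (induction xs arbitrary: a b c c')
  case (Cons x xs)
  obtain a1 b1 c1 where x: "x = (a1, b1, c1)" by (cases x)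
  have asc: "a * b1 \<le> a1 * b" "0 < b" "0 < b1" "ascending ((a1, b1, c1) # xs)" using Cons.prems x by auto
  have "\<not> a1 * P \<le> b1 * m"
  proof
    assume "a1 * P \<le> b1 * m"
    have "(a * P) * b1 = (a * b1) * P" by simp
    also have "\<dots> \<le> (a1 * b) * P" using asc assms(3) by (intro mult_right_mono) auto
    also have "\<dots> = b * (a1 * P)" by simp
    also have "\<dots> \<le> b * (b1 * m)" using asc \<open>a1 * P \<le> b1 * m\<close> by (intro mult_left_mono) auto
    also have "\<dots> = (b * m) * b1" by simp
    finally show False using asc Cons.prems(2) by simp
  qed
  then show ?case using Cons.IH[OF asc(4)] x by simp
qed simp

lemma stepval_eq_step_sum:
  assumes "ascending xs" "P \<ge> 0"
  shows "real_of_int (stepval xs c m P) = of_int c + step_sum xs c (\<lambda>a b. if a * P \<le> b * m then 1 else 0)"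
  using assms(1)
proof (induction xs arbitrary: c)
  case (Cons x xs)
  obtain a b c' where x: "x = (a, b, c')" by (cases x)
  have "ascending xs" using Cons.prems x by (cases xs) (auto elim: ascending.elims)
  then show ?case using Cons.IH step_sum_eq_0[of a b c' xs P m c'] Cons.prems assms(2) x by auto
qed simp

lemma step_sum_linear:
  "step_sum xs c (\<lambda>a b. \<Sum>p\<in>A. f p * g p a b) = (\<Sum>p\<in>A. f p * step_sum xs c (g p))"
  by (induction xs c "g undefined" rule: step_sum.induct)
     (simp_all add: sum_distrib_left sum.distrib distrib_left mult_ac)

lemma step_sum_cong:
  "(\<And>a b c'. (a, b, c') \<in> set xs \<Longrightarrow> g a b = g' a b) \<Longrightarrow> step_sum xs c g = step_sum xs c g'"
proof (induction xs arbitrary: c)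
  case (Cons x xs)
  obtain a b c' where x: "x = (a, b, c')" by (cases x)
  have "g a b = g' a b" using Cons.prems[of a b c'] x by simp
  moreover have "step_sum xs c' g = step_sum xs c' g'" using Cons.prems by (intro Cons.IH) auto
  ultimately show ?case using x by simp
qed simp

text \<open>The coefficients do not depend on \<open>g\<close>, so the \<open>D\<close> that
  multiplies the values of \<open>theta\<close> also multiplies the main terms, as
  \<open>theta_combination_small\<close> requires.\<close>

lemma step_sum_eq_sum:
  "\<exists>D. \<forall>g. step_sum xs c g = (\<Sum>i<length xs. D i * g (fst (xs ! i)) (fst (snd (xs ! i))))"
proof (induction xs arbitrary: c)
  case (Cons x xs)
  obtain a b c' where x: "x = (a, b, c')" by (cases x)
  obtain D where D: "\<And>g. step_sum xs c' g = (\<Sum>i<length xs. D i * g (fst (xs ! i)) (fst (snd (xs ! i))))"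
    using Cons by blast
  show ?case
    by (rule exI[of _ "case_nat (of_int (c' - c)) D"]) (simp add: x D sum.lessThan_Suc_shift del: sum.lessThan_Suc)
qed simp

text \<open>An integer upper bound in thousandths: \<open>- ((- x) div a)\<close> is the ceiling of
  x / a, and 6000 = 1000 * 6 because theta (b / a * m) has main term 6 b / a * k for m = 6
  k.\<close>

fun step_bound :: "(int \<times> int \<times> int) list \<Rightarrow> int \<Rightarrow> int" where
  "step_bound [] c = 0"
| "step_bound ((a, b, c') # xs) c = - ((- (6000 * (c' - c) * b)) div a) + step_bound xs c'"

lemma step_sum_le_bound:
  assumes "list_all (\<lambda>(a, b, c). 0 < a) xs"
  shows "1000 * step_sum xs c (\<lambda>a b. 6 * of_int b / of_int a) \<le> of_int (step_bound xs c)"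
  using assms
proof (induction xs arbitrary: c)
  case (Cons x xs)
  obtain a b c' where x: "x = (a, b, c')" by (cases x)
  define d where "d = c' - c"
  have "real_of_int ((- (6000 * d * b)) div a) \<le> of_int (- (6000 * d * b)) / of_int a"
    by (rule real_of_int_div4)
  moreover have "real_of_int (- (6000 * d * b)) / of_int a = - (1000 * (of_int d * (6 * of_int b / of_int a)))" by simp
  moreover have "1000 * step_sum xs c' (\<lambda>a b. 6 * of_int b / of_int a) \<le> of_int (step_bound xs c')"
    using Cons.prems x by (intro Cons.IH) simp
  ultimately show ?case unfolding x step_sum.simps step_bound.simps d_def[symmetric] distrib_left of_int_add of_int_minus by linarith
qed simp

text \<open>\<open>b \<le> 16 * a\<close> keeps the arguments of \<open>theta\<close> at most 16 m.
  The last fact says that the prime number theorem would predict at most 498.9 per unit of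
  \<open>k\<close> for \<open>weight_sum\<close>.\<close>

lemma breaks_facts:
  "ascending breaks" "list_all (\<lambda>(a, b, c). 0 < a \<and> 0 < b \<and> b \<le> 16 * a) breaks" "step_bound breaks 0 \<le> 498900"
  by code_simp+

definition weight_sum :: "nat \<Rightarrow> real" where
  "weight_sum m = (\<Sum>p | prime p \<and> p \<le> 16 * m. ln (real p) * of_int (weight (int m) (int p)))"

lemma weight_sum_eq_theta:
  assumes "m > 0"
  shows "weight_sum m = step_sum breaks 0 (\<lambda>a b. theta (of_int b / of_int a * real m))"
proof -
  let ?A = "{p. prime p \<and> p \<le> 16 * m}"
  have fin: "finite ?A" by (rule finite_subset[of _ "{..16 * m}"]) auto
  have "(\<Sum>p\<in>?A. ln (real p) * of_int (weight (int m) (int p)))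
     = (\<Sum>p\<in>?A. ln (real p) * step_sum breaks 0 (\<lambda>a b. if a * int p \<le> b * int m then 1 else 0))"
    unfolding weight_def by (simp add: stepval_eq_step_sum[OF breaks_facts(1)])
  also have "\<dots> = step_sum breaks 0 (\<lambda>a b. \<Sum>p\<in>?A. ln (real p) * (if a * int p \<le> b * int m then 1 else 0))"
    by (rule step_sum_linear[symmetric])
  also have "\<dots> = step_sum breaks 0 (\<lambda>a b. theta (of_int b / of_int a * real m))"
  proof (rule step_sum_cong)
    fix a b c' assume "(a, b, c') \<in> set breaks"
    then have ab: "0 < a" "0 < b" "b \<le> 16 * a" using breaks_facts(2) by (auto simp: list_all_iff)
    have iff: "a * int p \<le> b * int m \<longleftrightarrow> real p \<le> of_int b / of_int a * real m" for p
    proof -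
      have "a * int p \<le> b * int m \<longleftrightarrow> real_of_int (a * int p) \<le> of_int (b * int m)" by (rule of_int_le_iff[symmetric])
      also have "\<dots> \<longleftrightarrow> real p \<le> of_int b / of_int a * real m" using ab by (simp add: field_simps)
      finally show ?thesis .
    qed
    have "p \<le> 16 * m" if "real p \<le> of_int b / of_int a * real m" for p
    proof -
      have "of_int b / of_int a \<le> (16 :: real)"
      proof -
        have "real_of_int b \<le> of_int (16 * a)" using ab(3) by (rule of_int_le_iff[THEN iffD2])
        then show ?thesis using ab by (simp add: divide_le_eq)
      qed
      then have "of_int b / of_int a * real m \<le> 16 * real m" by (intro mult_right_mono) auto
      then show ?thesis using that by linarith
    qed
    then have "?A \<inter> {p. a * int p \<le> b * int m} = {p. prime p \<and> real p \<le> of_int b / of_int a * real m}"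
      unfolding iff by auto
    then show "(\<Sum>p\<in>?A. ln (real p) * (if a * int p \<le> b * int m then 1 else 0)) = theta (of_int b / of_int a * real m)"
      unfolding theta_def using fin by (simp add: if_distrib sum.If_cases cong: if_cong)
  qed
  finally show ?thesis unfolding weight_sum_def .
qed

proposition weight_sum_small:
  "\<exists>k\<ge>k0. weight_sum (6 * k) \<le> 499 * real k"
proof -
  obtain D where D: "\<And>g. step_sum breaks 0 g = (\<Sum>i<length breaks. D i * g (fst (breaks ! i)) (fst (snd (breaks ! i))))"
    using step_sum_eq_sum[of breaks 0] by blast
  define \<alpha> where "\<alpha> i = 6 * of_int (fst (snd (breaks ! i))) / real_of_int (fst (breaks ! i))" for i
  have pos: "0 < \<alpha> i" if "i \<in> {..<length breaks}" for i
  proof -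
    obtain a b c where abc: "breaks ! i = (a, b, c)" by (cases "breaks ! i")
    then have "(a, b, c) \<in> set breaks" using that by (metis lessThan_iff nth_mem)
    then have "0 < a" "0 < b" using breaks_facts(2) by (auto simp: list_all_iff)
    then show ?thesis unfolding \<alpha>_def abc by simp
  qed
  \<comment> \<open>The slack 1 / 10 raises the main term 498.9 to 499.\<close>
  obtain k where k: "k \<ge> max k0 1"
    "(\<Sum>i<length breaks. D i * theta (\<alpha> i * real k)) \<le> ((\<Sum>i<length breaks. D i * \<alpha> i) + 1 / 10) * real k"
    using theta_combination_small[of "{..<length breaks}" \<alpha> "1 / 10" "max k0 1" D] pos by auto
  have "list_all (\<lambda>(a, b, c). 0 < a) breaks" using breaks_facts(2) by (auto simp: list_all_iff)
  then have "1000 * step_sum breaks 0 (\<lambda>a b. 6 * of_int b / of_int a) \<le> of_int (step_bound breaks 0)"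
    by (rule step_sum_le_bound)
  also have "\<dots> \<le> 498900" using breaks_facts(3) by linarith
  finally have S: "(\<Sum>i<length breaks. D i * \<alpha> i) \<le> 498.9" unfolding D \<alpha>_def by simp
  have "weight_sum (6 * k)
     = step_sum breaks 0 (\<lambda>a b. theta (of_int b / of_int a * real (6 * k)))"
    using k by (intro weight_sum_eq_theta) auto
  also have "\<dots> = (\<Sum>i<length breaks. D i * theta (\<alpha> i * real k))"
    unfolding D \<alpha>_def by (intro sum.cong refl) (simp add: mult_ac)
  also have "\<dots> \<le> ((\<Sum>i<length breaks. D i * \<alpha> i) + 1 / 10) * real k" by (rule k(2))
  also have "\<dots> \<le> 499 * real k" using S by (intro mult_right_mono) auto
  finally show ?thesis using k by auto
qed

section \<open>Logarithms of factorials and the numerical inequality\<close>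

lemma ln_fact_lower: "n > 0 \<Longrightarrow> real n * ln (real n) - real n \<le> ln (fact n)"
proof -
  assume n: "n > 0"
  have "ln ((real n / exp 1) ^ n) \<le> ln (fact n)" using n fact_ge_power_exp[of n] by simp
  then show ?thesis using n by (simp add: ln_realpow ln_div algebra_simps)
qed

lemma ln_fact_upper:
  assumes "n > 0" shows "ln (fact n :: real) \<le> real n * ln (real n) - real n + ln (real n) + 1"
  using assms
proof (induction n rule: nat_induct_non_zero)
  case (Suc n)
  have n: "real n > 0" using Suc.hyps by simp
  have "ln (real n / real (Suc n)) \<le> real n / real (Suc n) - 1" using n by (intro ln_le_minus_one) simp
  also have "\<dots> = - (1 / real (Suc n))" by (simp add: field_simps)
  finally have "1 / real (Suc n) \<le> ln (real (Suc n)) - ln (real n)" using n by (simp add: ln_div)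
  then have "real (Suc n) * (1 / real (Suc n)) \<le> real (Suc n) * (ln (real (Suc n)) - ln (real n))" by (intro mult_left_mono) auto
  then have 1: "1 \<le> real (Suc n) * ln (real (Suc n)) - real (Suc n) * ln (real n)" by (simp add: right_diff_distrib del: of_nat_Suc)
  have "ln (fact (Suc n) :: real) = ln (real (Suc n)) + ln (fact n)"
    unfolding fact_Suc by (rule ln_mult_pos) auto
  also have "\<dots> \<le> ln (real (Suc n)) + (real n * ln (real n) - real n + ln (real n) + 1)" using Suc.IH by simp
  also have "\<dots> \<le> real (Suc n) * ln (real (Suc n)) - real (Suc n) + ln (real (Suc n)) + 1"
    using 1 by (simp add: distrib_right)
  finally show ?case .
qed simp

lemma ln_le_powr_quarter:
  assumes "(x::real) \<ge> 1" shows "ln x \<le> 4 * x powr (1 / 4)"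
proof -
  have "ln (x powr (1 / 4)) \<le> x powr (1 / 4) - 1" using assms by (intro ln_le_minus_one) simp
  then show ?thesis using assms by (simp add: ln_powr)
qed

text \<open>Stirling's formula with an error of order ln k, relaxed to k powr (3 / 4), the order of
  the contribution of the small primes, so that all errors can be collected in one term.\<close>

lemma ln_fact_scaled:
  assumes "c > 0" "k > 0"
  shows "ln (fact (c * k) :: real) \<le> real k * (real c * ln (real c) - real c) + real c * (real k * ln (real k)) + (ln (real c) + 5) * real k powr (3 / 4)"
    "real k * (real c * ln (real c) - real c) + real c * (real k * ln (real k)) \<le> ln (fact (c * k) :: real)"
proof -
  have ck: "c * k > 0" using assms by simp
  have e: "real (c * k) * ln (real (c * k)) - real (c * k) = real k * (real c * ln (real c) - real c) + real c * (real k * ln (real k))"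
    using assms by (simp add: ln_mult algebra_simps)
  have k1: "1 \<le> real k powr (3 / 4)" using assms by (simp add: ge_one_powr_ge_zero)
  have "ln (real k) \<le> 4 * real k powr (1 / 4)" using assms by (intro ln_le_powr_quarter) simp
  also have "\<dots> \<le> 4 * real k powr (3 / 4)" using assms by (intro mult_left_mono powr_mono) auto
  finally have "ln (real (c * k)) + 1 \<le> ln (real c) * 1 + 4 * real k powr (3 / 4) + 1" using assms by (simp add: ln_mult)
  also have "\<dots> \<le> ln (real c) * real k powr (3 / 4) + 4 * real k powr (3 / 4) + real k powr (3 / 4)"
    using assms k1 by (intro add_mono mult_left_mono) auto
  finally have "ln (real (c * k)) + 1 \<le> (ln (real c) + 5) * real k powr (3 / 4)" by (simp add: algebra_simps)
  then show "ln (fact (c * k) :: real) \<le> real k * (real c * ln (real c) - real c) + real c * (real k * ln (real k)) + (ln (real c) + 5) * real k powr (3 / 4)"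
    using ln_fact_upper[OF ck] e by linarith
  show "real k * (real c * ln (real c) - real c) + real c * (real k * ln (real k)) \<le> ln (fact (c * k) :: real)"
    using ln_fact_lower[OF ck] e by linarith
qed

lemma ln_smooth_times:
  assumes "(r::real) > 0"
  shows "ln (2 ^ i * 3 ^ j * 5 ^ k * 7 ^ l * r) = real i * ln 2 + real j * ln 3 + real k * ln 5 + real l * ln 7 + ln r"
  using assms by (simp add: ln_mult ln_realpow)

lemma ln_ge_one_minus_inverse:
  assumes "(r::real) > 0" shows "1 - inverse r \<le> ln r"
  using ln_le_minus_one[of "inverse r"] assms by (simp add: ln_inverse)

text \<open>The numbers \<open>125 \<plusminus> 6 * B\<close> with \<open>B\<close> from \<open>radii\<close> below come from the factorials in the size estimate, 251 and 252 from the maximum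
  of \<open>z / (1 + z)\<^bsup>252\<^esup>\<close> at \<open>z = 1 / 251\<close>, and 499 from \<open>weight_sum_small\<close>; the terms with \<open>ln 252\<close> cancel.\<close>
lemma numeric_bound:
  "504 * ln 72 + 504 * ln 2 + 251 * ln 251 + 499 +
   (107 * ln 107 + 2 * (101 * ln 101) + 2 * (95 * ln 95) + 2 * (89 * ln 89) + 2 * (83 * ln 83) + 2 * (77 * ln 77)) <
   143 * ln 143 + 2 * (149 * ln 149) + 2 * (155 * ln 155) + 2 * (161 * ln 161) + 2 * (167 * ln 167) + 2 * (173 * ln (173 :: real)) - 1"
proof -
  have ln2: "ln (2::real) \<in> {69314 / 100000..69315 / 100000}"
    using ln_approx_bounds[of 2 6] by (simp add: eval_nat_numeral)
  have "ln (3 / 2 :: real) \<in> {40546 / 100000..40547 / 100000}"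
    using ln_approx_bounds[of "3 / 2" 4] by (simp add: eval_nat_numeral)
  then have ln3: "ln (3::real) - ln 2 \<in> {40546 / 100000..40547 / 100000}" by (simp add: ln_div)
  have "ln (5 / 4 :: real) \<in> {22314 / 100000..22315 / 100000}"
    using ln_approx_bounds[of "5 / 4" 3] by (simp add: eval_nat_numeral)
  moreover have "ln (4::real) = 2 * ln 2" using ln_smooth_times[of 1 2 0 0 0] by simp
  ultimately have ln5: "ln (5::real) - 2 * ln 2 \<in> {22314 / 100000..22315 / 100000}" by (simp add: ln_div)
  have "ln (7 / 6 :: real) \<in> {15415 / 100000..15416 / 100000}"
    using ln_approx_bounds[of "7 / 6" 3] by (simp add: eval_nat_numeral)
  moreover have "ln (6::real) = ln 2 + ln 3" using ln_smooth_times[of 1 1 1 0 0] by simp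
  ultimately have ln7: "ln (7::real) - ln 2 - ln 3 \<in> {15415 / 100000..15416 / 100000}" by (simp add: ln_div)
  have e72: "ln (72::real) = 3 * ln 2 + 2 * ln 3" using ln_smooth_times[of 1 3 2 0 0] by simp
  \<comment> \<open>Each argument is a product of primes up to 7 times a ratio near 1, for which ln
    r \<le> r - 1 or ln r \<ge> 1 - 1 / r is accurate enough.\<close>
  have u251: "ln 251 \<le> 1 * ln 2 + 3 * ln 5 + (251 / 250 - 1 :: real)"
    using ln_smooth_times[of "251 / 250" 1 0 3 0] ln_le_minus_one[of "251 / 250"] by simp
  have u107: "ln 107 \<le> 2 * ln 2 + 3 * ln 3 + (107 / 108 - 1 :: real)"
    using ln_smooth_times[of "107 / 108" 2 3 0 0] ln_le_minus_one[of "107 / 108"] by simp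
  have u101: "ln 101 \<le> 2 * ln 2 + 2 * ln 5 + (101 / 100 - 1 :: real)"
    using ln_smooth_times[of "101 / 100" 2 0 2 0] ln_le_minus_one[of "101 / 100"] by simp
  have u95: "ln 95 \<le> 5 * ln 2 + 1 * ln 3 + (95 / 96 - 1 :: real)"
    using ln_smooth_times[of "95 / 96" 5 1 0 0] ln_le_minus_one[of "95 / 96"] by simp
  have u89: "ln 89 \<le> 1 * ln 2 + 2 * ln 3 + 1 * ln 5 + (89 / 90 - 1 :: real)"
    using ln_smooth_times[of "89 / 90" 1 2 1 0] ln_le_minus_one[of "89 / 90"] by simp
  have u83: "ln 83 \<le> 2 * ln 2 + 1 * ln 3 + 1 * ln 7 + (83 / 84 - 1 :: real)"
    using ln_smooth_times[of "83 / 84" 2 1 0 1] ln_le_minus_one[of "83 / 84"] by simp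
  have u77: "ln 77 \<le> 1 * ln 3 + 2 * ln 5 + (77 / 75 - 1 :: real)"
    using ln_smooth_times[of "77 / 75" 0 1 2 0] ln_le_minus_one[of "77 / 75"] by simp
  have l143: "4 * ln 2 + 2 * ln 3 + (1 - 144 / 143 :: real) \<le> ln 143"
    using ln_smooth_times[of "143 / 144" 4 2 0 0] ln_ge_one_minus_inverse[of "143 / 144"] by simp
  have l149: "1 * ln 2 + 1 * ln 3 + 2 * ln 5 + (1 - 150 / 149 :: real) \<le> ln 149"
    using ln_smooth_times[of "149 / 150" 1 1 2 0] ln_ge_one_minus_inverse[of "149 / 150"] by simp
  have l155: "5 * ln 2 + 1 * ln 5 + (1 - 160 / 155 :: real) \<le> ln 155"
    using ln_smooth_times[of "155 / 160" 5 0 1 0] ln_ge_one_minus_inverse[of "155 / 160"] by simp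
  have l161: "5 * ln 2 + 1 * ln 5 + (1 - 160 / 161 :: real) \<le> ln 161"
    using ln_smooth_times[of "161 / 160" 5 0 1 0] ln_ge_one_minus_inverse[of "161 / 160"] by simp
  have l167: "3 * ln 2 + 1 * ln 3 + 1 * ln 7 + (1 - 168 / 167 :: real) \<le> ln 167"
    using ln_smooth_times[of "167 / 168" 3 1 0 1] ln_ge_one_minus_inverse[of "167 / 168"] by simp
  have l173: "2 * ln 5 + 1 * ln 7 + (1 - 175 / 173 :: real) \<le> ln 173"
    using ln_smooth_times[of "173 / 175" 0 0 2 1] ln_ge_one_minus_inverse[of "173 / 175"] by simp
  show ?thesis
    using ln2 ln3 ln5 ln7 e72 u251 u107 u101 u95 u89 u83 u77 l143 l149 l155 l161 l167 l173
    unfolding atLeastAtMost_iff by linarith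
qed

section \<open>Irrationality\<close>

lemma common_denominator:
  assumes "finite A" "\<And>s. s \<in> A \<Longrightarrow> f s \<in> (\<rat> :: real set)"
  obtains Q :: int where "Q > 0" "\<And>s. s \<in> A \<Longrightarrow> of_int Q * f s \<in> \<int>"
  using assms
proof (induction A arbitrary: thesis rule: finite_induct)
  case empty
  then show ?case by (metis empty_iff zero_less_one)
next
  case (insert x A)
  obtain Q where Q: "Q > 0" "\<And>s. s \<in> A \<Longrightarrow> of_int Q * f s \<in> \<int>"
    using insert.IH insert.prems(2) by blast
  obtain a b :: int where ab: "f x = of_int a / of_int b" "b > 0"
    using insert.prems(2)[of x] by (auto elim: Rats_cases')
  show ?case
  proof (rule insert.prems(1)[of "Q * b"])
    show "Q * b > 0" using Q ab by simp
    fix s assume "s \<in> insert x A"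
    then show "of_int (Q * b) * f s \<in> \<int>"
    proof
      assume "s = x"
      then have "of_int (Q * b) * f s = of_int (Q * a)" using ab by simp
      then show ?thesis by (metis Ints_of_int)
    next
      assume "s \<in> A"
      have "of_int (Q * b) * f s = of_int b * (of_int Q * f s)" by simp
      then show ?thesis using Q(2)[OF \<open>s \<in> A\<close>] by (metis Ints_mult Ints_of_int)
    qed
  qed
qed

definition radii :: "nat list" where
  "radii = [3, 4, 4, 5, 5, 6, 6, 7, 7, 8, 8]"

lemma pole_radii_eq: "pole_radii (int (6 * k)) = map (\<lambda>B. int (6 * B * k)) radii"
  by (simp add: pole_radii_def Bs_def radii_def)

lemma ln_prod_list:
  assumes "\<And>x. x \<in> set xs \<Longrightarrow> f x > (0::real)"
  shows "ln (\<Prod>x\<leftarrow>xs. f x) = (\<Sum>x\<leftarrow>xs. ln (f x)) \<and> (\<Prod>x\<leftarrow>xs. f x) > 0"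
  using assms
proof (induction xs)
  case (Cons x xs)
  then have "f x > 0" "ln (\<Prod>x\<leftarrow>xs. f x) = (\<Sum>x\<leftarrow>xs. ln (f x))" "(\<Prod>x\<leftarrow>xs. f x) > 0" by auto
  then show ?case by (simp add: ln_mult_pos)
qed simp

text \<open>Of the 2 n + 1 factors, all but w = n are lowered by 1/2 to the consecutive integers
  from h - s - n + 1 to h - s + n; the factor for w = n is at least 1.\<close>

lemma prod_pole_block_ge:
  fixes h s n :: nat
  assumes "n + s < h"
  shows "fact (h - s + n) / fact (h - s - n) \<le> (\<Prod>w\<leftarrow>[- int n..int n]. real h + 1 / 2 - of_int w - real s)"
proof -
  define r where "r = h - s"
  have r: "real r = real h - real s" "n < r" using assms by (auto simp: r_def of_nat_diff)
  have "fact (r + n) / fact (r - n) = (fact ((r - n) + 2 * n) / fact (r - n) :: real)" using r by (simp add: add.commute)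
  also have "\<dots> = (\<Prod>i=1..2 * n. real (r - n) + real i)" by (rule prod_shift_eq_fact[symmetric])
  also have "\<dots> = (\<Prod>w\<in>{- int n..<int n}. real r - of_int w)"
    using r by (intro prod.reindex_bij_witness[of _ "\<lambda>w. nat (int n - w)" "\<lambda>i. int n - int i"]) (auto simp: of_nat_diff)
  also have "\<dots> \<le> (\<Prod>w\<in>{- int n..<int n}. real r + 1 / 2 - of_int w)"
    using r by (intro prod_mono) auto
  also have "\<dots> * 1 \<le> (\<Prod>w\<in>{- int n..<int n}. real r + 1 / 2 - of_int w) * (real r + 1 / 2 - of_int (int n))"
    using r by (intro mult_left_mono prod_nonneg) auto
  also have "\<dots> = (\<Prod>w\<in>insert (int n) {- int n..<int n}. real r + 1 / 2 - of_int w)" by (simp add: mult.commute)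
  also have "insert (int n) {- int n..<int n} = {- int n..int n}" by auto
  also have "(\<Prod>w\<in>{- int n..int n}. real r + 1 / 2 - of_int w) = (\<Prod>w\<leftarrow>[- int n..int n]. real r + 1 / 2 - of_int w)"
    by (subst prod.distinct_set_conv_list[symmetric]) auto
  finally show ?thesis unfolding r_def[symmetric] r(1) by (simp add: algebra_simps)
qed

lemma prod_shifted_poles:
  "(\<Prod>a\<leftarrow>shifted_poles ns h. f a) = (\<Prod>n\<leftarrow>ns. \<Prod>w\<leftarrow>[- n..n]. f (real h + 1 / 2 - of_int w))"
  unfolding shifted_poles_def by (induction ns) (simp_all add: o_def)

definition approx_form :: "nat \<Rightarrow> real" where
  "approx_form k = (\<Sum>n. wp_term (126 * k) (shifted_poles (pole_radii (int (6 * k))) (126 * k)) n)"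

lemma shifted_poles_ge:
  assumes "k > 0" "a \<in> set (shifted_poles (pole_radii (int (6 * k))) (126 * k))"
  shows "real k < a" "1 \<le> a"
proof -
  from assms(2) obtain n w where a: "a = real (126 * k) + 1 / 2 - of_int w" and n: "n \<in> set (pole_radii (int (6 * k)))" and w: "w \<le> n"
    by (auto simp: shifted_poles_def)
  have "w \<le> 48 * int k" using n w by (auto simp: pole_radii_def Bs_def)
  then have "real_of_int w \<le> of_int (48 * int k)" by (rule of_int_le_iff[THEN iffD2])
  then show "real k < a" "1 \<le> a" unfolding a using assms(1) by auto
qed

lemma length_shifted_poles: "length (shifted_poles (pole_radii (int (6 * k))) h) = 756 * k + 11"
  by (simp add: shifted_poles_def pole_radii_def Bs_def nat_add_distrib nat_mult_distrib)

lemma summable_approx_form: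
  assumes "k > 0"
  shows "summable (\<lambda>n. \<bar>wp_term (126 * k) (shifted_poles (pole_radii (int (6 * k))) (126 * k)) n\<bar>)"
  using shifted_poles_ge(2)[OF assms] length_shifted_poles[of k] by (intro summable_abs_wp_term) auto

text \<open>The bound of \<open>prod_pole_block_ge\<close> for s = k and h = 126 k, so that h - s =
  125 k, with n = 6 B k.\<close>

definition fact_ratio :: "nat \<Rightarrow> nat \<Rightarrow> real" where
  "fact_ratio k B = fact ((125 + 6 * B) * k) / fact ((125 - 6 * B) * k)"

lemma fact_ratio_pos: "fact_ratio k B > 0"
  by (simp add: fact_ratio_def)

lemma approx_form_bounds:
  assumes k: "k > 0"
  shows "0 < approx_form k"
    "approx_form k \<le> fact (252 * k) * (real (126 * k) + 1 / 2) * (251 ^ 251 / 252 ^ 252) ^ k /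
      (\<Prod>B\<leftarrow>radii. fact_ratio k B)"
proof -
  let ?as = "shifted_poles (pole_radii (int (6 * k))) (126 * k)" and ?\<kappa> = "(251 ^ 251 / 252 ^ 252 :: real) ^ k"
  have as: "\<forall>a\<in>set ?as. real k < a" using shifted_poles_ge(1)[OF k] by blast
  have ne: "?as \<noteq> []" using length_shifted_poles[of k "126 * k"] by auto
  have \<kappa>: "z powr real k \<le> ?\<kappa> * (1 + z) ^ (2 * (126 * k) + 2)" if z: "0 < z" "z < 1" for z :: real
  proof -
    have "z * real (Suc 251) ^ Suc 251 \<le> real 251 ^ 251 * (1 + z) ^ Suc 251"
      using z by (intro times_power_le_power_Suc) auto
    then have le: "z * 252 ^ 252 \<le> 251 ^ 251 * (1 + z) ^ 252" by (simp only: numeral_plus_one of_nat_numeral Suc_numeral semiring_norm)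
    have "z ^ k \<le> (b / a) ^ k * (1 + z) ^ (2 * (126 * k) + 2)" if le: "z * a \<le> b * (1 + z) ^ 252" and ab: "a > 0" "b > 0" for a b
    proof -
      have "z \<le> b / a * (1 + z) ^ 252" using le ab by (simp add: field_simps)
      then have "z ^ k \<le> (b / a * (1 + z) ^ 252) ^ k" using z by (intro power_mono) auto
      also have "\<dots> = (b / a) ^ k * (1 + z) ^ (252 * k)" by (simp only: power_mult_distrib power_mult)
      also have "\<dots> \<le> (b / a) ^ k * (1 + z) ^ (2 * (126 * k) + 2)"
        using z ab by (intro mult_left_mono power_increasing) auto
      finally show ?thesis .
    qed
    from this[OF le] have "z ^ k \<le> ?\<kappa> * (1 + z) ^ (2 * (126 * k) + 2)" by (meson zero_less_numeral zero_less_power)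
    then show ?thesis using z by (simp only: powr_realpow)
  qed
  note B = wp_series_bounds[OF as of_nat_0_le_iff \<kappa> ne summable_approx_form[OF k]]
  show "0 < approx_form k" unfolding approx_form_def by (rule B(1))
  have pos: "(\<Prod>B\<leftarrow>radii. fact_ratio k B) > 0"
    using ln_prod_list[of radii "fact_ratio k"] by (simp add: fact_ratio_pos)
  have le: "(\<Prod>B\<leftarrow>radii. fact_ratio k B) \<le> (\<Prod>a\<leftarrow>?as. a - real k)"
  proof -
    have blk: "fact_ratio k B \<le>
       (\<Prod>w\<leftarrow>[- int (6 * B * k)..int (6 * B * k)]. real (126 * k) + 1 / 2 - of_int w - real k)" if "B \<in> set radii" for B
    proof -
      have B: "B \<le> 8" using that by (auto simp: radii_def)
      have "6 * B * k \<le> 48 * k" using B by simp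
      then have "6 * B * k + k < 126 * k" using k by linarith
      then have "fact (126 * k - k + 6 * B * k) / fact (126 * k - k - 6 * B * k) \<le>
         (\<Prod>w\<leftarrow>[- int (6 * B * k)..int (6 * B * k)]. real (126 * k) + 1 / 2 - of_int w - real k)"
        by (rule prod_pole_block_ge)
      moreover have "126 * k - k + 6 * B * k = (125 + 6 * B) * k" "126 * k - k - 6 * B * k = (125 - 6 * B) * k"
        by (simp_all add: algebra_simps diff_mult_distrib)
      ultimately show ?thesis by (simp add: fact_ratio_def)
    qed
    have "(\<Prod>B\<leftarrow>xs. fact_ratio k B) \<le>
      (\<Prod>B\<leftarrow>xs. \<Prod>w\<leftarrow>[- int (6 * B * k)..int (6 * B * k)]. real (126 * k) + 1 / 2 - of_int w - real k)"
      if "set xs \<subseteq> set radii" for xs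
      using that
    proof (induction xs)
      case (Cons B xs)
      let ?P = "\<lambda>B. (\<Prod>w\<leftarrow>[- int (6 * B * k)..int (6 * B * k)]. real (126 * k) + 1 / 2 - of_int w - real k)"
      have "fact_ratio k B * (\<Prod>B\<leftarrow>xs. fact_ratio k B)
         \<le> ?P B * (\<Prod>B\<leftarrow>xs. ?P B)"
      proof (rule mult_mono)
        show "fact_ratio k B \<le> ?P B" using Cons.prems by (intro blk) auto
        show "(\<Prod>B\<leftarrow>xs. fact_ratio k B) \<le> (\<Prod>B\<leftarrow>xs. ?P B)" using Cons by auto
        show "0 \<le> ?P B" using blk[of B] Cons.prems
          by (meson fact_ratio_pos less_imp_le list.set_intros(1) order_trans subsetD)
        show "0 \<le> (\<Prod>B\<leftarrow>xs. fact_ratio k B)"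
          by (intro prod_list_nonneg) (auto simp: fact_ratio_pos less_imp_le)
      qed
      then show ?case by simp
    qed simp
    from this[of radii] show ?thesis unfolding prod_shifted_poles pole_radii_eq by (simp add: o_def)
  qed
  have "approx_form k \<le> fact (2 * (126 * k)) * (real (126 * k) + 1 / 2) * ?\<kappa> / (\<Prod>a\<leftarrow>?as. a - real k)"
    unfolding approx_form_def by (rule B(2))
  also have "\<dots> \<le> fact (2 * (126 * k)) * (real (126 * k) + 1 / 2) * ?\<kappa> / (\<Prod>B\<leftarrow>radii. fact_ratio k B)"
  proof (rule divide_left_mono[OF le])
    have "0 \<le> fact n * (real i + 1 / 2) * (a / b) ^ k" if "a > 0" "b > 0" for n i :: nat and a b :: real using that by simp
    then show "0 \<le> fact (2 * (126 * k)) * (real (126 * k) + 1 / 2) * ?\<kappa>" by (meson zero_less_numeral zero_less_power)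
    show "0 < (\<Prod>a\<leftarrow>?as. a - real k) * (\<Prod>B\<leftarrow>radii. fact_ratio k B)"
      using pos le by (intro mult_pos_pos) linarith+
  qed
  also have "2 * (126 * k) = 252 * k" by linarith
  finally show "approx_form k \<le> fact (252 * k) * (real (126 * k) + 1 / 2) * ?\<kappa> /
      (\<Prod>B\<leftarrow>radii. fact_ratio k B)" .
qed

lemma ln_approx_form_le:
  assumes k: "k > 0"
  shows "ln (approx_form k) \<le> ln (fact (252 * k)) + ln (real (126 * k) + 1 / 2) + real k * (251 * ln 251 - 252 * ln 252)
     - (\<Sum>B\<leftarrow>radii. ln (fact ((125 + 6 * B) * k)) - ln (fact ((125 - 6 * B) * k)))"
proof -
  let ?P = "\<Prod>B\<leftarrow>radii. fact_ratio k B"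
  let ?\<kappa> = "251 ^ 251 / 252 ^ 252 :: real"
  have P: "ln ?P = (\<Sum>B\<leftarrow>radii. ln (fact_ratio k B))" "?P > 0"
    using ln_prod_list[of radii "fact_ratio k"] by (auto simp: fact_ratio_pos)
  have P': "ln ?P = (\<Sum>B\<leftarrow>radii. ln (fact ((125 + 6 * B) * k)) - ln (fact ((125 - 6 * B) * k)))"
    unfolding P(1) by (simp add: fact_ratio_def ln_div)
  have lk: "ln ?\<kappa> = 251 * ln 251 - 252 * ln 252"
  proof -
    have "ln ((a::real) ^ n / b ^ m) = real n * ln a - real m * ln b" if "a > 0" "b > 0" for a b n m
      using that by (simp add: ln_div ln_realpow)
    from this[of 251 252 251 252] show ?thesis by (simp only: of_nat_numeral zero_less_numeral)
  qed
  have k0: "?\<kappa> > 0" by (meson zero_less_divide_iff zero_less_numeral zero_less_power)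
  have q0: "real (126 * k) + 1 / 2 > 0" by simp
  have eq: "ln (F * q * \<kappa> ^ k / p) = ln F + ln q + real k * ln \<kappa> - ln p" if "F > 0" "q > 0" "\<kappa> > 0" "p > 0" for F q \<kappa> p :: real
    using that by (simp add: ln_div ln_mult ln_realpow)
  have "ln (approx_form k) \<le> ln (fact (252 * k) * (real (126 * k) + 1 / 2) * ?\<kappa> ^ k / ?P)"
    by (rule ln_mono; rule approx_form_bounds[OF k])
  also have "\<dots> = ln (fact (252 * k)) + ln (real (126 * k) + 1 / 2) + real k * ln ?\<kappa> - ln ?P"
    by (rule eq[OF _ q0 k0 P(2)]) simp
  finally show ?thesis unfolding lk P' .
qed

lemma ln_denom_le:
  assumes k: "k > 0"
  shows "ln (real (denom (6 * k))) \<le> 7 * ln (fact (72 * k)) + 504 * real k * ln 2 + 76 * 504 powr (3 / 4) * real k powr (3 / 4)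
    + weight_sum (6 * k)"
proof -
  let ?m = "6 * k" and ?X = "504 * k"
  have pos: "p > 0" if "p \<in> small_primes ?m \<union> large_primes ?m" for p
    using that by (auto simp: small_primes_def large_primes_def prime_gt_0_nat)
  have "ln (real (denom ?m)) = 7 * ln (fact (72 * k)) + 504 * real k * ln 2
     + (\<Sum>p\<in>small_primes ?m. ln (real (p ^ (19 * log_floor p (84 * ?m)))))
     + (\<Sum>p\<in>large_primes ?m. ln (real (p ^ nat (weight (int ?m) (int p)))))"
  proof -
    have "ln (F ^ 7 * 2 ^ n * a * b) = 7 * ln F + real n * ln 2 + ln a + ln b" if "F > 0" "a > 0" "b > 0" for F a b :: real and n
      using that by (simp add: ln_mult ln_realpow)
    from this[of "fact (12 * ?m)" "real (\<Prod>p\<in>small_primes ?m. p ^ (19 * log_floor p (84 * ?m)))"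
        "real (\<Prod>p\<in>large_primes ?m. p ^ nat (weight (int ?m) (int p)))" "84 * ?m"]
    have "ln (real (denom ?m)) = 7 * ln (fact (12 * ?m)) + real (84 * ?m) * ln 2
       + ln (real (\<Prod>p\<in>small_primes ?m. p ^ (19 * log_floor p (84 * ?m))))
       + ln (real (\<Prod>p\<in>large_primes ?m. p ^ nat (weight (int ?m) (int p))))"
      using pos by (simp add: denom_def prod_pos)
    moreover have ln_nat_prod: "ln (real (prod f A)) = (\<Sum>p\<in>A. ln (real (f p)))" if "finite A" "\<And>p. p \<in> A \<Longrightarrow> f p > 0" for f and A :: "nat set"
      using that by (subst of_nat_prod, subst ln_prod) auto
    moreover have "ln (real (\<Prod>p\<in>small_primes ?m. p ^ (19 * log_floor p (84 * ?m)))) = (\<Sum>p\<in>small_primes ?m. ln (real (p ^ (19 * log_floor p (84 * ?m)))))"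
      "ln (real (\<Prod>p\<in>large_primes ?m. p ^ nat (weight (int ?m) (int p)))) = (\<Sum>p\<in>large_primes ?m. ln (real (p ^ nat (weight (int ?m) (int p)))))"
      by (rule ln_nat_prod; use pos in simp)+
    moreover have "12 * ?m = 72 * k" "real (84 * ?m) = 504 * real k" by simp_all
    ultimately show ?thesis by (simp only:)
  qed
  moreover have "(\<Sum>p\<in>small_primes ?m. ln (real (p ^ (19 * log_floor p (84 * ?m))))) \<le> 76 * 504 powr (3 / 4) * real k powr (3 / 4)"
  proof -
    have X1: "real ?X \<ge> 1" using k by simp
    \<comment> \<open>76 = 19 * 4, from ln X \<le> 4 X^(1/4). There are at most X^(1/2) small
      primes, which yields the exponent 3/4.\<close>
    have "ln (real (p ^ (19 * log_floor p (84 * ?m)))) \<le> 76 * real ?X powr (1 / 4)" if "p \<in> small_primes ?m" for p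
    proof -
      have p: "prime p" using that by (simp add: small_primes_def)
      have "real (p ^ log_floor p ?X) \<le> real ?X" 
        by (rule of_nat_mono, rule log_floor_bounds(1)[OF p]) (use k in simp)
      then have "ln (real (p ^ log_floor p ?X)) \<le> ln (real ?X)"
        using p by (intro ln_mono) (auto simp: prime_gt_0_nat)
      also have "\<dots> \<le> 4 * real ?X powr (1 / 4)" by (rule ln_le_powr_quarter[OF X1])
      finally have "19 * ln (real (p ^ log_floor p ?X)) \<le> 76 * real ?X powr (1 / 4)" by simp
      moreover have "ln (real (p ^ (19 * log_floor p (84 * ?m)))) = 19 * ln (real (p ^ log_floor p ?X))"
        using p by (simp add: ln_realpow prime_gt_0_nat)
      ultimately show ?thesis by simp
    qed
    then have "(\<Sum>p\<in>small_primes ?m. ln (real (p ^ (19 * log_floor p (84 * ?m))))) \<le> of_nat (card (small_primes ?m)) * (76 * real ?X powr (1 / 4))"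
      by (rule sum_bounded_above)
    also have "\<dots> \<le> real ?X powr (1 / 2) * (76 * real ?X powr (1 / 4))"
    proof (rule mult_right_mono)
      have "small_primes ?m \<subseteq> {1..nat \<lfloor>sqrt (real ?X)\<rfloor>}"
      proof
        fix p assume "p \<in> small_primes ?m"
        then have "p ^ 2 \<le> ?X" "p \<ge> 1" by (auto simp: small_primes_def dest: prime_gt_0_nat)
        then have "real (p ^ 2) \<le> real ?X" by (intro of_nat_mono)
        then have "real p \<le> sqrt (real ?X)" by (intro real_le_rsqrt) simp
        then show "p \<in> {1..nat \<lfloor>sqrt (real ?X)\<rfloor>}" using \<open>p \<ge> 1\<close> by (simp add: le_nat_floor)
      qed
      then have "card (small_primes ?m) \<le> nat \<lfloor>sqrt (real ?X)\<rfloor>"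
        using card_mono[of "{1..nat \<lfloor>sqrt (real ?X)\<rfloor>}" "small_primes ?m"] by simp
      moreover have "real (nat \<lfloor>sqrt (real ?X)\<rfloor>) \<le> sqrt (real ?X)" by (intro of_nat_floor) simp
      ultimately have "real (card (small_primes ?m)) \<le> sqrt (real ?X)" by linarith
      then show "real (card (small_primes ?m)) \<le> real ?X powr (1 / 2)" by (simp add: powr_half_sqrt)
    qed simp
    also have "\<dots> = 76 * (real ?X powr (1 / 2) * real ?X powr (1 / 4))" by simp
    also have "real ?X powr (1 / 2) * real ?X powr (1 / 4) = real ?X powr (3 / 4)" by (simp flip: powr_add)
    also have "\<dots> = 504 powr (3 / 4) * real k powr (3 / 4)" by (simp add: powr_mult)
    finally show ?thesis by simp
  qed
  moreover have "(\<Sum>p\<in>large_primes ?m. ln (real (p ^ nat (weight (int ?m) (int p)))))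
     \<le> weight_sum ?m"
  proof -
    have "(\<Sum>p\<in>large_primes ?m. ln (real (p ^ nat (weight (int ?m) (int p)))))
       = (\<Sum>p\<in>large_primes ?m. ln (real p) * of_int (weight (int ?m) (int p)))"
      using pos weight_nonneg by (intro sum.cong refl) (simp add: ln_realpow)
    also have "\<dots> \<le> weight_sum ?m"
      unfolding weight_sum_def
    proof (rule sum_mono2)
      show "finite {p. prime p \<and> p \<le> 16 * ?m}" by (rule finite_subset[of _ "{..16 * ?m}"]) auto
    qed (auto simp: large_primes_def ln_prime_nonneg weight_nonneg intro!: mult_nonneg_nonneg)
    finally show ?thesis .
  qed
  ultimately show ?thesis by linarith
qed

text \<open>The product is an integer by \<open>linear_form_integral\<close> and positive by
  \<open>approx_form_bounds\<close>. The condition k \<ge> 7 provides 6 k \<ge> 42 for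
  \<open>denom_admissible\<close>.\<close>

lemma approx_form_integral:
  fixes Q :: int
  assumes "k \<ge> 7" "Q > 0" "\<And>s. s \<in> {2, 4, 6, 8, 10} \<Longrightarrow> of_int Q * dirichlet_beta s \<in> \<int>"
  shows "1 \<le> of_int Q * real (denom (6 * k)) * approx_form k"
proof -
  let ?ns = "pole_radii (int (6 * k))" and ?M = "8 * int (6 * k)"
  have h: "21 * int (6 * k) = int (126 * k)" by simp
  have len: "nat (2 * int (126 * k)) + 1 < (\<Sum>n\<leftarrow>?ns. nat (2 * n + 1))"
    using assms(1) by (simp add: pole_radii_def Bs_def nat_add_distrib nat_mult_distrib)
  have l11: "length ?ns = 11" by (simp add: pole_radii_def Bs_def)
  define T where "T = (\<Sum>v\<in>{- ?M..?M}. \<Sum>k'<pole_order ?ns v. (- 1) ^ nat \<bar>v\<bar> * pole_series ?ns (int (126 * k)) ?M v $ k' *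
       ((if even (pole_order ?ns v - k') then 2 ^ (pole_order ?ns v - k') * dirichlet_beta (pole_order ?ns v - k') else 0)
        + beta_tail (pole_order ?ns v - k') v))"
  have "(\<lambda>t. (- 1) ^ t * wp_ratio ?ns (int (126 * k)) ?M (real t + 1 / 2)) sums T"
    unfolding T_def by (rule wp_ratio_linear_form[OF _ pole_radii_bounds len]) (use l11 in \<open>simp_all del: of_nat_mult\<close>)
  from suminf_wp_ratio[OF pole_radii_bounds this]
  have A: "approx_form k = (- 1) ^ (126 * k) * T" unfolding approx_form_def by (simp add: sums_iff)
  have "of_int Q * real (denom (6 * k)) * T \<in> \<int>"
    unfolding T_def
  proof (rule linear_form_integral)
    fix i :: nat assume i: "even i" "2 \<le> i" "i \<le> length ?ns"
    then have "i \<in> {2, 4, 6, 8, 10}" unfolding l11 by (auto elim!: evenE)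
    then show "of_int Q * dirichlet_beta i \<in> \<int>" by (rule assms(3))
  next
    fix p :: nat assume "prime p"
    then show "\<exists>C. vge p C (real (denom (6 * k))) \<and> (\<forall>v\<in>{- ?M..?M}. \<exists>L. 2 * \<bar>v\<bar> \<le> int p ^ Suc L \<and>
       (\<forall>k'<pole_order ?ns v. vge p (int L * (int (pole_order ?ns v) - int k') - C) (pole_series ?ns (int (126 * k)) ?M v $ k')))"
      using denom_admissible[of "6 * k" p] assms(1) unfolding h by simp
  qed
  then have "(- 1) ^ (126 * k) * (of_int Q * real (denom (6 * k)) * T) \<in> \<int>" by (rule Ints_mult[rotated]) auto
  then have "of_int Q * real (denom (6 * k)) * approx_form k \<in> \<int>" unfolding A by (simp add: mult_ac)
  then obtain z where z: "of_int Q * real (denom (6 * k)) * approx_form k = of_int z" by (elim Ints_cases)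
  have "0 < of_int Q * real (denom (6 * k)) * approx_form k"
    using assms denom_pos[of "6 * k"] approx_form_bounds(1)[of k] by (intro mult_pos_pos) auto
  then show ?thesis unfolding z by simp
qed

text \<open>Both the \<open>l\<close> terms and the linear terms of Stirling's formula cancel, since
  7 * 72 + 252 = 756 is the total of (125 + 6 B) - (125 - 6 B) over \<open>radii\<close>. What is
  left is \<open>numeric_bound\<close> times \<open>k\<close>.\<close>

lemma ln_form_bound:
  "\<exists>C. \<forall>k>0. weight_sum (6 * k) \<le> 499 * real k \<longrightarrow>
    ln (real (denom (6 * k))) + ln (approx_form k) \<le> C * real k powr (3 / 4) - real k"
proof -
  define e where "e c = ln (real c) + 5" for c
  define C where "C = 7 * e 72 + 76 * 504 powr (3 / 4) + e 252 + e 127 + (\<Sum>B\<leftarrow>radii. e (125 - 6 * B))"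
  have "ln (real (denom (6 * k))) + ln (approx_form k) \<le> C * real k powr (3 / 4) - real k"
    if k: "k > 0" and W: "weight_sum (6 * k) \<le> 499 * real k" for k
  proof -
    define K where "K = real k"
    define R where "R = real k powr (3 / 4)"
    define l where "l = real k * ln (real k)"
    have up: "ln (fact (c * k) :: real) \<le> K * (real c * ln (real c) - real c) + real c * l + e c * R" if "c > 0" for c
      using ln_fact_scaled(1)[OF that k] by (simp add: K_def R_def l_def e_def)
    have low: "K * (real c * ln (real c) - real c) + real c * l \<le> ln (fact (c * k) :: real)" if "c > 0" for c
      using ln_fact_scaled(2)[OF that k] by (simp add: K_def l_def)
    have half: "ln (real (126 * k) + 1 / 2) \<le> e 127 * R"
    proof -
      have "ln (real (126 * k) + 1 / 2) \<le> ln (real (127 * k))" using k by (intro ln_mono) auto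
      also have "\<dots> = ln 127 + ln (real k)" using k by (simp add: ln_mult)
      also have "\<dots> \<le> ln 127 * R + 4 * R"
      proof (rule add_mono)
        have R1: "1 \<le> R" using k by (simp add: R_def ge_one_powr_ge_zero)
        then show "ln 127 \<le> ln 127 * R" by (simp add: mult_le_cancel_left1)
        have "ln (real k) \<le> 4 * real k powr (1 / 4)" using k by (intro ln_le_powr_quarter) simp
        also have "\<dots> \<le> 4 * R" unfolding R_def using k by (intro mult_left_mono powr_mono) auto
        finally show "ln (real k) \<le> 4 * R" .
      qed
      also have "\<dots> \<le> e 127 * R"
      proof -
        have "0 \<le> R" by (simp add: R_def)
        then show ?thesis by (simp add: e_def distrib_right)
      qed
      finally show ?thesis .
    qed
    have S: "(\<Sum>B\<leftarrow>radii. (K * (real (125 + 6 * B) * ln (real (125 + 6 * B)) - real (125 + 6 * B)) + real (125 + 6 * B) * l)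
        - (K * (real (125 - 6 * B) * ln (real (125 - 6 * B)) - real (125 - 6 * B)) + real (125 - 6 * B) * l + e (125 - 6 * B) * R))
       \<le> (\<Sum>B\<leftarrow>radii. ln (fact ((125 + 6 * B) * k)) - ln (fact ((125 - 6 * B) * k)))"
    proof (rule sum_list_mono)
      fix B assume "B \<in> set radii"
      then have "125 - 6 * B > 0" by (auto simp: radii_def)
      then show "(K * (real (125 + 6 * B) * ln (real (125 + 6 * B)) - real (125 + 6 * B)) + real (125 + 6 * B) * l)
        - (K * (real (125 - 6 * B) * ln (real (125 - 6 * B)) - real (125 - 6 * B)) + real (125 - 6 * B) * l + e (125 - 6 * B) * R)
        \<le> ln (fact ((125 + 6 * B) * k)) - ln (fact ((125 - 6 * B) * k))"
        using low[of "125 + 6 * B"] up[of "125 - 6 * B"] by linarith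
    qed
    have N: "K * (504 * ln 72 + 504 * ln 2 + 251 * ln 251 + 499 +
       (107 * ln 107 + 2 * (101 * ln 101) + 2 * (95 * ln 95) + 2 * (89 * ln 89) + 2 * (83 * ln 83) + 2 * (77 * ln 77))) \<le>
       K * (143 * ln 143 + 2 * (149 * ln 149) + 2 * (155 * ln 155) + 2 * (161 * ln 161) + 2 * (167 * ln 167) + 2 * (173 * ln 173) - 1)"
      using numeric_bound by (intro mult_left_mono) (auto simp: K_def)
    have D: "ln (real (denom (6 * k))) \<le> 7 * (K * (72 * ln 72 - 72) + 72 * l + e 72 * R) + 504 * K * ln 2 + 76 * 504 powr (3 / 4) * R + 499 * K"
      using ln_denom_le[OF k] up[of 72] W by (simp add: K_def R_def)
    have A: "ln (approx_form k) \<le> (K * (252 * ln 252 - 252) + 252 * l + e 252 * R) + e 127 * R + K * (251 * ln 251 - 252 * ln 252)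
       - (\<Sum>B\<leftarrow>radii. (K * (real (125 + 6 * B) * ln (real (125 + 6 * B)) - real (125 + 6 * B)) + real (125 + 6 * B) * l)
        - (K * (real (125 - 6 * B) * ln (real (125 - 6 * B)) - real (125 - 6 * B)) + real (125 - 6 * B) * l + e (125 - 6 * B) * R))"
      using ln_approx_form_le[OF k] up[of 252] half S by (simp add: K_def)
    show ?thesis
      unfolding R_def[symmetric] unfolding K_def[symmetric] using D A N
      by (simp add: C_def radii_def algebra_simps)
  qed
  then show ?thesis by blast
qed

theorem theorem6p1:
  shows "\<exists>s \<in> {2, 4, 6, 8, 10}. dirichlet_beta s \<notin> \<rat>"
proof (rule ccontr)
  assume "\<not> ?thesis"
  then have "\<And>s. s \<in> {2, 4, 6, 8, 10} \<Longrightarrow> dirichlet_beta s \<in> \<rat>" by blast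
  then obtain Q :: int where Q: "Q > 0" "\<And>s. s \<in> {2, 4, 6, 8, 10} \<Longrightarrow> of_int Q * dirichlet_beta s \<in> \<int>"
    using common_denominator[of "{2, 4, 6, 8, 10}" dirichlet_beta] by (metis finite.emptyI finite.insertI)
  obtain C where C: "\<And>k. k > 0 \<Longrightarrow>
    weight_sum (6 * k) \<le> 499 * real k \<Longrightarrow>
    ln (real (denom (6 * k))) + ln (approx_form k) \<le> C * real k powr (3 / 4) - real k"
    using ln_form_bound by blast
  \<comment> \<open>Once c^4 \<le> k, also c k^(3/4) \<le> k, while the estimates give k \<le> (c -
    1) k^(3/4).\<close>
  define c where "c = \<bar>C\<bar> + ln (of_int Q) + 1"
  have lQ: "ln (of_int Q :: real) \<ge> 0" using Q(1) by simp
  obtain k where k: "k \<ge> max 7 (nat \<lceil>c ^ 4\<rceil>)"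
    and W: "weight_sum (6 * k) \<le> 499 * real k"
    using weight_sum_small by blast
  have k7: "k \<ge> 7" and kc: "c ^ 4 \<le> real k" using k by (auto simp: nat_le_iff ceiling_le_iff)
  have A0: "approx_form k > 0" "real (denom (6 * k)) > 0"
    using approx_form_bounds(1)[of k] denom_pos[of "6 * k"] k7 by auto
  have "0 \<le> ln (of_int Q * real (denom (6 * k)) * approx_form k)"
    using approx_form_integral[OF k7 Q] by simp
  also have "\<dots> = ln (of_int Q) + (ln (real (denom (6 * k))) + ln (approx_form k))"
    using Q(1) A0 by (simp add: ln_mult)
  also have "\<dots> \<le> ln (of_int Q) + (C * real k powr (3 / 4) - real k)"
    using C[OF _ W] k7 by simp
  finally have 1: "real k \<le> ln (of_int Q) + C * real k powr (3 / 4)" by simp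
  have R1: "1 \<le> real k powr (3 / 4)" using k7 by (simp add: ge_one_powr_ge_zero)
  have "ln (of_int Q) \<le> ln (of_int Q) * real k powr (3 / 4)" using lQ R1 by (simp add: mult_le_cancel_left1)
  moreover have "C * real k powr (3 / 4) \<le> \<bar>C\<bar> * real k powr (3 / 4)" by (intro mult_right_mono) auto
  ultimately have 2: "real k \<le> (c - 1) * real k powr (3 / 4)" using 1 by (simp add: c_def algebra_simps)
  have "c \<le> real k powr (1 / 4)"
  proof -
    have c0: "c > 0" using lQ by (simp add: c_def)
    have "c = (c ^ 4) powr (1 / 4)" using c0 by (simp add: powr_powr flip: powr_numeral)
    also have "\<dots> \<le> real k powr (1 / 4)" using kc c0 by (intro powr_mono2) auto
    finally show ?thesis .
  qed
  then have "c * real k powr (3 / 4) \<le> real k powr (1 / 4) * real k powr (3 / 4)" by (intro mult_right_mono) auto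
  also have "\<dots> = real k" using k7 by (simp flip: powr_add)
  finally have "c * real k powr (3 / 4) \<le> (c - 1) * real k powr (3 / 4)" using 2 by linarith
  then show False using R1 by (simp add: algebra_simps)
qed

end
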